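(* Let $f:X\to S$ be a semistable degeneration of curves (with at worst double points on its special fibre). Then the class $[N]\in H^0(\tilde T^{(3)},\mathbf{Q})$ has, around $(P,P)$ for $P$ a double point of $Y$, the following description: $$[N]=a_{125}1_{T_{125}}+a_{135}1_{T_{135}}+a_{245}1_{T_{245}}+a_{345}1_{T_{345}},$$ where the rational numbers $a_{125},a_{135},a_{245},a_{345}$ are subject to the requirement $$-2a_{125}+2a_{135}-2a_{245}+2a_{345}=1.$$ The induced class $[N]$ in $gr^L_0H^2(T,\mathbf{Q})$ (i.e. modulo boundary relations via the restriction map $\rho^{(3)}$) determines a unique zero-cycle.
   Context: Setting. $X$ is a connected smooth complex surface, $S$ the unit disk, $f:X\to S$ a projective semistable degeneration of curves: $f$ is smooth over $S\setminus\{0\}$ and around a double point $P$ of the special fibre $Y=f^{-1}(0)$ one has $f=z_1z_2$ in local parameters $z_1,z_2$ at $P$; locally $Y=Y_1\cup Y_2$ with $Y_i=\{z_i=0\}$ and $Y_{12}=Y_1\cap Y_2=\{P\}$. Let $w_1,w_2$ be a second copy of these parameters, so $X\times_SX$ is $z_1z_2=w_1w_2$ near $(P,P)$. The model $Z$. $h:Z\to S$ is obtained by blowing up $X\times_SX$ at each such point $(P,P)$ (origin of the coordinates $z_1,z_2,w_1,w_2$). Near $(P,P)$ its special fibre is $T=\bigcup_{i=1}^5T_i$, where $T_1,T_2,T_3,T_4$ are the strict transforms of $Y_1\times Y_1$, $Y_1\times Y_2$, $Y_2\times Y_1$, $Y_2\times Y_2$, and $T_5$ is the exceptional divisor. $\tilde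 T^{(j)}$ is the disjoint union of the $j$-fold intersections $T_{i_1\dots i_j}=T_{i_1}\cap\dots\cap T_{i_j}$, $i_1<\dots<i_j$ (components taken with reduced structure); $\tilde Y^{(j)}$ is defined similarly. Locally $\tilde T^{(3)}$ consists of the four points $T_{125},T_{135},T_{245},T_{345}$; $1_V$ is the unit class in $H^0(V,\mathbf{Q})$. The restriction $\rho^{(j)}:H^*(\tilde T^{(j-1)})\to H^*(\tilde T^{(j)})$ is $\sum_{u=1}^j(-1)^{u-1}(\delta_u^{(j)})^*$ with $\delta_u^{(j)}$ the inclusion omitting the $u$-th component. The class $[N]$. Let $N$ be the logarithm of the local monodromy on the limiting cohomology $H^*(\tilde X^*,\mathbf{Q})$, where $\tilde X^*$ is the pullback of $X$ to the universal cover of $S\setminus\{0\}$. It defines a Hodge class in $gr^L_0H^2(T,\mathbf{Q})\simeq H^0(\tilde T^{(3)},\mathbf{Q})/\mathrm{Im}\big(\rho^{(3)}:H^0(\tilde T^{(2)},\mathbf{Q})\to H^0(\tilde T^{(3)},\mathbf{Q})\big)$ ($L$ the monodromy-weight filtration), and $[N]\in E_1^{2,0}(Z)=H^0(\tilde T^{(3)},\mathbf{Q})$ denotes a cocycle representing it; it is determined by the requirement that $$H^0(\tilde Y^{(2)},\mathbf{Q})(-1)\xrightarrow{\ p_1^*\ }H^0(\tilde T^{(2)},\mathbf{Q})(-1)\xrightarrow{\ [N]\cdot\ }H^2(\tilde T^{(2)},\mathbf{Q})\xrightarrow{\ (p_2)_*\ }H^0(\tilde Y^{(2)},\mathbf{Q})(-1)$$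 be the identity (this is the map representing $N:gr^L_2H^1(\tilde X^*,\mathbf{Q})\to (gr^L_0H^1(\tilde X^*,\mathbf{Q}))(-1)$ on the $E_1$-terms of the weight spectral sequences). Here: (i) $p_1,p_2:Z\to X$ are the projections. The pullback $p_i^*$ on strata is the one induced by pullback of logarithmic forms via Poincaré residues: the coefficient of $p_i^*(1_{Y_{12}})$ along $T_{jk}$ ($j<k$) is the coefficient of $\frac{du_j}{u_j}\wedge\frac{du_k}{u_k}$ ($u_j,u_k$ local equations of $T_j,T_k$) in $p_1^*(\frac{dz_1}{z_1}\wedge\frac{dz_2}{z_2})$, resp. $p_2^*(\frac{dw_1}{w_1}\wedge\frac{dw_2}{w_2})$. $(p_2)_*$ is the Poincaré dual of $p_2^*$ on strata. (ii) The product. For $I=\{i_0<\dots<i_m\}$, $J=\{j_0<\dots<j_n\}$, call $(I,J)$ admissible if there is $p$ with $i_m=j_p$ and $\{j_0,\dots,j_p\}\subset I$. Then write $j_s=i_{b_s}$ ($0\le s\le p-1$), $a(I,J)=b_0+\dots+b_{p-1}+mp$, $K=(I\setminus\{j_0,\dots,j_{p-1}\})\cup\{j_p,\dots,j_n\}$, and for $x\in H^\alpha(T_I)$, $y\in H^\beta(T_J)$ set $x\cdot y:=(-1)^{a(I,J)}g_{j_0}\circ\cdots\circ g_{j_{p-1}}(x|_{T_{I\cup J}}\cup y|_{T_{I\cup J}})\in H^{\alpha+\beta+2p}(T_K)$, where $g_j$ is the Gysin map of the inclusion obtained by dropping the index $j$. If $(I,J)$ is not admissible, the product is $0$. Tate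 twists are carried along. *)

theory Defs
  imports "HOL-Analysis.Analysis" "HOL-Homology.Homology"
begin

section \<open>Holomorphic maps, projective space, complex manifolds\<close>

text \<open>Holomorphic in several variables: continuously differentiable with complex linear
  derivative.\<close>

definition holomorphic_fun :: "(complex^'n \<Rightarrow> complex) \<Rightarrow> (complex^'n) set \<Rightarrow> bool" where
  "holomorphic_fun g D \<longleftrightarrow> open D \<and>
     (\<forall>x\<in>D. g differentiable (at x) \<and>
        (\<forall>c v. frechet_derivative g (at x) (c *s v) = c * frechet_derivative g (at x) v)) \<and>
     (\<forall>v. continuous_on D (\<lambda>x. frechet_derivative g (at x) v))"

definition holomorphic_map :: "(complex^'n \<Rightarrow> complex^'m) \<Rightarrow> (complex^'n) set \<Rightarrow> bool" where
  "holomorphic_map F D \<longleftrightarrow> (\<forall>i. holomorphic_fun (\<lambda>x. F x $ i) D)"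

text \<open>Projective space, of dimension \<open>CARD('n) - 1\<close>, is the set of lines of \<open>complex^'n\<close> with
  the quotient topology.\<close>

typedef ('n::finite) proj = "{L :: (complex^'n) set. \<exists>v. v \<noteq> 0 \<and> L = range (\<lambda>c. c *s v)}"
  by (auto intro!: exI[of _ "axis undefined 1"])

definition proj_pt :: "complex^'n \<Rightarrow> 'n proj" where
  "proj_pt v = Abs_proj (range (\<lambda>c. c *s v))"

instantiation proj :: (finite) topological_space
begin

definition open_proj :: "'a proj set \<Rightarrow> bool" where
  "open_proj W \<longleftrightarrow> open {v. v \<noteq> 0 \<and> proj_pt v \<in> W}"

instance
proof
  show "open (UNIV :: 'a proj set)"
    by (auto simp: open_proj_def open_Collect_neq)
next
  fix S T :: "'a proj set"
  assume "open S" "open T"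
  moreover have "{v. v \<noteq> 0 \<and> proj_pt v \<in> S \<inter> T}
      = {v. v \<noteq> 0 \<and> proj_pt v \<in> S} \<inter> {v. v \<noteq> 0 \<and> proj_pt v \<in> T}" by blast
  ultimately show "open (S \<inter> T)"
    by (auto simp only: open_proj_def intro: open_Int)
next
  fix K :: "'a proj set set"
  assume "\<forall>S\<in>K. open S"
  moreover have "{v. v \<noteq> 0 \<and> proj_pt v \<in> \<Union>K} = (\<Union>S\<in>K. {v. v \<noteq> 0 \<and> proj_pt v \<in> S})" by blast
  ultimately show "open (\<Union>K)"
    by (auto simp only: open_proj_def intro: open_UN)
qed

end

text \<open>\<open>u \<mapsto> (G u, p u)\<close> is a holomorphic immersion of \<open>D\<close> into affine times projective space.
  Locally \<open>p = [F]\<close>, and a tangent vector \<open>v\<close> is killed by the derivative of \<open>p\<close> iff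
  \<open>dF(v)\<close> is a multiple of \<open>F\<close>.\<close>

definition holomorphic_immersion ::
  "(complex^'n \<Rightarrow> complex^'k) \<Rightarrow> (complex^'n \<Rightarrow> 'm::finite proj) \<Rightarrow> (complex^'n) set \<Rightarrow> bool" where
  "holomorphic_immersion G p D \<longleftrightarrow> holomorphic_map G D \<and>
     (\<forall>x\<in>D. \<exists>W F. x \<in> W \<and> W \<subseteq> D \<and> holomorphic_map F W \<and>
        (\<forall>y\<in>W. F y \<noteq> 0 \<and> p y = proj_pt (F y)) \<and>
        (\<forall>v. (\<forall>i. frechet_derivative (\<lambda>y. G y $ i) (at x) v = 0) \<and>
             (\<exists>c. \<forall>i. frechet_derivative (\<lambda>y. F y $ i) (at x) v = c * F x $ i) \<longrightarrow> v = 0))"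

type_synonym ('x, 'n) chart = "'x set \<times> ('x \<Rightarrow> complex^'n)"

text \<open>A chart of the maximal atlas determined by \<open>A\<close>.\<close>

definition compatible_chart ::
  "('x::topological_space, 'n::finite) chart set \<Rightarrow> 'x set \<Rightarrow> ('x \<Rightarrow> complex^'n) \<Rightarrow> bool" where
  "compatible_chart A U \<phi> \<longleftrightarrow> open U \<and> open (\<phi> ` U) \<and>
     homeomorphism U (\<phi> ` U) \<phi> (the_inv_into U \<phi>) \<and>
     (\<forall>(V, \<psi>)\<in>A. holomorphic_map (\<psi> \<circ> the_inv_into U \<phi>) (\<phi> ` (U \<inter> V)) \<and>
                 holomorphic_map (\<phi> \<circ> the_inv_into V \<psi>) (\<psi> ` (U \<inter> V)))"

definition complex_atlas :: "('x::topological_space, 'n::finite) chart set \<Rightarrow> bool" where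
  "complex_atlas A \<longleftrightarrow> (\<Union>(U, \<phi>)\<in>A. U) = UNIV \<and> (\<forall>(U, \<phi>)\<in>A. compatible_chart A U \<phi>)"

section \<open>Semistable degenerations of curves over the unit disk\<close>

text \<open>Parameters \<open>z\<close> centred at a double point \<open>P\<close> of the special fibre, on a polydisk.\<close>

definition local_parameters ::
  "('x::topological_space, 2) chart set \<Rightarrow> ('x \<Rightarrow> complex) \<Rightarrow> 'x \<Rightarrow> 'x set \<Rightarrow> ('x \<Rightarrow> complex^2) \<Rightarrow> bool"
  where
  "local_parameters A f P U z \<longleftrightarrow> compatible_chart A U z \<and> P \<in> U \<and> z P = 0 \<and>
     (\<exists>r>0. z ` U = {v. \<forall>i. norm (v $ i) < r}) \<and>
     (\<forall>x\<in>U. f x = z x $ 1 * z x $ 2)"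

definition double_point ::
  "('x::topological_space, 2) chart set \<Rightarrow> ('x \<Rightarrow> complex) \<Rightarrow> 'x \<Rightarrow> bool" where
  "double_point A f P \<longleftrightarrow> (\<exists>U z. local_parameters A f P U z)"

definition smooth_at ::
  "('x::topological_space, 2) chart set \<Rightarrow> ('x \<Rightarrow> complex) \<Rightarrow> 'x \<Rightarrow> bool" where
  "smooth_at A f x \<longleftrightarrow> (\<exists>(U, \<phi>)\<in>A. x \<in> U \<and>
     (\<exists>v. frechet_derivative (f \<circ> the_inv_into U \<phi>) (at (\<phi> x)) v \<noteq> 0))"

text \<open>\<open>f\<close> is projective: \<open>(\<iota>, f)\<close> is a closed holomorphic embedding of the surface into
  (projective space) times (unit disk).\<close>

definition projective_by ::
  "('x::topological_space, 2) chart set \<Rightarrow> ('x \<Rightarrow> complex) \<Rightarrow> ('x \<Rightarrow> 'm::finite proj) \<Rightarrow> bool" where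
  "projective_by A f \<iota> \<longleftrightarrow>
     (\<forall>(U, \<phi>)\<in>A. holomorphic_immersion
        ((\<lambda>x. (\<chi> i. f x) :: complex^1) \<circ> the_inv_into U \<phi>) (\<iota> \<circ> the_inv_into U \<phi>) (\<phi> ` U)) \<and>
     (\<exists>g. homeomorphism UNIV (range (\<lambda>x. (\<iota> x, f x))) (\<lambda>x. (\<iota> x, f x)) g) \<and>
     closedin (top_of_set (UNIV \<times> ball 0 1)) (range (\<lambda>x. (\<iota> x, f x)))"

text \<open>The total space is the whole type \<open>'x\<close>.\<close>

definition semistable_degeneration ::
  "('x::{t2_space,second_countable_topology}, 2) chart set \<Rightarrow> ('x \<Rightarrow> complex) \<Rightarrow>
     ('x \<Rightarrow> 'm::finite proj) \<Rightarrow> bool" where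
  "semistable_degeneration A f \<iota> \<longleftrightarrow>
     connected (UNIV :: 'x set) \<and> complex_atlas A \<and>
     (\<forall>(U, \<phi>)\<in>A. holomorphic_fun (f \<circ> the_inv_into U \<phi>) (\<phi> ` U)) \<and>
     range f \<subseteq> ball 0 1 \<and> projective_by A f \<iota> \<and>
     (\<forall>x. f x \<noteq> 0 \<longrightarrow> smooth_at A f x) \<and>
     (\<forall>x. f x = 0 \<longrightarrow> smooth_at A f x \<or> double_point A f x)"

section \<open>Cohomology with rational coefficients in degrees 0 and 2\<close>

text \<open>\<open>H\<^sup>0\<close>: locally constant functions, extended by zero. \<open>H\<^sup>2\<close>: homomorphisms from singular
  homology to the rationals (universal coefficients). Tate twists do not change the underlying
  rational vector space and are not recorded.\<close>

definition H0 :: "'a::topological_space set \<Rightarrow> ('a \<Rightarrow> rat) set" where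
  "H0 V = {c. (\<forall>x. x \<notin> V \<longrightarrow> c x = 0) \<and>
              continuous_map (top_of_set V) (discrete_topology UNIV) c}"

definition H_2 :: "'a::topological_space set \<Rightarrow> ('a chain) set monoid" where
  "H_2 V = homology_group 2 (top_of_set V)"

definition rat_group :: "rat monoid" where
  "rat_group = \<lparr>carrier = UNIV, monoid.mult = (+), one = 0\<rparr>"

definition H2 :: "'a::topological_space set \<Rightarrow> (('a chain) set \<Rightarrow> rat) set" where
  "H2 V = {\<eta> \<in> hom (H_2 V) rat_group. \<forall>c. c \<notin> carrier (H_2 V) \<longrightarrow> \<eta> c = 0}"

text \<open>For a connected compact complex curve \<open>V\<close>: \<open>m\<close> is its fundamental class for one of its two
  orientations. If \<open>V\<close> is a non-compact curve or empty, \<open>H\<^sub>2\<close> vanishes and \<open>m\<close> is its zero.\<close>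

definition fundamental_class :: "'a::topological_space set \<Rightarrow> ('a chain) set \<Rightarrow> bool" where
  "fundamental_class V m \<longleftrightarrow>
     m \<in> carrier (H_2 V) \<and> subgroup_generated (H_2 V) {m} = H_2 V"

text \<open>Gysin map \<open>H\<^sup>0(E) \<rightarrow> H\<^sup>2(V)\<close> of a finite set of points \<open>E\<close> in a curve \<open>V\<close>, i.e. the Poincare
  dual of push-forward of zero-cycles: the image of \<open>x\<close> has degree \<open>\<Sum>x\<close> on the fundamental class.
  If \<open>H\<^sub>2(V)\<close> vanishes, the image is 0.\<close>

definition gysin_point ::
  "('a chain) set \<Rightarrow> 'a::topological_space set \<Rightarrow> 'a set \<Rightarrow> ('a \<Rightarrow> rat) \<Rightarrow> (('a chain) set \<Rightarrow> rat)"
  where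
  "gysin_point m V E x =
     (THE \<eta>. \<eta> \<in> H2 V \<and> (\<not> trivial_group (H_2 V) \<longrightarrow> \<eta> m = (\<Sum>q\<in>E. x q)))"

section \<open>Combinatorics of the product on the weight spectral sequence\<close>

text \<open>\<open>srt I ! s\<close> is \<open>i\<^sub>s\<close>, counted from 0.\<close>

abbreviation srt :: "nat set \<Rightarrow> nat list" where
  "srt I \<equiv> sorted_list_of_set I"

definition position :: "nat set \<Rightarrow> nat \<Rightarrow> nat" where
  "position I j = (THE b. b < card I \<and> srt I ! b = j)"

definition admissible :: "nat set \<Rightarrow> nat set \<Rightarrow> nat \<Rightarrow> bool" where
  "admissible I J p \<longleftrightarrow> p < card J \<and> last (srt I) = srt J ! p \<and> set (take (Suc p) (srt J)) \<subseteq> I"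

definition sign_exponent :: "nat set \<Rightarrow> nat set \<Rightarrow> nat \<Rightarrow> nat" where
  "sign_exponent I J p = (\<Sum>s<p. position I (srt J ! s)) + (card I - 1) * p"

definition target_index :: "nat set \<Rightarrow> nat set \<Rightarrow> nat \<Rightarrow> nat set" where
  "target_index I J p = (I - set (take p (srt J))) \<union> set (drop p (srt J))"

section \<open>The model near \<open>(P, P)\<close>\<close>

type_synonym 'x blowup_pt = "('x \<times> 'x) \<times> 4 proj"
type_synonym 'x H0_family = "nat set \<Rightarrow> 'x blowup_pt \<Rightarrow> rat"
type_synonym 'x H2_family = "nat set \<Rightarrow> ('x blowup_pt chain) set \<Rightarrow> rat"

definition strata :: "nat \<Rightarrow> nat set set" where
  "strata j = {I. I \<subseteq> {1..5} \<and> card I = j}"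

locale node =
  fixes f :: "'x::{t2_space,second_countable_topology} \<Rightarrow> complex"
    and P :: 'x and U :: "'x set" and z :: "'x \<Rightarrow> complex^2"
begin

text \<open>\<open>(z\<^sub>1, z\<^sub>2, w\<^sub>1, w\<^sub>2)\<close>, the \<open>w\<^sub>i\<close> being the \<open>z\<^sub>i\<close> on the second factor.\<close>

definition zw :: "'x \<times> 'x \<Rightarrow> complex^4" where
  "zw q = vector [z (fst q) $ 1, z (fst q) $ 2, z (snd q) $ 1, z (snd q) $ 2]"

definition fibre_product :: "('x \<times> 'x) set" where
  "fibre_product = {(x, y). x \<in> U \<and> y \<in> U \<and> f x = f y}"

text \<open>The part of \<open>Z\<close> over \<open>U \<times> U\<close>: the blow-up of the point where all four coordinates vanish
  is the closure of the graph of \<open>[z\<^sub>1 : z\<^sub>2 : w\<^sub>1 : w\<^sub>2]\<close>.\<close>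

definition Z :: "'x blowup_pt set" where
  "Z = {t. fst t \<in> fibre_product} \<inter>
       closure ((\<lambda>q. (q, proj_pt (zw q))) ` (fibre_product - {(P, P)}))"

abbreviation pr1 :: "'x blowup_pt \<Rightarrow> 'x" where "pr1 t \<equiv> fst (fst t)"
abbreviation pr2 :: "'x blowup_pt \<Rightarrow> 'x" where "pr2 t \<equiv> snd (fst t)"

definition Y :: "2 \<Rightarrow> 'x set" where
  "Y i = {x \<in> U. z x $ i = 0}"

definition strict_transform :: "('x \<times> 'x) set \<Rightarrow> 'x blowup_pt set" where
  "strict_transform W = Z \<inter> closure {t \<in> Z. fst t \<in> W - {(P, P)}}"

text \<open>Only the indices 1 to 5 are meaningful.\<close>

definition T :: "nat \<Rightarrow> 'x blowup_pt set" where
  "T i = (if i = 1 then strict_transform (Y 1 \<times> Y 1)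
          else if i = 2 then strict_transform (Y 1 \<times> Y 2)
          else if i = 3 then strict_transform (Y 2 \<times> Y 1)
          else if i = 4 then strict_transform (Y 2 \<times> Y 2)
          else {t \<in> Z. fst t = (P, P)})"

definition T_cap :: "nat set \<Rightarrow> 'x blowup_pt set" where
  "T_cap I = {t \<in> Z. \<forall>i\<in>I. t \<in> T i}"

text \<open>\<open>H\<^sup>0\<close> and \<open>H\<^sup>2\<close> of the disjoint union of the \<open>j\<close>-fold intersections.\<close>

definition H0_strata :: "nat \<Rightarrow> 'x H0_family set" where
  "H0_strata j = {x. (\<forall>I\<in>strata j. x I \<in> H0 (T_cap I)) \<and> (\<forall>I. I \<notin> strata j \<longrightarrow> x I = (\<lambda>t. 0))}"

definition unit_class :: "nat set \<Rightarrow> 'x H0_family" where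
  "unit_class I = (\<lambda>J t. if J = I \<and> t \<in> T_cap I then 1 else 0)"

definition restriction :: "nat \<Rightarrow> 'x H0_family \<Rightarrow> 'x H0_family" where
  "restriction j x = (\<lambda>I t. if I \<in> strata j \<and> t \<in> T_cap I
      then \<Sum>u = 1..j. (-1) ^ (u - 1) * x (I - {srt I ! (u - 1)}) t else 0)"

text \<open>Holomorphic coordinates \<open>\<psi>\<inverse> = (u\<^sub>1, u\<^sub>2, u\<^sub>3)\<close> of \<open>Z\<close> centred at \<open>q\<close> such that \<open>u\<^sub>1\<close>, \<open>u\<^sub>2\<close> are
  local equations of \<open>T j\<close>, \<open>T k\<close>.\<close>

definition adapted_chart ::
  "nat \<Rightarrow> nat \<Rightarrow> 'x blowup_pt \<Rightarrow> (complex^3) set \<Rightarrow> (complex^3 \<Rightarrow> 'x blowup_pt) \<Rightarrow> bool" where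
  "adapted_chart j k q D \<psi> \<longleftrightarrow> open D \<and> 0 \<in> D \<and> \<psi> 0 = q \<and>
     openin (top_of_set Z) (\<psi> ` D) \<and> (\<exists>\<psi>'. homeomorphism D (\<psi> ` D) \<psi> \<psi>') \<and>
     holomorphic_immersion (zw \<circ> fst \<circ> \<psi>) (snd \<circ> \<psi>) D \<and>
     (\<forall>u\<in>D. \<psi> u \<in> T j \<longleftrightarrow> u $ 1 = 0) \<and> (\<forall>u\<in>D. \<psi> u \<in> T k \<longleftrightarrow> u $ 2 = 0)"

definition partial :: "3 \<Rightarrow> (complex^3 \<Rightarrow> complex) \<Rightarrow> complex^3 \<Rightarrow> complex" where
  "partial i g u = frechet_derivative g (at u) (axis i 1)"

text \<open>\<open>c\<close> is the coefficient of \<open>du\<^sub>j/u\<^sub>j \<and> du\<^sub>k/u\<^sub>k\<close> along \<open>T\<^sub>j\<^sub>k\<close> in \<open>dg/g \<and> dh/h\<close>.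
  In coordinates as above, the coefficient of \<open>du\<^sub>1 \<and> du\<^sub>2\<close> in \<open>dg/g \<and> dh/h\<close> is
  \<open>(\<partial>\<^sub>1g \<partial>\<^sub>2h - \<partial>\<^sub>2g \<partial>\<^sub>1h) / (gh)\<close>; so that of \<open>du\<^sub>1/u\<^sub>1 \<and> du\<^sub>2/u\<^sub>2\<close> is the continuous function \<open>C\<close>
  below, whose value is taken at points \<open>q\<close> of \<open>T\<^sub>j\<^sub>k\<close> on no further component.\<close>

definition log_coefficient ::
  "('x blowup_pt \<Rightarrow> complex) \<Rightarrow> ('x blowup_pt \<Rightarrow> complex) \<Rightarrow> nat \<Rightarrow> nat \<Rightarrow> rat \<Rightarrow> bool" where
  "log_coefficient g h j k c \<longleftrightarrow>
     (\<forall>q \<in> T_cap {j, k} - (\<Union>l\<in>{1..5} - {j, k}. T l).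
        \<exists>D \<psi> C. adapted_chart j k q D \<psi> \<and> continuous_on D C \<and> C 0 = of_rat c \<and>
          (\<forall>u\<in>D. C u * (g (\<psi> u) * h (\<psi> u)) =
             u $ 1 * u $ 2 * (partial 1 (g \<circ> \<psi>) u * partial 2 (h \<circ> \<psi>) u
                            - partial 2 (g \<circ> \<psi>) u * partial 1 (h \<circ> \<psi>) u)))"

text \<open>Coefficients along \<open>T_cap J\<close>, \<open>J \<in> strata 2\<close>, of the pullbacks of \<open>1\<close> on \<open>Y 1 \<inter> Y 2\<close>. For empty
  \<open>T_cap J\<close> the value is arbitrary, and it multiplies a zero class.\<close>

definition pull_coeff1 :: "nat set \<Rightarrow> rat" where
  "pull_coeff1 J = (THE c. log_coefficient (\<lambda>t. z (pr1 t) $ 1) (\<lambda>t. z (pr1 t) $ 2) (Min J) (Max J) c)"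

definition pull_coeff2 :: "nat set \<Rightarrow> rat" where
  "pull_coeff2 J = (THE c. log_coefficient (\<lambda>t. z (pr2 t) $ 1) (\<lambda>t. z (pr2 t) $ 2) (Min J) (Max J) c)"

text \<open>\<open>p\<^sub>1\<^sup>*\<close> on \<open>H\<^sup>0(Y\<^sub>1\<^sub>2)\<close>, where \<open>Y\<^sub>1\<^sub>2 = {P}\<close>.\<close>

definition p1_pull :: "('x \<Rightarrow> rat) \<Rightarrow> 'x H0_family" where
  "p1_pull x = (\<lambda>J t. if J \<in> strata 2 \<and> t \<in> T_cap J then pull_coeff1 J * x P else 0)"

text \<open>A choice of fundamental classes of all double strata. The complex orientations are one such
  choice; below, the Gysin maps and the integration in \<open>p2_push\<close> use the same choice, so signs
  cancel.\<close>

definition fundamental_classes :: "(nat set \<Rightarrow> ('x blowup_pt chain) set) \<Rightarrow> bool" where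
  "fundamental_classes \<mu> \<longleftrightarrow> (\<forall>J\<in>strata 2. fundamental_class (T_cap J) (\<mu> J))"

text \<open>The part of \<open>N \<cdot> x\<close> lying in \<open>H\<^sup>2\<close> of the double strata, for \<open>N\<close> in \<open>H\<^sup>0\<close> of the triple strata
  and \<open>x\<close> in \<open>H\<^sup>0\<close> of the double strata; these are the admissible pairs with \<open>p = 1\<close> (a pair with
  \<open>p = 0\<close> contributes to \<open>H\<^sup>0\<close> of the fourfold strata). The Gysin map drops the index \<open>j\<^sub>0\<close>.\<close>

definition mult ::
  "(nat set \<Rightarrow> ('x blowup_pt chain) set) \<Rightarrow> 'x H0_family \<Rightarrow> 'x H0_family \<Rightarrow> 'x H2_family" where
  "mult \<mu> N x = (\<lambda>K c.
     \<Sum>(I, J) \<in> {(I, J). I \<in> strata 3 \<and> J \<in> strata 2 \<and> admissible I J 1 \<and> target_index I J 1 = K}.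
       (-1) ^ sign_exponent I J 1 *
       gysin_point (\<mu> K) (T_cap K) (T_cap (I \<union> J)) (\<lambda>t. N I t * x J t) c)"

text \<open>\<open>(p\<^sub>2)\<^sub>*\<close>, the transpose of \<open>p\<^sub>2\<^sup>* : 1 \<mapsto> \<Sum>\<^sub>J pull_coeff2 J \<cdot> 1\<close> under the Poincare pairings
  \<open>\<Sum>\<^sub>J \<integral>\<^sub>J y \<union> x\<close> on the double strata and the standard one on the point \<open>Y\<^sub>1\<^sub>2\<close>.\<close>

definition p2_push :: "(nat set \<Rightarrow> ('x blowup_pt chain) set) \<Rightarrow> 'x H2_family \<Rightarrow> 'x \<Rightarrow> rat" where
  "p2_push \<mu> y = (\<lambda>p. if p \<in> Y 1 \<inter> Y 2 then \<Sum>J\<in>strata 2. pull_coeff2 J * y J (\<mu> J) else 0)"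

text \<open>The cocycles \<open>[N]\<close> representing the monodromy operator near \<open>(P, P)\<close>.\<close>

definition monodromy_cocycle ::
  "(nat set \<Rightarrow> ('x blowup_pt chain) set) \<Rightarrow> 'x H0_family \<Rightarrow> bool" where
  "monodromy_cocycle \<mu> N \<longleftrightarrow> N \<in> H0_strata 3 \<and> restriction 4 N = (\<lambda>I t. 0) \<and>
     (\<forall>x \<in> H0 (Y 1 \<inter> Y 2). p2_push \<mu> (mult \<mu> N (p1_pull x)) = x)"

text \<open>A class in \<open>H\<^sup>0\<close> of the (global) double strata of \<open>Z\<close> restricts to an element of
  \<open>H0_strata 2\<close>. Not every element of \<open>H0_strata 2\<close> need arise in this way, as \<open>T\<^sub>1\<^sub>2, T\<^sub>1\<^sub>3, T\<^sub>2\<^sub>4, T\<^sub>3\<^sub>4\<close>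
  reach out of the neighbourhood, but every class supported over \<open>(P, P)\<close> does (extend by zero).
  A space of boundaries therefore is the image of some subspace between these two.\<close>

definition supported_classes :: "'x H0_family set" where
  "supported_classes = {x \<in> H0_strata 2. \<forall>J t. x J t \<noteq> 0 \<longrightarrow> fst t = (P, P)}"

definition boundary_source :: "'x H0_family set \<Rightarrow> bool" where
  "boundary_source B \<longleftrightarrow> supported_classes \<subseteq> B \<and> B \<subseteq> H0_strata 2 \<and>
     (\<forall>x\<in>B. \<forall>y\<in>B. (\<lambda>J t. x J t + y J t) \<in> B) \<and>
     (\<forall>x\<in>B. \<forall>c::rat. (\<lambda>J t. c * x J t) \<in> B)"

text \<open>Congruence modulo \<open>restriction 3 ` B\<close>.\<close>

definition cohomologous :: "'x H0_family set \<Rightarrow> ('x H0_family \<times> 'x H0_family) set" where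
  "cohomologous B = {(M, N). M \<in> H0_strata 3 \<and> N \<in> H0_strata 3 \<and>
     (\<exists>x\<in>B. (\<lambda>I t. M I t - N I t) = restriction 3 x)}"

end

end

theory Submission
  imports Defs
begin

text \<open>All strata that matter lie over \<open>(P, P)\<close>, and everything there can be read off from the homogeneous
coordinates \<open>[v\<^sub>1 : v\<^sub>2 : v\<^sub>3 : v\<^sub>4] = [z\<^sub>1 : z\<^sub>2 : w\<^sub>1 : w\<^sub>2]\<close> of the blow-up. The lemma \<open>Z_iff\<close> describes
\<open>Z\<close> as the set of pairs of a point \<open>q\<close> and a line \<open>[v]\<close> on the quadric \<open>v\<^sub>1v\<^sub>2 = v\<^sub>3v\<^sub>4\<close> with \<open>zw q\<close> on that
line, and \<open>T_component_iff\<close> says that \<open>T\<^sub>1, \<dots>, T\<^sub>4\<close> are cut out by the vanishing of \<open>v\<^sub>1, v\<^sub>3\<close>, of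
\<open>v\<^sub>1, v\<^sub>4\<close>, of \<open>v\<^sub>2, v\<^sub>3\<close> and of \<open>v\<^sub>2, v\<^sub>4\<close>. So \<open>T\<^sub>1\<close>, \<open>T\<^sub>2\<close>, \<open>T\<^sub>4\<close>, \<open>T\<^sub>3\<close> meet the quadric surface
\<open>T\<^sub>5\<close> in a cycle of four lines. The corners of the cycle are the four triple points (\<open>triple_points\<close>);
there are no quadruple points, so every class on the triple strata is a cocycle.\<close>

text \<open>Near a point of \<open>T\<^sub>i \<inter> T\<^sub>5\<close> that is not a corner, take the equation \<open>t\<close> of \<open>T\<^sub>5\<close> and the equation \<open>b\<close> of \<open>T\<^sub>i\<close>.
If \<open>m\<close> is one of the two coordinates vanishing on \<open>T\<^sub>i\<close> and \<open>m'\<close> is its partner in the equation of the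
quadric, then the \<open>m'\<close>-th entry of \<open>zw\<close> is a unit times \<open>t\<close> and the \<open>m\<close>-th one a unit times \<open>t b\<close>. Hence the
logarithmic form of the entries \<open>m\<close>, \<open>m'\<close>, in this order, has coefficient \<open>1\<close>, and in the reverse order
\<open>- 1\<close>. This needs two halves: a chart in which the coefficient is visibly \<open>1\<close> (\<open>chart_adapted\<close>), and the
independence of the chart (\<open>log_coefficient_in_chart\<close>). Along the strata \<open>15, 25, 35, 45\<close> the coefficients
of \<open>p\<^sub>1\<^sup>*\<close> are \<open>1, 1, -1, -1\<close> and those of \<open>p\<^sub>2\<^sup>*\<close> are \<open>1, -1, 1, -1\<close> (\<open>pull_coeff_values\<close>).\<close>

text \<open>The product with a class on the triple stratum \<open>ik5\<close> sends \<open>1\<close> on \<open>i5\<close> to the class of a point of \<open>k5\<close>, and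
\<open>1\<close> on \<open>k5\<close> to minus the class of a point of \<open>i5\<close>. These strata are projective lines, that is, spheres
(\<open>coordinate_line_sphere\<close>), whose \<open>H\<^sub>2\<close> is infinite cyclic, so these classes have degree one. No other
double stratum receives anything. With \<open>c\<close> and \<open>d\<close> the coefficients of \<open>p\<^sub>1\<^sup>*\<close> and \<open>p\<^sub>2\<^sup>*\<close>, the corner
\<open>ik5\<close> contributes \<open>c\<^sub>i d\<^sub>k - c\<^sub>k d\<^sub>i\<close>, which is \<open>-2, 2, -2, 2\<close> on \<open>125, 135, 245, 345\<close> (\<open>push_mult\<close>).\<close>

text \<open>Two solutions of the resulting equation differ by a class \<open>a\<close> with
\<open>- a\<^sub>1\<^sub>2\<^sub>5 + a\<^sub>1\<^sub>3\<^sub>5 - a\<^sub>2\<^sub>4\<^sub>5 + a\<^sub>3\<^sub>4\<^sub>5 = 0\<close>. This says that the oriented sum of \<open>a\<close> around the cycle of lines vanishes,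
so that \<open>a\<^sub>i\<^sub>k\<^sub>5 = c\<^sub>k - c\<^sub>i\<close> for constants \<open>c\<^sub>i\<close>; and this is the restriction of the class with value \<open>c\<^sub>i\<close>
on the line \<open>i5\<close>, which is supported over \<open>(P, P)\<close> (\<open>unit_combination_is_boundary\<close>).\<close>

section \<open>Projective space as a space of projectors\<close>

lemma norm_vector_scalar: "norm (c *s v) = cmod c * norm (v :: complex^'n)"
  by (simp add: norm_vec_def norm_mult L2_set_right_distrib)

lemma proj_obtain:
  obtains v where "v \<noteq> 0" "p = proj_pt v"
proof -
  obtain v where "v \<noteq> 0" "Rep_proj p = range (\<lambda>c. c *s v)"
    using Rep_proj[of p] by blast
  then show ?thesis
    using that Rep_proj_inverse[of p] unfolding proj_pt_def by metis
qed

lemma proj_pt_eq_iff: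
  assumes "v \<noteq> 0" "w \<noteq> 0"
  shows "proj_pt v = proj_pt w \<longleftrightarrow> (\<exists>c. c \<noteq> 0 \<and> w = c *s v)"
proof -
  have "proj_pt v = proj_pt w \<longleftrightarrow> range (\<lambda>c. c *s v) = range (\<lambda>c. c *s w)"
    unfolding proj_pt_def using assms by (intro Abs_proj_inject) auto
  also have "\<dots> \<longleftrightarrow> (\<exists>c. c \<noteq> 0 \<and> w = c *s v)"
  proof
    assume eq: "range (\<lambda>c. c *s v) = range (\<lambda>c. c *s w)"
    have "w \<in> range (\<lambda>c. c *s v)"
      unfolding eq by (intro range_eqI[of _ _ 1]) simp
    then obtain c where "w = c *s v" by auto
    then show "\<exists>c. c \<noteq> 0 \<and> w = c *s v" using assms by auto
  next
    assume "\<exists>c. c \<noteq> 0 \<and> w = c *s v"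
    then obtain c where c: "c \<noteq> 0" "w = c *s v" by blast
    have "a *s v = (a / c) *s w" "a *s w = (a * c) *s v" for a
      using c by (auto simp: vector_smult_assoc)
    then show "range (\<lambda>c. c *s v) = range (\<lambda>c. c *s w)"
      by (auto simp only: image_iff)
  qed
  finally show ?thesis .
qed

lemma proj_pt_smult: "v \<noteq> 0 \<Longrightarrow> c \<noteq> 0 \<Longrightarrow> proj_pt (c *s v) = proj_pt v"
  by (metis proj_pt_eq_iff vector_mul_eq_0)

lemma continuous_on_proj_pt: "continuous_on {v. v \<noteq> 0} proj_pt"
proof (subst continuous_on_open_vimage)
  show "open {v :: complex^'a. v \<noteq> 0}" by (simp add: open_Collect_neq)
next
  show "\<forall>B. open B \<longrightarrow> open (proj_pt -` B \<inter> {v :: complex^'a. v \<noteq> 0})"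
  proof (intro allI impI)
    fix B :: "'a proj set" assume "open B"
    then have "open {v. v \<noteq> 0 \<and> proj_pt v \<in> B}" by (simp add: open_proj_def)
    also have "{v. v \<noteq> 0 \<and> proj_pt v \<in> B} = proj_pt -` B \<inter> {v. v \<noteq> 0}" by blast
    finally show "open (proj_pt -` B \<inter> {v. v \<noteq> 0})" .
  qed
qed

lemma continuous_on_proj_pt_comp:
  "continuous_on S g \<Longrightarrow> (\<And>x. x \<in> S \<Longrightarrow> g x \<noteq> 0) \<Longrightarrow> continuous_on S (\<lambda>x. proj_pt (g x))"
  by (rule continuous_on_compose2[OF continuous_on_proj_pt]) auto

text \<open>The entries of the orthogonal projection onto a line are continuous on projective space and determine
the line. They turn conditions on homogeneous coordinates into equations between continuous functions,
which pass to closures.\<close>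

definition projector :: "'n::finite proj \<Rightarrow> 'n \<Rightarrow> 'n \<Rightarrow> complex" where
  "projector p i j =
     (let v = SOME v. v \<noteq> 0 \<and> p = proj_pt v in v $ i * cnj (v $ j) / of_real ((norm v)\<^sup>2))"

lemma projector_proj_pt:
  assumes "v \<noteq> 0"
  shows "projector (proj_pt v) i j = v $ i * cnj (v $ j) / of_real ((norm v)\<^sup>2)"
proof -
  define w where "w = (SOME w. w \<noteq> 0 \<and> proj_pt v = proj_pt w)"
  have "w \<noteq> 0 \<and> proj_pt v = proj_pt w"
    unfolding w_def by (rule someI[of _ v]) (use assms in simp)
  then obtain c where c: "c \<noteq> 0" "w = c *s v" using assms by (auto simp: proj_pt_eq_iff)
  have "projector (proj_pt v) i j = w $ i * cnj (w $ j) / of_real ((norm w)\<^sup>2)"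
    unfolding projector_def w_def Let_def by simp
  also have "\<dots> = (c * cnj c) * (v $ i * cnj (v $ j)) / (of_real ((cmod c)\<^sup>2) * of_real ((norm v)\<^sup>2))"
    by (simp add: c norm_vector_scalar power_mult_distrib mult_ac)
  also have "c * cnj c = of_real ((cmod c)\<^sup>2)"
    by (metis complex_norm_square)
  finally show ?thesis using c by simp
qed

lemma continuous_on_projector: "continuous_on S (\<lambda>p. projector p i j)"
proof -
  have cont: "continuous_on {v. v \<noteq> 0} (\<lambda>v. v $ i * cnj (v $ j) / of_real ((norm v)\<^sup>2))"
    by (intro continuous_intros) auto
  have "open ((\<lambda>p. projector p i j) -` B)" if "open B" for B
  proof -
    have "open ((\<lambda>v. v $ i * cnj (v $ j) / of_real ((norm v)\<^sup>2)) -` B \<inter> {v. v \<noteq> 0})"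
      using cont that by (subst (asm) continuous_on_open_vimage) (auto simp: open_Collect_neq)
    also have "\<dots> = {v. v \<noteq> 0 \<and> proj_pt v \<in> (\<lambda>p. projector p i j) -` B}"
      by (auto simp: projector_proj_pt)
    finally show ?thesis by (simp add: open_proj_def)
  qed
  then have "continuous_on UNIV (\<lambda>p. projector p i j)"
    by (subst continuous_on_open_vimage) auto
  then show ?thesis using continuous_on_subset by blast
qed

lemma projector_diag_eq_0: "v \<noteq> 0 \<Longrightarrow> projector (proj_pt v) m m = 0 \<longleftrightarrow> v $ m = 0"
  by (simp add: projector_proj_pt)

lemma projector_ratio: "v \<noteq> 0 \<Longrightarrow> v $ m \<noteq> 0 \<Longrightarrow>
  projector (proj_pt v) i m / projector (proj_pt v) m m = v $ i / v $ m"
  by (simp add: projector_proj_pt)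

section \<open>Holomorphic functions of several variables\<close>

lemma holomorphic_funI:
  assumes "open D"
    and "\<And>x. x \<in> D \<Longrightarrow> (g has_derivative g' x) (at x)"
    and "\<And>x c v. x \<in> D \<Longrightarrow> g' x (c *s v) = c * g' x v"
    and "\<And>v. continuous_on D (\<lambda>x. g' x v)"
  shows "holomorphic_fun g D"
proof -
  have eq: "frechet_derivative g (at x) = g' x" if "x \<in> D" for x
    using assms(2)[OF that] frechet_derivative_at by metis
  have "continuous_on D (\<lambda>x. frechet_derivative g (at x) v)" for v
    using assms(4)[of v] by (rule continuous_on_eq) (simp add: eq)
  then show ?thesis
    unfolding holomorphic_fun_def using assms(1,2,3) eq
    by (auto simp: differentiable_def)
qed

lemma holomorphic_fun_derivative:
  "holomorphic_fun g D \<Longrightarrow> x \<in> D \<Longrightarrow> (g has_derivative frechet_derivative g (at x)) (at x)"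
  by (simp add: holomorphic_fun_def frechet_derivative_works)

lemma holomorphic_fun_cong:
  assumes "holomorphic_fun g D" "\<And>x. x \<in> D \<Longrightarrow> h x = g x"
  shows "holomorphic_fun h D"
proof (rule holomorphic_funI)
  show D: "open D" using assms(1) by (simp add: holomorphic_fun_def)
  show "(h has_derivative frechet_derivative g (at x)) (at x)" if "x \<in> D" for x
    by (rule has_derivative_transform_within_open[OF holomorphic_fun_derivative[OF assms(1) that] D that])
      (simp add: assms(2))
qed (use assms(1) in \<open>auto simp: holomorphic_fun_def\<close>)

lemma holomorphic_fun_subset:
  "holomorphic_fun g D \<Longrightarrow> open W \<Longrightarrow> W \<subseteq> D \<Longrightarrow> holomorphic_fun g W"
  by (auto simp: holomorphic_fun_def intro: continuous_on_subset)

lemma holomorphic_fun_continuous: "holomorphic_fun g D \<Longrightarrow> continuous_on D g"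
  by (simp add: holomorphic_fun_def continuous_at_imp_continuous_on differentiable_imp_continuous_within)

lemma holomorphic_fun_const: "open D \<Longrightarrow> holomorphic_fun (\<lambda>x. c) D"
  by (rule holomorphic_funI[where g' = "\<lambda>x v. 0"]) auto

lemma holomorphic_fun_coord: "open D \<Longrightarrow> holomorphic_fun (\<lambda>x. x $ i) D"
  by (rule holomorphic_funI[where g' = "\<lambda>x v. v $ i"])
    (auto intro!: bounded_linear_imp_has_derivative bounded_linear_vec_nth)

lemma holomorphic_fun_derivative_scale:
  "holomorphic_fun g D \<Longrightarrow> x \<in> D \<Longrightarrow>
    frechet_derivative g (at x) (c *s v) = c * frechet_derivative g (at x) v"
  by (simp add: holomorphic_fun_def)

lemma holomorphic_fun_continuous_derivative:
  "holomorphic_fun g D \<Longrightarrow> continuous_on D (\<lambda>x. frechet_derivative g (at x) v)"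
  by (simp add: holomorphic_fun_def)

lemma holomorphic_fun_open: "holomorphic_fun g D \<Longrightarrow> open D"
  by (simp add: holomorphic_fun_def)

lemma holomorphic_fun_add:
  assumes g: "holomorphic_fun g D" and h: "holomorphic_fun h D"
  shows "holomorphic_fun (\<lambda>x. g x + h x) D"
proof (rule holomorphic_funI)
  show "((\<lambda>x. g x + h x) has_derivative
      (\<lambda>v. frechet_derivative g (at x) v + frechet_derivative h (at x) v)) (at x)"
    if "x \<in> D" for x
    by (intro has_derivative_add holomorphic_fun_derivative[OF g that]
        holomorphic_fun_derivative[OF h that])
qed (auto intro!: continuous_intros holomorphic_fun_continuous_derivative[OF g]
      holomorphic_fun_continuous_derivative[OF h] holomorphic_fun_open[OF g]
      simp: holomorphic_fun_derivative_scale[OF g] holomorphic_fun_derivative_scale[OF h]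
        algebra_simps)

lemma holomorphic_fun_mult:
  assumes g: "holomorphic_fun g D" and h: "holomorphic_fun h D"
  shows "holomorphic_fun (\<lambda>x. g x * h x) D"
proof (rule holomorphic_funI)
  show "((\<lambda>x. g x * h x) has_derivative
      (\<lambda>v. g x * frechet_derivative h (at x) v + frechet_derivative g (at x) v * h x)) (at x)"
    if "x \<in> D" for x
    by (intro has_derivative_mult holomorphic_fun_derivative[OF g that]
        holomorphic_fun_derivative[OF h that])
qed (auto intro!: continuous_intros holomorphic_fun_continuous_derivative[OF g]
      holomorphic_fun_continuous_derivative[OF h] holomorphic_fun_open[OF g]
      holomorphic_fun_continuous[OF g] holomorphic_fun_continuous[OF h]
      simp: holomorphic_fun_derivative_scale[OF g] holomorphic_fun_derivative_scale[OF h]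
        algebra_simps)

lemma holomorphic_fun_inverse:
  assumes h: "holomorphic_fun h D" and nz: "\<And>x. x \<in> D \<Longrightarrow> h x \<noteq> 0"
  shows "holomorphic_fun (\<lambda>x. inverse (h x)) D"
proof (rule holomorphic_funI)
  show "((\<lambda>x. inverse (h x)) has_derivative
      (\<lambda>v. - (inverse (h x) * frechet_derivative h (at x) v * inverse (h x)))) (at x)"
    if "x \<in> D" for x
    by (intro Deriv.has_derivative_inverse holomorphic_fun_derivative[OF h that] nz that)
qed (auto intro!: continuous_intros holomorphic_fun_continuous_derivative[OF h]
      holomorphic_fun_open[OF h] holomorphic_fun_continuous[OF h]
      simp: holomorphic_fun_derivative_scale[OF h] nz algebra_simps)

lemma holomorphic_fun_divide:
  assumes "holomorphic_fun g D" "holomorphic_fun h D" "\<And>x. x \<in> D \<Longrightarrow> h x \<noteq> 0"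
  shows "holomorphic_fun (\<lambda>x. g x / h x) D"
  using holomorphic_fun_mult[OF assms(1) holomorphic_fun_inverse[OF assms(2,3)]]
  by (simp add: field_class.field_divide_inverse)

section \<open>The blow-up in homogeneous coordinates\<close>

lemma vector_4:
  "(vector [a, b, c, d] :: ('a::zero)^4) $ 1 = a"
  "(vector [a, b, c, d] :: ('a::zero)^4) $ 2 = b"
  "(vector [a, b, c, d] :: ('a::zero)^4) $ 3 = c"
  "(vector [a, b, c, d] :: ('a::zero)^4) $ 4 = d"
  unfolding vector_def by simp_all

lemma scaleR_eq_smult: "c *\<^sub>R v = of_real c *s (v :: complex^'n)"
  by (simp add: vec_eq_iff complex_eq_iff)

lemma continuous_on_vector_2:
  assumes "continuous_on S a" "continuous_on S b"
  shows "continuous_on S (\<lambda>x. vector [a x, b x] :: complex^2)"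
proof (rule continuous_on_eq)
  show "continuous_on S (\<lambda>x. (\<chi> i. if i = 1 then a x else b x) :: complex^2)"
    by (intro continuous_on_vec_lambda, rename_tac i, case_tac "i = 1") (use assms in auto)
qed (auto simp: vec_eq_iff forall_2)

text \<open>Continuity is asked on an open set only, because \<open>z\<close> is a coordinate system on \<open>U\<close>.\<close>

lemma vanishing_on_closure:
  fixes h :: "'a::topological_space \<Rightarrow> complex"
  assumes "open V" "continuous_on V h" "t \<in> closure S" "t \<in> V" "\<And>s. s \<in> S \<Longrightarrow> s \<in> V \<Longrightarrow> h s = 0"
  shows "h t = 0"
proof (rule ccontr)
  assume "h t \<noteq> 0"
  have "open (h -` (- {0}) \<inter> V)"
    using assms(1,2) by (subst (asm) continuous_on_open_vimage) (auto simp: open_Compl)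
  moreover have "(h -` (- {0}) \<inter> V) \<inter> S = {}" using assms(5) by auto
  ultimately have "(h -` (- {0}) \<inter> V) \<inter> closure S = {}"
    by (simp add: open_Int_closure_eq_empty)
  then show False using assms(3,4) \<open>h t \<noteq> 0\<close> by blast
qed

text \<open>What \<open>local_parameters\<close> says about the topology of \<open>U\<close>, with the radius of the polydisk made explicit.\<close>

locale node_chart = node f P U z
  for f :: "'x::{t2_space,second_countable_topology} \<Rightarrow> complex"
    and P :: 'x and U :: "'x set" and z :: "'x \<Rightarrow> complex^2" +
  fixes r :: real
  assumes r_pos: "0 < r"
    and open_U: "open U"
    and P_in_U: "P \<in> U"
    and z_P: "z P = 0"
    and z_homeomorphism: "homeomorphism U {v. \<forall>i. norm (v $ i) < r} z (the_inv_into U z)"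
    and f_eq: "\<And>x. x \<in> U \<Longrightarrow> f x = z x $ 1 * z x $ 2"
begin

definition polydisk :: "(complex^4) set" where
  "polydisk = {v. \<forall>i. norm (v $ i) < r}"

definition point_at :: "complex^4 \<Rightarrow> 'x \<times> 'x" where
  "point_at v = (the_inv_into U z (vector [v $ 1, v $ 2]), the_inv_into U z (vector [v $ 3, v $ 4]))"

lemma zw_nth:
  "zw q $ 1 = z (fst q) $ 1" "zw q $ 2 = z (fst q) $ 2"
  "zw q $ 3 = z (snd q) $ 1" "zw q $ 4 = z (snd q) $ 2"
  by (simp_all add: zw_def vector_4)

lemma open_polydisk: "open polydisk"
proof -
  have "polydisk = (\<Inter>i. {v. norm (v $ i) < r})" by (auto simp: polydisk_def)
  also have "open \<dots>"
    by (intro open_INT ballI open_Collect_less continuous_intros) auto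
  finally show ?thesis .
qed

lemma zw_in_polydisk: "q \<in> U \<times> U \<Longrightarrow> zw q \<in> polydisk"
  using homeomorphism_image1[OF z_homeomorphism] by (auto simp: polydisk_def forall_4 zw_nth)

lemma z_inv_in_U: "\<forall>i. norm (v $ i) < r \<Longrightarrow> the_inv_into U z v \<in> U"
  using homeomorphism_image2[OF z_homeomorphism] by blast

lemma z_inv: "\<forall>i. norm (v $ i) < r \<Longrightarrow> z (the_inv_into U z v) = v"
  using homeomorphism_apply2[OF z_homeomorphism] by blast

lemma inv_z: "x \<in> U \<Longrightarrow> the_inv_into U z (z x) = x"
  using homeomorphism_apply1[OF z_homeomorphism] by blast

lemma point_at_in_U: "v \<in> polydisk \<Longrightarrow> point_at v \<in> U \<times> U"
  by (simp add: point_at_def polydisk_def z_inv_in_U forall_2)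

lemma zw_point_at: "v \<in> polydisk \<Longrightarrow> zw (point_at v) = v"
  by (simp add: vec_eq_iff[of "zw _"] forall_4 zw_nth)
    (simp add: point_at_def polydisk_def z_inv forall_2 forall_4)

lemma point_at_zw: "q \<in> U \<times> U \<Longrightarrow> point_at (zw q) = q"
proof -
  have "vector [v $ 1, v $ 2] = v" for v :: "complex^2" by (simp add: vec_eq_iff forall_2)
  then show "q \<in> U \<times> U \<Longrightarrow> point_at (zw q) = q"
    by (auto simp: point_at_def zw_nth inv_z)
qed

lemma zw_inj: "q \<in> U \<times> U \<Longrightarrow> q' \<in> U \<times> U \<Longrightarrow> zw q = zw q' \<longleftrightarrow> q = q'"
  by (metis point_at_zw)

lemma zw_PP: "zw (P, P) = 0"
  by (simp add: vec_eq_iff forall_4 zw_nth z_P)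

lemma zw_eq_0_iff: "q \<in> U \<times> U \<Longrightarrow> zw q = 0 \<longleftrightarrow> q = (P, P)"
  using zw_inj[of q "(P, P)"] P_in_U by (auto simp: zw_PP)

lemma continuous_on_zw: "continuous_on (U \<times> U) (\<lambda>q. zw q $ i)"
proof -
  note z = homeomorphism_cont1[OF z_homeomorphism]
  have "continuous_on (U \<times> U) (\<lambda>q. z (fst q))" "continuous_on (U \<times> U) (\<lambda>q. z (snd q))"
    by (rule continuous_on_compose2[OF z]; force intro!: continuous_intros)+
  then have "continuous_on (U \<times> U) (\<lambda>q. zw q $ 1)" "continuous_on (U \<times> U) (\<lambda>q. zw q $ 2)"
    "continuous_on (U \<times> U) (\<lambda>q. zw q $ 3)" "continuous_on (U \<times> U) (\<lambda>q. zw q $ 4)"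
    by (auto simp: zw_nth intro: continuous_on_component)
  then show ?thesis using exhaust_4[of i] by auto
qed

lemma continuous_on_point_at: "continuous_on polydisk point_at"
proof -
  note z = homeomorphism_cont2[OF z_homeomorphism]
  show ?thesis
    unfolding point_at_def
    by (intro continuous_on_Pair continuous_on_compose2[OF z] continuous_on_vector_2
        continuous_intros) (auto simp: polydisk_def forall_2)
qed

lemma fibre_product_iff:
  "q \<in> fibre_product \<longleftrightarrow> q \<in> U \<times> U \<and> zw q $ 1 * zw q $ 2 = zw q $ 3 * zw q $ 4"
  by (cases q) (auto simp: fibre_product_def f_eq zw_nth)

text \<open>Points over \<open>(P, P)\<close> are limits of points elsewhere: move along the line \<open>v\<close> towards the origin, which
keeps the second entry constant.\<close>

lemma in_closure_by_scaling:
  assumes "\<And>s. 0 < s \<Longrightarrow> s *\<^sub>R v \<in> polydisk \<Longrightarrow> (point_at (s *\<^sub>R v), p) \<in> S"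
  shows "((P, P), p) \<in> closure S"
proof -
  have zero: "0 \<in> polydisk" using r_pos by (simp add: polydisk_def)
  have lim: "((\<lambda>s. s *\<^sub>R v) \<longlongrightarrow> 0) (at_right (0::real))"
    by (rule tendsto_eq_intros | simp)+
  have "eventually (\<lambda>s. s *\<^sub>R v \<in> polydisk) (at_right 0)"
    using lim open_polydisk zero by (rule topological_tendstoD)
  moreover have "eventually (\<lambda>s::real. 0 < s) (at_right 0)"
    by (rule eventually_at_right_less)
  ultimately have ev: "eventually (\<lambda>s. (point_at (s *\<^sub>R v), p) \<in> closure S) (at_right 0)"
    by eventually_elim (use assms closure_subset in blast)
  have "isCont point_at 0"
    using continuous_on_point_at open_polydisk zero by (simp add: continuous_on_eq_continuous_at)
  then have "((\<lambda>s. point_at (s *\<^sub>R v)) \<longlongrightarrow> point_at 0) (at_right 0)"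
    using lim by (rule isCont_tendsto_compose)
  moreover have "point_at 0 = (P, P)" using point_at_zw[of "(P, P)"] P_in_U by (simp add: zw_PP)
  ultimately have "((\<lambda>s. (point_at (s *\<^sub>R v), p)) \<longlongrightarrow> ((P, P), p)) (at_right 0)"
    by (intro tendsto_Pair tendsto_const) simp
  then show ?thesis
    using ev by (intro Lim_in_closed_set[OF closed_closure]) auto
qed

text \<open>The inclusion from left to right holds because the right-hand side is closed over \<open>U \<times> U\<close> and contains
the graph. Conversely, a point over \<open>(P, P)\<close> is approached along the line \<open>v\<close> itself, which stays in the
cone over the quadric.\<close>

lemma Z_iff:
  assumes v: "v \<noteq> 0"
  shows "(q, proj_pt v) \<in> Z \<longleftrightarrow>
    q \<in> U \<times> U \<and> v $ 1 * v $ 2 = v $ 3 * v $ 4 \<and> (\<exists>s. zw q = s *s v)"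
proof -
  define S where "S = (\<lambda>q. (q, proj_pt (zw q))) ` (fibre_product - {(P, P)})"
  have Z: "t \<in> Z \<longleftrightarrow> fst t \<in> fibre_product \<and> t \<in> closure S" for t
    by (auto simp: Z_def S_def)
  have S: "(q, proj_pt w) \<in> S"
    if "w \<noteq> 0" "q \<in> U \<times> U" "w $ 1 * w $ 2 = w $ 3 * w $ 4" "zw q = c *s w" "c \<noteq> 0" for q w c
  proof -
    have "zw q \<noteq> 0" using that by simp
    then have "q \<noteq> (P, P)" using zw_PP by auto
    moreover have "q \<in> fibre_product"
      using that(2,3) by (simp add: fibre_product_iff that(4))
    moreover have "proj_pt w = proj_pt (zw q)" using that by (simp add: proj_pt_smult)
    ultimately show ?thesis by (simp add: S_def)
  qed
  let ?M = "\<lambda>t :: 'x blowup_pt. projector (snd t)"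
  define V :: "'x blowup_pt set" where "V = (U \<times> U) \<times> UNIV"
  have V: "open V" by (simp add: V_def open_Times open_U)
  have M: "continuous_on V (\<lambda>t. ?M t i j)" for i j
    by (rule continuous_on_compose2[OF continuous_on_projector]) (auto intro!: continuous_intros)
  have W: "continuous_on V (\<lambda>t. zw (fst t) $ i)" for i
    by (rule continuous_on_compose2[OF continuous_on_zw]) (auto intro!: continuous_intros simp: V_def)
  show ?thesis
  proof
    assume t: "(q, proj_pt v) \<in> Z"
    then have q: "q \<in> U \<times> U" and cl: "(q, proj_pt v) \<in> closure S"
      by (auto simp: Z fibre_product_iff)
    have nz: "zw q \<noteq> 0 \<and> zw q $ 1 * zw q $ 2 = zw q $ 3 * zw q $ 4 \<and> snd t = proj_pt (zw q)"
      if "t \<in> S" "q = fst t" for t q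
      using that by (auto simp: S_def fibre_product_iff zw_eq_0_iff)
    (* the 2x2 minors of zw q and v, multiplied by the conjugate of v_k *)
    have line: "zw q $ i * projector (proj_pt v) j k - zw q $ j * projector (proj_pt v) i k = 0" for i j k
      using vanishing_on_closure[of V "\<lambda>t. zw (fst t) $ i * ?M t j k - zw (fst t) $ j * ?M t i k",
          OF V _ cl] q nz
      by (force simp: V_def projector_proj_pt intro!: continuous_intros M[unfolded V_def] W[unfolded V_def])
    have quadric: "projector (proj_pt v) 1 a * projector (proj_pt v) 2 b
        - projector (proj_pt v) 3 a * projector (proj_pt v) 4 b = 0" for a b
      using vanishing_on_closure[of V "\<lambda>t. ?M t 1 a * ?M t 2 b - ?M t 3 a * ?M t 4 b", OF V _ cl] q nz
      by (force simp: V_def projector_proj_pt intro!: continuous_intros M[unfolded V_def])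
    obtain k where k: "v $ k \<noteq> 0" using v by (auto simp: vec_eq_iff)
    have "v $ 1 * v $ 2 = v $ 3 * v $ 4"
      using quadric[of k k] v k by (simp add: projector_proj_pt divide_simps)
    moreover have "zw q = (zw q $ k / v $ k) *s v"
      using line[of _ k k] v k by (simp add: vec_eq_iff projector_proj_pt divide_simps)
    ultimately show "q \<in> U \<times> U \<and> v $ 1 * v $ 2 = v $ 3 * v $ 4 \<and> (\<exists>s. zw q = s *s v)"
      using q by blast
  next
    assume "q \<in> U \<times> U \<and> v $ 1 * v $ 2 = v $ 3 * v $ 4 \<and> (\<exists>s. zw q = s *s v)"
    then obtain s where q: "q \<in> U \<times> U" and quadric: "v $ 1 * v $ 2 = v $ 3 * v $ 4" and s: "zw q = s *s v"
      by blast
    have "(q, proj_pt v) \<in> closure S"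
    proof (cases "s = 0")
      case True
      then have "q = (P, P)" using q s by (simp add: zw_eq_0_iff)
      moreover have "(point_at (c *\<^sub>R v), proj_pt v) \<in> S" if "0 < c" "c *\<^sub>R v \<in> polydisk" for c
        using that quadric v
        by (intro S[of v _ "of_real c"] point_at_in_U)
          (auto simp: zw_point_at simp flip: scaleR_eq_smult)
      ultimately show ?thesis using in_closure_by_scaling by blast
    next
      case False
      then show ?thesis using S[OF v q quadric s] closure_subset by blast
    qed
    moreover have "q \<in> fibre_product" using q quadric by (simp add: fibre_product_iff s)
    ultimately show "(q, proj_pt v) \<in> Z" by (simp add: Z)
  qed
qed

text \<open>As for \<open>Z_iff\<close>, the condition on \<open>v\<close> is closed, and the strict transform is filled up by moving along
\<open>v\<close> towards the origin.\<close>

lemma strict_transform_iff: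
  assumes W: "W = {q \<in> U \<times> U. zw q $ m = 0 \<and> zw q $ n = 0}" and v: "v \<noteq> 0"
  shows "(q, proj_pt v) \<in> strict_transform W \<longleftrightarrow> (q, proj_pt v) \<in> Z \<and> v $ m = 0 \<and> v $ n = 0"
proof -
  define S where "S = {t \<in> Z. fst t \<in> W - {(P, P)}}"
  have coord: "projector (snd t) m m = 0" "projector (snd t) n n = 0" if "t \<in> S" for t
  proof -
    obtain w where w: "w \<noteq> 0" "snd t = proj_pt w" by (rule proj_obtain)
    have "(fst t, proj_pt w) \<in> Z" using that w by (simp add: S_def flip: w(2))
    then obtain s where s: "zw (fst t) = s *s w" and U: "fst t \<in> U \<times> U"
      using w(1) by (auto simp: Z_iff)
    have "zw (fst t) \<noteq> 0" using that U by (auto simp: S_def zw_eq_0_iff)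
    then have "s \<noteq> 0" using s by auto
    then show "projector (snd t) m m = 0" "projector (snd t) n n = 0"
      using that w s by (auto simp: S_def W projector_diag_eq_0)
  qed
  have cont: "continuous_on UNIV (\<lambda>t :: 'x blowup_pt. projector (snd t) i i)" for i
    by (rule continuous_on_compose2[OF continuous_on_projector]) (auto intro!: continuous_intros)
  show ?thesis
  proof
    assume "(q, proj_pt v) \<in> strict_transform W"
    then have Z: "(q, proj_pt v) \<in> Z" and cl: "(q, proj_pt v) \<in> closure S"
      by (auto simp: strict_transform_def S_def)
    from vanishing_on_closure[OF open_UNIV cont cl] coord v
    show "(q, proj_pt v) \<in> Z \<and> v $ m = 0 \<and> v $ n = 0"
      using Z by (auto simp: projector_diag_eq_0)
  next
    assume *: "(q, proj_pt v) \<in> Z \<and> v $ m = 0 \<and> v $ n = 0"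
    then obtain s where q: "q \<in> U \<times> U" and quadric: "v $ 1 * v $ 2 = v $ 3 * v $ 4" and s: "zw q = s *s v"
      using v by (auto simp: Z_iff)
    have "(q, proj_pt v) \<in> closure S"
    proof (cases "q = (P, P)")
      case True
      have "(point_at (c *\<^sub>R v), proj_pt v) \<in> S" if "0 < c" "c *\<^sub>R v \<in> polydisk" for c
      proof -
        have c: "c *\<^sub>R v = of_real c *s v" by (rule scaleR_eq_smult)
        then have "(point_at (c *\<^sub>R v), proj_pt v) \<in> Z"
          using that quadric v by (auto simp: Z_iff zw_point_at intro: point_at_in_U)
        moreover have "point_at (c *\<^sub>R v) \<in> W"
          using that * point_at_in_U[of "c *\<^sub>R v"] by (simp add: W zw_point_at)
        moreover have "zw (point_at (c *\<^sub>R v)) \<noteq> 0"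
          using that v by (simp add: zw_point_at)
        then have "point_at (c *\<^sub>R v) \<noteq> (P, P)" using zw_PP by auto
        ultimately show ?thesis by (simp add: S_def)
      qed
      then show ?thesis using True in_closure_by_scaling by blast
    next
      case False
      then have "(q, proj_pt v) \<in> S" using * q s by (auto simp: S_def W)
      then show ?thesis using closure_subset by blast
    qed
    then show "(q, proj_pt v) \<in> strict_transform W"
      using * by (simp add: strict_transform_def S_def)
  qed
qed

end

text \<open>\<open>T i\<close> is cut out by the coordinates \<open>m\<close> and \<open>n\<close>, and the quadric is \<open>v\<^sub>mv\<^sub>m\<^sub>' = v\<^sub>nv\<^sub>n\<^sub>'\<close>. Each \<open>i\<close> occurs with
both orders of the pairs \<open>(m, m')\<close> and \<open>(n, n')\<close>: taking \<open>(m, m')\<close> from \<open>{1, 2}\<close> serves the first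
projection, and from \<open>{3, 4}\<close> the second.\<close>

definition component :: "nat \<Rightarrow> 4 \<Rightarrow> 4 \<Rightarrow> 4 \<Rightarrow> 4 \<Rightarrow> bool" where
  "component i m m' n n' \<longleftrightarrow> (i, m, m', n, n') \<in>
     {(1, 1, 2, 3, 4), (1, 3, 4, 1, 2), (2, 1, 2, 4, 3), (2, 4, 3, 1, 2),
      (3, 2, 1, 3, 4), (3, 3, 4, 2, 1), (4, 2, 1, 4, 3), (4, 4, 3, 2, 1)}"

lemma component_coordinates:
  assumes "component i m m' n n'"
  shows "i \<in> {1..4}" "\<And>j. j = m \<or> j = m' \<or> j = n \<or> j = n'"
    "m \<noteq> m'" "m \<noteq> n" "m \<noteq> n'" "m' \<noteq> n" "m' \<noteq> n'" "n \<noteq> n'"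
    "v $ 1 * v $ 2 = v $ 3 * v $ 4 \<longleftrightarrow> v $ m * v $ m' = v $ n * (v $ n' :: complex)"
proof -
  note c = assms[unfolded component_def insert_iff empty_iff Pair_inject]
  show "i \<in> {1..4}" using c by auto
  show "m \<noteq> m'" "m \<noteq> n" "m \<noteq> n'" "m' \<noteq> n" "m' \<noteq> n'" "n \<noteq> n'" using c by auto
  show "j = m \<or> j = m' \<or> j = n \<or> j = n'" for j using c exhaust_4[of j] by (elim disjE) auto
  show "v $ 1 * v $ 2 = v $ 3 * v $ 4 \<longleftrightarrow> v $ m * v $ m' = v $ n * (v $ n' :: complex)"
    using c by (elim disjE) (auto simp: mult_ac)
qed

context node_chart
begin

lemma T_component_iff:
  assumes c: "component i m m' n n'" and v: "v \<noteq> 0"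
  shows "(q, proj_pt v) \<in> T i \<longleftrightarrow> (q, proj_pt v) \<in> Z \<and> v $ m = 0 \<and> v $ n = 0"
proof -
  have "(Y 1 \<times> Y 1) = {q \<in> U \<times> U. zw q $ 1 = 0 \<and> zw q $ 3 = 0}"
    "(Y 1 \<times> Y 2) = {q \<in> U \<times> U. zw q $ 1 = 0 \<and> zw q $ 4 = 0}"
    "(Y 2 \<times> Y 1) = {q \<in> U \<times> U. zw q $ 2 = 0 \<and> zw q $ 3 = 0}"
    "(Y 2 \<times> Y 2) = {q \<in> U \<times> U. zw q $ 2 = 0 \<and> zw q $ 4 = 0}"
    by (auto simp: Y_def zw_nth)
  from this[THEN strict_transform_iff, OF v, of q] show ?thesis
    using c by (auto simp: T_def component_def)
qed

lemma T_5_iff: "t \<in> T 5 \<longleftrightarrow> t \<in> Z \<and> fst t = (P, P)"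
  by (simp add: T_def)

end

section \<open>The coefficient of a logarithmic form\<close>

lemma axis_nth: "axis i x $ j = (if j = i then x else 0)"
  by (simp add: axis_def)

lemma tendsto_ray_0: "((\<lambda>s. s *\<^sub>R v) \<longlongrightarrow> (0 :: 'a::real_normed_vector)) (at_right (0::real))"
  by (rule tendsto_eq_intros | simp)+

lemma eventually_ray_in:
  "open W \<Longrightarrow> 0 \<in> W \<Longrightarrow> eventually (\<lambda>s. s *\<^sub>R v \<in> (W :: 'a::real_normed_vector set)) (at_right (0::real))"
  by (rule topological_tendstoD[OF tendsto_ray_0])

lemma tendsto_along_ray:
  fixes h :: "'a::real_normed_vector \<Rightarrow> complex"
  assumes "continuous_on W h" "open W" "0 \<in> W"
  shows "((\<lambda>s. h (s *\<^sub>R v)) \<longlongrightarrow> h 0) (at_right 0)"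
  using assms by (intro isCont_tendsto_compose[OF _ tendsto_ray_0]) (simp add: continuous_on_eq_continuous_at)

lemma derivative_along_ray:
  fixes h :: "'a::real_normed_vector \<Rightarrow> complex"
  assumes h: "(h has_derivative h') (at 0)" and "h 0 = 0"
  shows "((\<lambda>s. h (s *\<^sub>R v) / of_real s) \<longlongrightarrow> h' v) (at_right 0)"
proof -
  have "((\<lambda>s. s *\<^sub>R v) has_derivative (\<lambda>s. s *\<^sub>R v)) (at 0)"
    by (auto intro!: derivative_eq_intros)
  from has_derivative_compose[OF this, of h h'] h
  have ray: "((\<lambda>s. h (s *\<^sub>R v)) has_derivative (\<lambda>s. h' (s *\<^sub>R v))) (at 0)" by simp
  have eq: "norm (h (s *\<^sub>R v) - h' (s *\<^sub>R v)) / norm s = norm (h (s *\<^sub>R v) / of_real s - h' v)"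
    if "s > 0" for s
  proof -
    have "h' (s *\<^sub>R v) = of_real s * h' v"
      using linear_scale[OF bounded_linear.linear[OF has_derivative_bounded_linear[OF h]], of s v]
      by (simp only: scaleR_conv_of_real[of s "h' v"])
    then have "h (s *\<^sub>R v) / of_real s - h' v = (h (s *\<^sub>R v) - h' (s *\<^sub>R v)) / of_real s"
      using that by (simp add: field_simps)
    then show ?thesis by (simp add: norm_divide)
  qed
  have "((\<lambda>s. norm (h (s *\<^sub>R v) - h' (s *\<^sub>R v)) / norm s) \<longlongrightarrow> 0) (at 0)"
    using ray \<open>h 0 = 0\<close> by (simp add: has_derivative_at)
  then have "((\<lambda>s. norm (h (s *\<^sub>R v) - h' (s *\<^sub>R v)) / norm s) \<longlongrightarrow> 0) (at_right 0)"
    by (rule tendsto_within_subset[OF _ subset_UNIV])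
  moreover have "\<forall>\<^sub>F s in at_right 0. norm (h (s *\<^sub>R v) - h' (s *\<^sub>R v)) / norm s
      = norm (h (s *\<^sub>R v) / of_real s - h' v)"
    using eventually_at_right_less by (rule eventually_mono) (rule eq)
  ultimately have "((\<lambda>s. norm (h (s *\<^sub>R v) / of_real s - h' v)) \<longlongrightarrow> 0) (at_right 0)"
    by (rule Lim_transform_eventually)
  then show ?thesis
    by (rule LIM_zero_cancel[OF tendsto_norm_zero_cancel])
qed

lemma tendsto_unique_at_right:
  fixes g h :: "real \<Rightarrow> complex"
  assumes "(g \<longlongrightarrow> a) (at_right 0)" "(h \<longlongrightarrow> b) (at_right 0)"
    and "eventually (\<lambda>s. g s = h s) (at_right 0)"
  shows "a = b"
  using assms tendsto_cong[OF assms(3)] by (metis tendsto_unique trivial_limit_at_right_real)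

lemma derivative_along_zero_ray:
  fixes h :: "'a::real_normed_vector \<Rightarrow> complex"
  assumes "(h has_derivative h') (at 0)" "open W" "0 \<in> W" "\<And>s. s *\<^sub>R v \<in> W \<Longrightarrow> h (s *\<^sub>R v) = 0"
  shows "h' v = 0"
proof (rule tendsto_unique_at_right)
  have "h 0 = 0" using assms(3) assms(4)[of 0] by simp
  then show "((\<lambda>s. h (s *\<^sub>R v) / of_real s) \<longlongrightarrow> h' v) (at_right 0)"
    using derivative_along_ray assms(1) by blast
  show "eventually (\<lambda>s. h (s *\<^sub>R v) / of_real s = 0) (at_right 0)"
    using eventually_ray_in[OF assms(2,3), of v]
    by (rule eventually_mono) (simp only: assms(4) div_0)
qed simp

lemma holomorphic_derivative_coordinates:
  fixes g :: "complex^3 \<Rightarrow> complex"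
  assumes "holomorphic_fun g D" "x \<in> D"
  shows "frechet_derivative g (at x) v =
    v $ 1 * frechet_derivative g (at x) (axis 1 1) + v $ 2 * frechet_derivative g (at x) (axis 2 1)
    + v $ 3 * frechet_derivative g (at x) (axis 3 1)"
proof -
  have "v = v $ 1 *s axis 1 1 + v $ 2 *s axis 2 1 + v $ 3 *s axis 3 1"
    by (simp add: vec_eq_iff forall_3 axis_def)
  then have "frechet_derivative g (at x) v = frechet_derivative g (at x)
      (v $ 1 *s axis 1 1 + v $ 2 *s axis 2 1 + v $ 3 *s axis 3 1)"
    by simp
  also have "\<dots> = v $ 1 * frechet_derivative g (at x) (axis 1 1) + v $ 2 * frechet_derivative g (at x) (axis 2 1)
    + v $ 3 * frechet_derivative g (at x) (axis 3 1)"
    by (simp only: linear_add[OF bounded_linear.linear[OF has_derivative_bounded_linear[OF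
            holomorphic_fun_derivative[OF assms]]]] holomorphic_fun_derivative_scale[OF assms])
  finally show ?thesis .
qed

lemma wedge_cancel:
  fixes c t b :: complex
  assumes "c * (t * b * t) = w * ((t * b1 + t1 * b) * t2 - (t * b2 + t2 * b) * t1)" "t \<noteq> 0"
  shows "c * (t * b) = w * (b1 * t2 - b2 * t1)"
proof -
  have "t * (c * (t * b)) = t * (w * (b1 * t2 - b2 * t1))"
    using assms(1) by (simp add: algebra_simps)
  then show ?thesis by (rule mult_left_cancel[OF assms(2), THEN iffD1])
qed

text \<open>The coefficient does not depend on the chart. Here \<open>G\<close> stands for \<open>zw\<close> and \<open>F\<close> for homogeneous coordinates
on the chart, so that \<open>G\<^sub>m = \<tau> \<beta>\<close> with \<open>\<tau> = G\<^sub>m\<^sub>'\<close> vanishing on \<open>u\<^sub>2 = 0\<close> and \<open>\<beta> = F\<^sub>m / F\<^sub>m\<^sub>'\<close> vanishing on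
\<open>u\<^sub>1 = 0\<close>. The form is \<open>d\<beta>/\<beta> \<and> d\<tau>/\<tau>\<close>, and its coefficient tends to \<open>1\<close> at the origin as soon as
\<open>\<partial>\<^sub>1\<beta>\<close> and \<open>\<partial>\<^sub>2\<tau>\<close> do not vanish there. If one of them did, the derivative of the immersion would
involve, besides the other one, only the ratio of \<open>F\<^sub>n\<^sub>'\<close> and \<open>F\<^sub>m\<^sub>'\<close>; two functionals on a
three-dimensional space have a common zero.\<close>

lemma log_coefficient_in_chart:
  fixes G F :: "complex^3 \<Rightarrow> complex^4"
  assumes G: "holomorphic_map G D" and F: "holomorphic_map F W" and W: "0 \<in> W" "W \<subseteq> D"
    and quadric: "\<And>y. y \<in> W \<Longrightarrow> F y $ m * F y $ m' = F y $ n * F y $ n'"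
    and parallel: "\<And>y. y \<in> W \<Longrightarrow> \<exists>s. G y = s *s F y"
    and zero1: "\<And>y. y \<in> W \<Longrightarrow> y $ 1 = 0 \<Longrightarrow> F y $ m = 0 \<and> F y $ n = 0"
    and zero2: "\<And>y. y \<in> W \<Longrightarrow> G y = 0 \<longleftrightarrow> y $ 2 = 0"
    and imm: "\<And>v. (\<forall>i. frechet_derivative (\<lambda>y. G y $ i) (at 0) v = 0) \<Longrightarrow>
      \<exists>c. \<forall>i. frechet_derivative (\<lambda>y. F y $ i) (at 0) v = c * F 0 $ i \<Longrightarrow> v = 0"
    and nz: "F 0 $ m' \<noteq> 0" "F 0 $ n' \<noteq> 0"
    and coords: "\<And>j. j = m \<or> j = m' \<or> j = n \<or> j = n'"
    and C: "continuous_on D C"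
    and eq: "\<And>u. u \<in> D \<Longrightarrow> C u * (G u $ m * G u $ m') = u $ 1 * u $ 2 *
        (frechet_derivative (\<lambda>y. G y $ m) (at u) (axis 1 1) * frechet_derivative (\<lambda>y. G y $ m') (at u) (axis 2 1)
       - frechet_derivative (\<lambda>y. G y $ m) (at u) (axis 2 1) * frechet_derivative (\<lambda>y. G y $ m') (at u) (axis 1 1))"
  shows "C 0 = 1"
proof -
  let ?e = "\<lambda>i::3. axis i (1::complex)"
  define dG where "dG j = frechet_derivative (\<lambda>y. G y $ j) (at 0)" for j
  define dF where "dF j = frechet_derivative (\<lambda>y. F y $ j) (at 0)" for j
  have hF: "holomorphic_fun (\<lambda>y. F y $ j) W" for j using F by (simp add: holomorphic_map_def)
  have openW: "open W" using holomorphic_fun_open[OF hF] .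
  have hG: "holomorphic_fun (\<lambda>y. G y $ j) W" for j
    using G openW W(2) holomorphic_fun_subset unfolding holomorphic_map_def by blast
  have dF: "((\<lambda>y. F y $ j) has_derivative dF j) (at 0)" for j
    unfolding dF_def by (rule holomorphic_fun_derivative[OF hF W(1)])
  have dG: "((\<lambda>y. G y $ j) has_derivative dG j) (at 0)" for j
    unfolding dG_def by (rule holomorphic_fun_derivative[OF hG W(1)])
  note dF_coord = holomorphic_derivative_coordinates[OF hF W(1), folded dF_def]
  note dG_coord = holomorphic_derivative_coordinates[OF hG W(1), folded dG_def]
  note F_lim = tendsto_along_ray[OF holomorphic_fun_continuous[OF hF] openW W(1)]
  note ev_W = eventually_ray_in[OF openW W(1)]
  have F0: "F 0 $ m = 0" "F 0 $ n = 0" using zero1[OF W(1)] by auto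
  have G0: "G 0 = 0" using zero2[OF W(1)] by auto
  have dF0: "dF m (?e 2) = 0" "dF m (?e 3) = 0" "dF n (?e 2) = 0" "dF n (?e 3) = 0"
    by (rule derivative_along_zero_ray[OF dF openW W(1)], simp add: zero1 axis_nth)+
  have zero2': "G y $ j = 0" if "y \<in> W" "y $ 2 = 0" for y j using zero2[OF that(1)] that(2) by simp
  have dG0: "dG j (?e 1) = 0" "dG j (?e 3) = 0" for j
    by (rule derivative_along_zero_ray[OF dG openW W(1)], simp add: zero2' axis_nth)+
  have an: "dF m (?e 1) * F 0 $ m' = dF n (?e 1) * F 0 $ n'"
  proof (rule tendsto_unique_at_right)
    show "((\<lambda>s. F (s *\<^sub>R ?e 1) $ m / of_real s * F (s *\<^sub>R ?e 1) $ m') \<longlongrightarrow> dF m (?e 1) * F 0 $ m') (at_right 0)"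
      by (intro tendsto_mult derivative_along_ray[OF dF] F_lim F0)
    show "((\<lambda>s. F (s *\<^sub>R ?e 1) $ n / of_real s * F (s *\<^sub>R ?e 1) $ n') \<longlongrightarrow> dF n (?e 1) * F 0 $ n') (at_right 0)"
      by (intro tendsto_mult derivative_along_ray[OF dF] F_lim F0)
    show "\<forall>\<^sub>F s in at_right 0. F (s *\<^sub>R ?e 1) $ m / of_real s * F (s *\<^sub>R ?e 1) $ m'
        = F (s *\<^sub>R ?e 1) $ n / of_real s * F (s *\<^sub>R ?e 1) $ n'"
      using ev_W[of "?e 1"] by eventually_elim (simp add: quadric)
  qed
  have eG: "dG j (?e 2) * F 0 $ m' = dG m' (?e 2) * F 0 $ j" for j
  proof (rule tendsto_unique_at_right)
    show "((\<lambda>s. G (s *\<^sub>R ?e 2) $ j / of_real s * F (s *\<^sub>R ?e 2) $ m') \<longlongrightarrow> dG j (?e 2) * F 0 $ m') (at_right 0)"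
      by (intro tendsto_mult derivative_along_ray[OF dG] F_lim) (simp add: G0)
    show "((\<lambda>s. G (s *\<^sub>R ?e 2) $ m' / of_real s * F (s *\<^sub>R ?e 2) $ j) \<longlongrightarrow> dG m' (?e 2) * F 0 $ j) (at_right 0)"
      by (intro tendsto_mult derivative_along_ray[OF dG] F_lim) (simp add: G0)
    have swap: "G y $ j * F y $ m' = G y $ m' * F y $ j" if y: "y \<in> W" for y
      using parallel[OF y] by auto
    show "\<forall>\<^sub>F s in at_right 0. G (s *\<^sub>R ?e 2) $ j / of_real s * F (s *\<^sub>R ?e 2) $ m'
        = G (s *\<^sub>R ?e 2) $ m' / of_real s * F (s *\<^sub>R ?e 2) $ j"
      using ev_W[of "?e 2"] by (rule eventually_mono) (drule swap, simp)
  qed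
  (* the derivative of F_m' / F_n' at the origin, up to a nonzero factor *)
  define \<theta> where "\<theta> v = F 0 $ n' * dF m' v - F 0 $ m' * dF n' v" for v
  have \<theta>_coord: "\<theta> v = v $ 1 * \<theta> (?e 1) + v $ 2 * \<theta> (?e 2) + v $ 3 * \<theta> (?e 3)" for v
    unfolding \<theta>_def dF_coord[of _ v] by (simp add: algebra_simps)
  have ker: "v = 0" if "\<And>j. dG j v = 0" "dF m v = 0" "dF n v = 0" "\<theta> v = 0" for v
  proof (rule imm)
    show "\<forall>i. frechet_derivative (\<lambda>y. G y $ i) (at 0) v = 0" using that(1) by (simp add: dG_def)
    have "dF n' v = dF m' v / F 0 $ m' * F 0 $ n'"
      using that(4) nz by (simp add: \<theta>_def field_simps)
    then have "dF j v = dF m' v / F 0 $ m' * F 0 $ j" for j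
      using coords[of j] that(2,3) F0 nz(1) by auto
    then show "\<exists>c. \<forall>i. frechet_derivative (\<lambda>y. F y $ i) (at 0) v = c * F 0 $ i"
      unfolding dF_def by blast
  qed
  (* With a vanishing partial derivative, the zeros of \<theta> in a coordinate plane would lie in the kernel. *)
  have a: "dF m (?e 1) \<noteq> 0"
  proof
    assume a: "dF m (?e 1) = 0"
    have key: "v = 0" if "v $ 2 = 0" "\<theta> v = 0" for v
      using that a an nz by (intro ker) (auto simp: dG_coord[of _ v] dF_coord[of _ v] dF0 dG0)
    have "vector [\<theta> (?e 3), 0, - \<theta> (?e 1)] = (0 :: complex^3)"
      by (rule key) (simp_all add: \<theta>_coord[of "vector _"])
    then have "\<theta> (?e 1) = 0" by (auto simp: vec_eq_iff forall_3)
    then have "?e 1 = 0" by (intro key) (simp_all add: axis_def)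
    then show False by simp
  qed
  have e: "dG m' (?e 2) \<noteq> 0"
  proof
    assume e: "dG m' (?e 2) = 0"
    have key: "v = 0" if "v $ 1 = 0" "\<theta> v = 0" for v
      using that e eG nz by (intro ker) (auto simp: dG_coord[of _ v] dF_coord[of _ v] dF0 dG0)
    have "vector [0, \<theta> (?e 3), - \<theta> (?e 2)] = (0 :: complex^3)"
      by (rule key) (simp_all add: \<theta>_coord[of "vector _"])
    then have "\<theta> (?e 2) = 0" by (auto simp: vec_eq_iff forall_3)
    then have "?e 2 = 0" by (intro key) (simp_all add: axis_def)
    then show False by simp
  qed
  define V where "V = {y \<in> W. F y $ m' \<noteq> 0}"
  have "V = (\<lambda>y. F y $ m') -` (- {0}) \<inter> W" by (auto simp: V_def)
  also have "open \<dots>"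
    using holomorphic_fun_continuous[OF hF] openW
    by (subst (asm) continuous_on_open_vimage) (auto simp: open_Compl)
  finally have openV: "open V" .
  have V: "0 \<in> V" "V \<subseteq> W" using W(1) nz(1) by (auto simp: V_def)
  define \<tau> where "\<tau> = (\<lambda>y. G y $ m')"
  define \<beta> where "\<beta> = (\<lambda>y. F y $ m / F y $ m')"
  have h\<tau>: "holomorphic_fun \<tau> V"
    unfolding \<tau>_def using holomorphic_fun_subset[OF hG openV V(2)] .
  have h\<beta>: "holomorphic_fun \<beta> V"
    unfolding \<beta>_def
    by (intro holomorphic_fun_divide holomorphic_fun_subset[OF hF openV V(2)]) (simp add: V_def)
  let ?d = "\<lambda>h y. frechet_derivative h (at y)"
  have Gm: "G y $ m = \<tau> y * \<beta> y" if "y \<in> V" for y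
  proof -
    have "y \<in> W" using that V(2) by blast
    then obtain s where "G y = s *s F y" using parallel by blast
    then show ?thesis using that by (simp add: \<tau>_def \<beta>_def V_def)
  qed
  have dGm: "?d (\<lambda>y. G y $ m) y v = \<tau> y * ?d \<beta> y v + ?d \<tau> y v * \<beta> y" if y: "y \<in> V" for y v
  proof -
    have "((\<lambda>y. \<tau> y * \<beta> y) has_derivative (\<lambda>v. \<tau> y * ?d \<beta> y v + ?d \<tau> y v * \<beta> y)) (at y)"
      by (intro has_derivative_mult holomorphic_fun_derivative[OF h\<tau> y] holomorphic_fun_derivative[OF h\<beta> y])
    then have "((\<lambda>y. G y $ m) has_derivative (\<lambda>v. \<tau> y * ?d \<beta> y v + ?d \<tau> y v * \<beta> y)) (at y)"
      by (rule has_derivative_transform_within_open[OF _ openV y]) (simp add: Gm)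
    from fun_cong[OF frechet_derivative_at[OF this], symmetric] show ?thesis .
  qed
  have C\<tau>\<beta>: "C y * (\<tau> y * \<beta> y) = y $ 1 * y $ 2 *
      (?d \<beta> y (?e 1) * ?d \<tau> y (?e 2) - ?d \<beta> y (?e 2) * ?d \<tau> y (?e 1))"
    if y: "y \<in> V" "y $ 2 \<noteq> 0" for y
  proof -
    have yW: "y \<in> W" using y V(2) by blast
    then obtain s where s: "G y = s *s F y" using parallel by blast
    have "G y \<noteq> 0" using zero2[OF yW] y(2) by blast
    then have "s \<noteq> 0" using s by auto
    then have \<tau>: "\<tau> y \<noteq> 0" using y(1) by (simp add: \<tau>_def s V_def)
    have "y \<in> D" using yW W(2) by blast
    note e = eq[OF this, folded \<tau>_def]
    have "G y $ m' = \<tau> y" by (simp only: \<tau>_def)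
    from e[unfolded dGm[OF y(1)] Gm[OF y(1)] this] show ?thesis
      by (rule wedge_cancel[OF _ \<tau>])
  qed
  have \<beta>0: "\<beta> 0 = 0" "\<tau> 0 = 0" by (simp_all add: \<beta>_def \<tau>_def F0 G0)
  note d\<beta> = holomorphic_fun_derivative[OF h\<beta> V(1)] and d\<tau> = holomorphic_fun_derivative[OF h\<tau> V(1)]
  have \<beta>1: "?d \<beta> 0 (?e 1) = dF m (?e 1) / F 0 $ m'"
  proof (rule tendsto_unique_at_right)
    show "((\<lambda>s. \<beta> (s *\<^sub>R ?e 1) / of_real s) \<longlongrightarrow> ?d \<beta> 0 (?e 1)) (at_right 0)"
      by (rule derivative_along_ray[OF d\<beta> \<beta>0(1)])
    show "((\<lambda>s. (F (s *\<^sub>R ?e 1) $ m / of_real s) / F (s *\<^sub>R ?e 1) $ m') \<longlongrightarrow> dF m (?e 1) / F 0 $ m') (at_right 0)"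
      by (intro tendsto_divide derivative_along_ray[OF dF] F_lim F0 nz)
  qed (simp add: \<beta>_def mult_ac)
  have \<beta>2: "?d \<beta> 0 (?e 2) = 0"
  proof (rule derivative_along_zero_ray[OF d\<beta> openV V(1)])
    show "\<beta> (s *\<^sub>R ?e 2) = 0" if "s *\<^sub>R ?e 2 \<in> V" for s
      using zero1[of "s *\<^sub>R ?e 2"] that V(2) by (auto simp: \<beta>_def axis_nth)
  qed
  have \<tau>12: "?d \<tau> 0 (?e 1) = 0" "?d \<tau> 0 (?e 2) = dG m' (?e 2)"
    using dG0 by (simp_all add: \<tau>_def dG_def)
  have nonzero: "?d \<beta> 0 (?e 1) \<noteq> 0" "?d \<tau> 0 (?e 2) \<noteq> 0"
    using a e nz by (simp_all add: \<beta>1 \<tau>12)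
  (* The ray through (1, 1, 0) avoids both components, where the equation for C says nothing. *)
  let ?u = "?e 1 + ?e 2"
  have du: "?d \<beta> 0 ?u = ?d \<beta> 0 (?e 1)" "?d \<tau> 0 ?u = ?d \<tau> 0 (?e 2)"
    using linear_add[OF bounded_linear.linear[OF has_derivative_bounded_linear[OF d\<beta>]]]
      linear_add[OF bounded_linear.linear[OF has_derivative_bounded_linear[OF d\<tau>]]]
    by (simp_all add: \<beta>2 \<tau>12(1))
  have contC: "continuous_on V C" using C V(2) W(2) by (blast intro: continuous_on_subset)
  note lim = tendsto_along_ray[OF _ openV V(1), of _ ?u]
  note cont\<beta> = holomorphic_fun_continuous_derivative[OF h\<beta>]
    and cont\<tau> = holomorphic_fun_continuous_derivative[OF h\<tau>]
  have "C 0 * (?d \<tau> 0 ?u * ?d \<beta> 0 ?u) =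
      ?d \<beta> 0 (?e 1) * ?d \<tau> 0 (?e 2) - ?d \<beta> 0 (?e 2) * ?d \<tau> 0 (?e 1)"
  proof (rule tendsto_unique_at_right)
    show "((\<lambda>s. C (s *\<^sub>R ?u) * (\<tau> (s *\<^sub>R ?u) / of_real s * (\<beta> (s *\<^sub>R ?u) / of_real s)))
        \<longlongrightarrow> C 0 * (?d \<tau> 0 ?u * ?d \<beta> 0 ?u)) (at_right 0)"
      by (intro tendsto_mult lim contC derivative_along_ray[OF d\<beta>] derivative_along_ray[OF d\<tau>] \<beta>0)
    show "((\<lambda>s. ?d \<beta> (s *\<^sub>R ?u) (?e 1) * ?d \<tau> (s *\<^sub>R ?u) (?e 2)
          - ?d \<beta> (s *\<^sub>R ?u) (?e 2) * ?d \<tau> (s *\<^sub>R ?u) (?e 1))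
        \<longlongrightarrow> ?d \<beta> 0 (?e 1) * ?d \<tau> 0 (?e 2) - ?d \<beta> 0 (?e 2) * ?d \<tau> 0 (?e 1)) (at_right 0)"
      by (intro tendsto_mult tendsto_diff lim[OF cont\<beta>] lim[OF cont\<tau>])
    have "eventually (\<lambda>s::real. 0 < s) (at_right 0)" by (rule eventually_at_right_less)
    with eventually_ray_in[OF openV V(1), of ?u]
    show "\<forall>\<^sub>F s in at_right 0.
        C (s *\<^sub>R ?u) * (\<tau> (s *\<^sub>R ?u) / of_real s * (\<beta> (s *\<^sub>R ?u) / of_real s)) =
        ?d \<beta> (s *\<^sub>R ?u) (?e 1) * ?d \<tau> (s *\<^sub>R ?u) (?e 2)
          - ?d \<beta> (s *\<^sub>R ?u) (?e 2) * ?d \<tau> (s *\<^sub>R ?u) (?e 1)"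
    proof eventually_elim
      case (elim s)
      have u: "(s *\<^sub>R ?u) $ 1 = of_real s" "(s *\<^sub>R ?u) $ 2 = of_real s"
        by (simp_all add: scaleR_eq_smult axis_nth)
      have u2: "(s *\<^sub>R ?u) $ 2 \<noteq> 0" unfolding u using elim(2) by simp
      have "C (s *\<^sub>R ?u) * (\<tau> (s *\<^sub>R ?u) * \<beta> (s *\<^sub>R ?u)) = of_real s * of_real s *
         (?d \<beta> (s *\<^sub>R ?u) (?e 1) * ?d \<tau> (s *\<^sub>R ?u) (?e 2)
          - ?d \<beta> (s *\<^sub>R ?u) (?e 2) * ?d \<tau> (s *\<^sub>R ?u) (?e 1))"
        using C\<tau>\<beta>[OF elim(1) u2] by (simp only: u)
      then show ?case using elim(2) by (simp add: field_simps)
    qed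
  qed
  then show ?thesis
    unfolding du using nonzero by (simp add: \<beta>2)
qed

section \<open>The coefficients along the exceptional double strata\<close>

lemma frechet_derivative_eqI:
  assumes "(g has_derivative g') (at x)" "open D" "x \<in> D" "\<And>y. y \<in> D \<Longrightarrow> f y = g y"
  shows "frechet_derivative f (at x) = g'"
proof -
  have "(f has_derivative g') (at x)"
    by (rule has_derivative_transform_within_open[OF assms(1,2,3)]) (simp add: assms(4))
  then show ?thesis by (rule frechet_derivative_at[symmetric])
qed

lemma continuous_on_vector_3:
  assumes "continuous_on S a" "continuous_on S b" "continuous_on S c"
  shows "continuous_on S (\<lambda>x. vector [a x, b x, c x] :: complex^3)"
proof (rule continuous_on_eq)
  have "continuous_on S (\<lambda>x. if i = 1 then a x else if i = 2 then b x else c x)" for i :: 3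
    using assms by (cases "i = 1"; cases "i = 2") auto
  then show "continuous_on S (\<lambda>x. (\<chi> i. if i = 1 then a x else if i = 2 then b x else c x) :: complex^3)"
    by (rule continuous_on_vec_lambda)
qed (auto simp: vec_eq_iff forall_3)

context node_chart
begin

lemma T_iff:
  assumes "v \<noteq> 0"
  shows "(q, proj_pt v) \<in> T 1 \<longleftrightarrow> (q, proj_pt v) \<in> Z \<and> v $ 1 = 0 \<and> v $ 3 = 0"
    "(q, proj_pt v) \<in> T 2 \<longleftrightarrow> (q, proj_pt v) \<in> Z \<and> v $ 1 = 0 \<and> v $ 4 = 0"
    "(q, proj_pt v) \<in> T 3 \<longleftrightarrow> (q, proj_pt v) \<in> Z \<and> v $ 2 = 0 \<and> v $ 3 = 0"
    "(q, proj_pt v) \<in> T 4 \<longleftrightarrow> (q, proj_pt v) \<in> Z \<and> v $ 2 = 0 \<and> v $ 4 = 0"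
  by (rule T_component_iff[OF _ assms], simp add: component_def)+

lemma Z_in_U: "t \<in> Z \<Longrightarrow> fst t \<in> U \<times> U"
  by (auto simp: Z_def fibre_product_def)

lemma Z_quadric: "(q, proj_pt v) \<in> Z \<Longrightarrow> v \<noteq> 0 \<Longrightarrow> v $ 1 * v $ 2 = v $ 3 * v $ 4"
  by (simp add: Z_iff)

text \<open>The conditions \<open>v\<^sub>m = v\<^sub>n = 0\<close> leave a line on the quadric; its two points with another vanishing
coordinate are the corners, which lie on the two neighbouring components.\<close>

lemma generic_point_iff:
  assumes c: "component i m m' n n'" and v: "v \<noteq> 0"
  shows "(q, proj_pt v) \<in> T_cap {i, 5} - (\<Union>l\<in>{1..5} - {i, 5}. T l) \<longleftrightarrow>
    q = (P, P) \<and> v $ m = 0 \<and> v $ n = 0 \<and> v $ m' \<noteq> 0 \<and> v $ n' \<noteq> 0"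
proof -
  have Zq: "(q, proj_pt v) \<in> Z" if "q = (P, P)" "v $ m = 0" "v $ n = 0"
    using that component_coordinates(9)[OF c, of v] v P_in_U
    by (auto simp: Z_iff zw_PP intro!: exI[of _ 0])
  have nz: "\<not> (v $ m' = 0 \<and> v $ n' = 0)" if "v $ m = 0" "v $ n = 0"
  proof
    assume *: "v $ m' = 0 \<and> v $ n' = 0"
    have "v $ j = 0" for j using component_coordinates(2)[OF c, of j] that * by (elim disjE) simp_all
    then show False using v by (simp add: vec_eq_iff)
  qed
  have union: "(\<Union>l\<in>{1..5} - {i, 5}. T l) = (\<Union>l\<in>{1, 2, 3, 4} - {i}. T l)"
    by (rule arg_cong[of _ _ "\<lambda>S. \<Union> (T ` S)"]) auto
  have "(q, proj_pt v) \<in> T_cap {i, 5} \<longleftrightarrow> q = (P, P) \<and> v $ m = 0 \<and> v $ n = 0"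
    using Zq by (auto simp: T_cap_def T_component_iff[OF c v] T_5_iff)
  moreover have "(q, proj_pt v) \<in> (\<Union>l\<in>{1..5} - {i, 5}. T l) \<longleftrightarrow> v $ m' = 0 \<or> v $ n' = 0"
    if "(q, proj_pt v) \<in> Z" "v $ m = 0" "v $ n = 0"
  proof -
    have "(q, proj_pt v) \<in> T 1 \<longleftrightarrow> v $ 1 = 0 \<and> v $ 3 = 0" "(q, proj_pt v) \<in> T 2 \<longleftrightarrow> v $ 1 = 0 \<and> v $ 4 = 0"
      "(q, proj_pt v) \<in> T 3 \<longleftrightarrow> v $ 2 = 0 \<and> v $ 3 = 0" "(q, proj_pt v) \<in> T 4 \<longleftrightarrow> v $ 2 = 0 \<and> v $ 4 = 0"
      using that(1) by (simp_all only: T_iff[OF v] simp_thms)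
    then show ?thesis
      using that(2,3) nz[OF that(2,3)] c[unfolded component_def insert_iff empty_iff Pair_inject]
      unfolding union
      by (elim disjE) (simp_all add: insert_Diff_if del: One_nat_def, blast+)
  qed
  ultimately show ?thesis using Zq by blast
qed

lemma log_coefficient_unique:
  assumes c: "component i m m' n n'"
    and log: "log_coefficient (\<lambda>t. zw (fst t) $ m) (\<lambda>t. zw (fst t) $ m') i 5 a"
  shows "a = 1"
proof -
  (* One generic point suffices; it also shows that the condition is not void. *)
  define v0 :: "complex^4" where "v0 = (\<chi> j. if j = m' \<or> j = n' then 1 else 0)"
  note mn = component_coordinates[OF c]
  have v0: "v0 $ m = 0" "v0 $ n = 0" "v0 $ m' = 1" "v0 $ n' = 1"
    using mn(3-8) by (auto simp: v0_def)
  then have "v0 \<noteq> 0" by (intro notI) simp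
  let ?q = "((P, P), proj_pt v0)"
  have "?q \<in> T_cap {i, 5} - (\<Union>l\<in>{1..5} - {i, 5}. T l)"
    using generic_point_iff[OF c \<open>v0 \<noteq> 0\<close>] v0 by simp
  then obtain D \<psi> C where ad: "adapted_chart i 5 ?q D \<psi>" and C: "continuous_on D C" "C 0 = of_rat a"
    and eq: "\<And>u. u \<in> D \<Longrightarrow> C u * (zw (fst (\<psi> u)) $ m * zw (fst (\<psi> u)) $ m') =
             u $ 1 * u $ 2 * (partial 1 ((\<lambda>t. zw (fst t) $ m) \<circ> \<psi>) u * partial 2 ((\<lambda>t. zw (fst t) $ m') \<circ> \<psi>) u
                            - partial 2 ((\<lambda>t. zw (fst t) $ m) \<circ> \<psi>) u * partial 1 ((\<lambda>t. zw (fst t) $ m') \<circ> \<psi>) u)"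
    using log unfolding log_coefficient_def by meson
  let ?G = "zw \<circ> fst \<circ> \<psi>"
  have D: "0 \<in> D" "\<psi> 0 = ?q" and imm: "holomorphic_immersion ?G (snd \<circ> \<psi>) D"
    and Ti: "\<And>u. u \<in> D \<Longrightarrow> \<psi> u \<in> T i \<longleftrightarrow> u $ 1 = 0"
    and T5: "\<And>u. u \<in> D \<Longrightarrow> \<psi> u \<in> T 5 \<longleftrightarrow> u $ 2 = 0"
    and sub: "\<psi> ` D \<subseteq> Z"
    using ad by (auto simp: adapted_chart_def dest: openin_imp_subset)
  obtain W F where W: "0 \<in> W" "W \<subseteq> D" "holomorphic_map F W"
    and F: "\<And>y. y \<in> W \<Longrightarrow> F y \<noteq> 0 \<and> (snd \<circ> \<psi>) y = proj_pt (F y)"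
    and ker: "\<And>v. (\<forall>i. frechet_derivative (\<lambda>y. ?G y $ i) (at 0) v = 0) \<and>
             (\<exists>c. \<forall>i. frechet_derivative (\<lambda>y. F y $ i) (at 0) v = c * F 0 $ i) \<Longrightarrow> v = 0"
    using imm D(1) unfolding holomorphic_immersion_def by meson
  have \<psi>: "\<psi> y = (fst (\<psi> y), proj_pt (F y))" if "y \<in> W" for y
    using F[OF that] by (simp add: prod_eq_iff)
  have ZW: "(fst (\<psi> y), proj_pt (F y)) \<in> Z" if "y \<in> W" for y
    unfolding \<psi>[OF that, symmetric] using sub W(2) that by blast
  have "proj_pt v0 = proj_pt (F 0)" using F[OF W(1)] D(2) by simp
  then obtain k where k: "k \<noteq> 0" "F 0 = k *s v0"
    using F[OF W(1)] \<open>v0 \<noteq> 0\<close> by (auto simp: proj_pt_eq_iff)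
  have "C 0 = 1"
  proof (rule log_coefficient_in_chart[of ?G D F W m m' n n' C])
    show "holomorphic_map ?G D" using imm by (simp add: holomorphic_immersion_def)
    show "F y $ m * F y $ m' = F y $ n * F y $ n'" if "y \<in> W" for y
      using Z_quadric[OF ZW[OF that]] F[OF that] mn(9) by simp
    show "\<exists>s. ?G y = s *s F y" if "y \<in> W" for y
      using ZW[OF that] F[OF that] by (simp add: Z_iff)
    show "F y $ m = 0 \<and> F y $ n = 0" if "y \<in> W" "y $ 1 = 0" for y
    proof -
      have "(fst (\<psi> y), proj_pt (F y)) \<in> T i"
        unfolding \<psi>[OF that(1), symmetric] using Ti that W(2) by blast
      then show ?thesis using T_component_iff[OF c] F[OF that(1)] by blast
    qed
    show "?G y = 0 \<longleftrightarrow> y $ 2 = 0" if "y \<in> W" for y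
    proof -
      have yD: "y \<in> D" using that W(2) by blast
      then have "\<psi> y \<in> Z" using sub by blast
      then have "?G y = 0 \<longleftrightarrow> \<psi> y \<in> T 5"
        using zw_eq_0_iff[OF Z_in_U] by (simp add: T_5_iff)
      then show ?thesis using T5[OF yD] by simp
    qed
    show "F 0 $ m' \<noteq> 0" "F 0 $ n' \<noteq> 0" using k v0 by simp_all
    show "j = m \<or> j = m' \<or> j = n \<or> j = n'" for j by (rule mn(2))
    show "C u * (?G u $ m * ?G u $ m') = u $ 1 * u $ 2 *
        (frechet_derivative (\<lambda>y. ?G y $ m) (at u) (axis 1 1) * frechet_derivative (\<lambda>y. ?G y $ m') (at u) (axis 2 1)
       - frechet_derivative (\<lambda>y. ?G y $ m) (at u) (axis 2 1) * frechet_derivative (\<lambda>y. ?G y $ m') (at u) (axis 1 1))"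
      if "u \<in> D" for u
      using eq[OF that] by (simp add: partial_def comp_def)
  qed (use W C ker in auto)
  then show ?thesis using C(2) by (simp add: of_rat_eq_1_iff)
qed

end

section \<open>Charts of the blow-up\<close>

text \<open>Where \<open>v\<^sub>m\<^sub>' = 1\<close>, the quadric is the graph \<open>v\<^sub>m = v\<^sub>nv\<^sub>n\<^sub>'\<close>. The parameters are \<open>u\<^sub>1 = v\<^sub>n\<close>, an equation of
\<open>T\<^sub>i\<close>, and \<open>u\<^sub>3 = v\<^sub>n\<^sub>' - c0\<close>; the remaining parameter \<open>u\<^sub>2\<close> will be the scaling factor between \<open>v\<close> and \<open>zw\<close>,
an equation of \<open>T\<^sub>5\<close>.\<close>

definition quadric_chart :: "4 \<Rightarrow> 4 \<Rightarrow> 4 \<Rightarrow> complex \<Rightarrow> complex^3 \<Rightarrow> complex^4" where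
  "quadric_chart m m' n c0 u = (\<chi> j. if j = m then u $ 1 * (c0 + u $ 3) else if j = m' then 1
     else if j = n then u $ 1 else c0 + u $ 3)"

lemma quadric_chart_nth:
  assumes "component i m m' n n'"
  shows "quadric_chart m m' n c0 u $ m = u $ 1 * (c0 + u $ 3)"
    "quadric_chart m m' n c0 u $ m' = 1"
    "quadric_chart m m' n c0 u $ n = u $ 1"
    "quadric_chart m m' n c0 u $ n' = c0 + u $ 3"
  using component_coordinates(3-8)[OF assms] by (simp_all add: quadric_chart_def)

lemma quadric_chart_nonzero: "component i m m' n n' \<Longrightarrow> quadric_chart m m' n c0 u \<noteq> 0"
  by (rule notI) (drule quadric_chart_nth(2)[of _ _ _ _ _ c0 u], simp)

lemma holomorphic_quadric_chart: "open D \<Longrightarrow> holomorphic_fun (\<lambda>u. quadric_chart m m' n c0 u $ j) D"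
proof -
  assume D: "open D"
  have "holomorphic_fun (\<lambda>u :: complex^3. u $ 1 * (c0 + u $ 3)) D"
    "holomorphic_fun (\<lambda>u :: complex^3. 1) D" "holomorphic_fun (\<lambda>u :: complex^3. u $ 1) D"
    "holomorphic_fun (\<lambda>u :: complex^3. c0 + u $ 3) D"
    by (intro holomorphic_fun_mult holomorphic_fun_add holomorphic_fun_coord holomorphic_fun_const D)+
  then show ?thesis
    by (cases "j = m"; cases "j = m'"; cases "j = n") (simp_all add: quadric_chart_def)
qed

lemma has_derivative_nth: "((\<lambda>u. u $ i) has_derivative (\<lambda>v. v $ i)) (at x)"
  by (rule bounded_linear_imp_has_derivative[OF bounded_linear_vec_nth])

lemma vec_eq_component_iff:
  assumes "component i m m' n n'"
  shows "v = w \<longleftrightarrow> v $ m = w $ m \<and> v $ m' = w $ m' \<and> v $ n = w $ n \<and> v $ n' = w $ n'"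
proof
  assume *: "v $ m = w $ m \<and> v $ m' = w $ m' \<and> v $ n = w $ n \<and> v $ n' = w $ n'"
  have "v $ j = w $ j" for j using component_coordinates(2)[OF assms, of j] * by (elim disjE) simp_all
  then show "v = w" by (simp add: vec_eq_iff)
qed simp

context node_chart
begin

context
  fixes i :: nat and m m' n n' :: 4 and c0 :: complex
  assumes comp: "component i m m' n n'"
begin

abbreviation (input) "hom_coord u \<equiv> quadric_chart m m' n c0 u"
abbreviation (input) "aff_coord u \<equiv> u $ 2 *s quadric_chart m m' n c0 u"

definition chart_domain :: "(complex^3) set" where
  "chart_domain = {u. aff_coord u \<in> polydisk}"

definition chart :: "complex^3 \<Rightarrow> 'x blowup_pt" where
  "chart u = (point_at (aff_coord u), proj_pt (hom_coord u))"

definition chart_inv :: "'x blowup_pt \<Rightarrow> complex^3" where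
  "chart_inv t = vector [projector (snd t) n m' / projector (snd t) m' m', zw (fst t) $ m',
     projector (snd t) n' m' / projector (snd t) m' m' - c0]"

lemma hom_coord_nonzero: "hom_coord u \<noteq> 0" by (rule quadric_chart_nonzero[OF comp])

lemma continuous_on_hom: "continuous_on S (\<lambda>u. hom_coord u $ j)"
  using holomorphic_fun_continuous[OF holomorphic_quadric_chart[OF open_UNIV]]
  by (rule continuous_on_subset) simp

lemma continuous_on_hom_coord: "continuous_on S (\<lambda>u. hom_coord u)"
proof -
  have "continuous_on S (\<lambda>u. \<chi> j. hom_coord u $ j)"
    by (intro continuous_on_vec_lambda continuous_on_hom)
  then show ?thesis by simp
qed

lemma continuous_on_aff_coord: "continuous_on S (\<lambda>u. aff_coord u)"
proof -
  have "continuous_on S (\<lambda>u. \<chi> j. u $ 2 * hom_coord u $ j)"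
    by (intro continuous_on_vec_lambda continuous_on_mult continuous_on_hom continuous_intros)
  then show ?thesis by (simp add: vector_scalar_mult_def)
qed

lemma open_chart_domain: "open chart_domain"
proof -
  have "chart_domain = (\<lambda>u. aff_coord u) -` polydisk \<inter> UNIV" by (auto simp: chart_domain_def)
  also have "open \<dots>"
    using continuous_on_aff_coord[of UNIV] open_polydisk
    by (subst (asm) continuous_on_open_vimage) auto
  finally show ?thesis .
qed

lemma zw_chart: "u \<in> chart_domain \<Longrightarrow> zw (fst (chart u)) = aff_coord u"
  by (simp add: chart_def chart_domain_def zw_point_at)

lemma chart_in_Z:
  assumes "u \<in> chart_domain"
  shows "chart u \<in> Z"
proof -
  have "hom_coord u $ 1 * hom_coord u $ 2 = hom_coord u $ 3 * hom_coord u $ 4"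
    by (simp add: component_coordinates(9)[OF comp] quadric_chart_nth[OF comp])
  then show ?thesis
    using assms point_at_in_U zw_chart[OF assms]
    by (auto simp: chart_def Z_iff[OF hom_coord_nonzero] chart_domain_def)
qed

lemma chart_chart_inv:
  assumes t: "t \<in> Z" and nz: "projector (snd t) m' m' \<noteq> 0"
  shows "chart_inv t \<in> chart_domain" "chart (chart_inv t) = t"
proof -
  obtain v where v: "v \<noteq> 0" "snd t = proj_pt v" by (rule proj_obtain)
  then have vm: "v $ m' \<noteq> 0" using nz by (simp add: projector_diag_eq_0)
  define w where "w = (1 / v $ m') *s v"
  have w: "w \<noteq> 0" "snd t = proj_pt w" "w $ m' = 1"
    using v vm by (auto simp: w_def proj_pt_smult)
  have t_eq: "t = (fst t, proj_pt w)" using w(2) by (simp add: prod_eq_iff)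
  then have Z: "(fst t, proj_pt w) \<in> Z" using t by simp
  then obtain s where s: "zw (fst t) = s *s w" using w(1) by (auto simp: Z_iff)
  have quadric: "w $ m = w $ n * w $ n'"
    using Z_quadric[OF Z w(1)] by (simp add: component_coordinates(9)[OF comp] w(3))
  have inv: "chart_inv t $ 1 = w $ n" "chart_inv t $ 2 = s" "chart_inv t $ 3 = w $ n' - c0"
    using w s by (simp_all add: chart_inv_def projector_ratio)
  have "hom_coord (chart_inv t) = w"
    unfolding vec_eq_component_iff[OF comp] quadric_chart_nth[OF comp] inv
    by (simp add: w(3) quadric)
  then have hom: "hom_coord (chart_inv t) = w" "aff_coord (chart_inv t) = zw (fst t)"
    using s inv(2) by simp_all
  have U: "fst t \<in> U \<times> U" using Z_in_U[OF t] .
  show "chart_inv t \<in> chart_domain"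
    unfolding chart_domain_def mem_Collect_eq hom(2) by (rule zw_in_polydisk[OF U])
  show "chart (chart_inv t) = t"
    unfolding chart_def hom(2) point_at_zw[OF U] unfolding hom(1) by (rule t_eq[symmetric])
qed

lemma chart_image: "chart ` chart_domain = Z \<inter> {t. projector (snd t) m' m' \<noteq> 0}"
proof (rule subset_antisym; rule subsetI)
  fix t assume "t \<in> chart ` chart_domain"
  then show "t \<in> Z \<inter> {t. projector (snd t) m' m' \<noteq> 0}"
    using chart_in_Z by (auto simp: chart_def projector_diag_eq_0[OF hom_coord_nonzero] quadric_chart_nth[OF comp])
next
  fix t assume "t \<in> Z \<inter> {t. projector (snd t) m' m' \<noteq> 0}"
  then show "t \<in> chart ` chart_domain"
    using chart_chart_inv[of t] by (intro image_eqI[of _ _ "chart_inv t"]) auto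
qed

lemma continuous_on_projector_snd: "continuous_on S (\<lambda>t :: 'x blowup_pt. projector (snd t) j k)"
  by (rule continuous_on_compose2[OF continuous_on_projector]) (auto intro!: continuous_intros)

lemma chart_homeomorphism: "homeomorphism chart_domain (chart ` chart_domain) chart chart_inv"
proof (rule homeomorphismI)
  show "continuous_on chart_domain chart"
    unfolding chart_def
    by (intro continuous_on_Pair continuous_on_compose2[OF continuous_on_point_at continuous_on_aff_coord]
        continuous_on_proj_pt_comp continuous_on_hom_coord hom_coord_nonzero) (auto simp: chart_domain_def)
  have zw: "continuous_on (chart ` chart_domain) (\<lambda>t. zw (fst t) $ m')"
    by (rule continuous_on_compose2[OF continuous_on_zw])
      (use Z_in_U in \<open>auto simp: chart_image intro!: continuous_intros\<close>)
  show "continuous_on (chart ` chart_domain) chart_inv"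
    unfolding chart_inv_def
    by (intro continuous_on_vector_3 continuous_on_divide continuous_on_diff continuous_on_const
        continuous_on_projector_snd zw) (auto simp: chart_image)
  show "chart_inv ` chart ` chart_domain \<subseteq> chart_domain"
    using chart_chart_inv by (auto simp: chart_image)
  show "chart_inv (chart u) = u" if "u \<in> chart_domain" for u
  proof -
    have "chart_inv (chart u) = vector [u $ 1, u $ 2, u $ 3]"
      using zw_chart[OF that] unfolding chart_inv_def
      by (simp add: quadric_chart_nth[OF comp] chart_def projector_ratio[OF hom_coord_nonzero])
    also have "\<dots> = u" by (simp add: vec_eq_iff forall_3)
    finally show ?thesis .
  qed
  show "chart (chart_inv t) = t" if "t \<in> chart ` chart_domain" for t
    using that chart_chart_inv by (simp add: chart_image)
qed simp

text \<open>As the \<open>m'\<close>-th homogeneous coordinate is constant, a tangent vector killed by the map to projective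
space kills all homogeneous coordinates, among them \<open>u\<^sub>1\<close> and \<open>u\<^sub>3\<close> up to a constant; and \<open>u\<^sub>2\<close> is the
\<open>m'\<close>-th entry of \<open>zw\<close>.\<close>

lemma chart_immersion: "holomorphic_immersion (zw \<circ> fst \<circ> chart) (snd \<circ> chart) chart_domain"
  unfolding holomorphic_immersion_def
proof (intro conjI ballI)
  note D = open_chart_domain
  show "holomorphic_map (zw \<circ> fst \<circ> chart) chart_domain"
    unfolding holomorphic_map_def
  proof
    fix j
    have "holomorphic_fun (\<lambda>u. u $ 2 * hom_coord u $ j) chart_domain"
      by (intro holomorphic_fun_mult holomorphic_fun_coord holomorphic_quadric_chart D)
    then show "holomorphic_fun (\<lambda>u. (zw \<circ> fst \<circ> chart) u $ j) chart_domain"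
      by (rule holomorphic_fun_cong) (simp add: zw_chart)
  qed
  fix x assume x: "x \<in> chart_domain"
  show "\<exists>W F. x \<in> W \<and> W \<subseteq> chart_domain \<and> holomorphic_map F W \<and>
        (\<forall>y\<in>W. F y \<noteq> 0 \<and> (snd \<circ> chart) y = proj_pt (F y)) \<and>
        (\<forall>v. (\<forall>i. frechet_derivative (\<lambda>y. (zw \<circ> fst \<circ> chart) y $ i) (at x) v = 0) \<and>
             (\<exists>c. \<forall>i. frechet_derivative (\<lambda>y. F y $ i) (at x) v = c * F x $ i) \<longrightarrow> v = 0)"
  proof (rule exI[of _ chart_domain], rule exI[of _ "quadric_chart m m' n c0"], intro conjI ballI allI impI)
    show "holomorphic_map (quadric_chart m m' n c0) chart_domain"
      by (simp add: holomorphic_map_def holomorphic_quadric_chart D)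
    fix v
    assume v: "(\<forall>i. frechet_derivative (\<lambda>y. (zw \<circ> fst \<circ> chart) y $ i) (at x) v = 0) \<and>
        (\<exists>c. \<forall>i. frechet_derivative (\<lambda>y. hom_coord y $ i) (at x) v = c * hom_coord x $ i)"
    then obtain c where c: "\<And>i. frechet_derivative (\<lambda>y. hom_coord y $ i) (at x) v = c * hom_coord x $ i"
      by blast
    have "frechet_derivative (\<lambda>y. hom_coord y $ m') (at x) = (\<lambda>v. 0)"
      by (rule frechet_derivative_eqI[OF has_derivative_const D x]) (simp add: quadric_chart_nth[OF comp])
    then have c0: "c = 0" using c[of m'] by (simp add: quadric_chart_nth[OF comp])
    have "frechet_derivative (\<lambda>y. hom_coord y $ n) (at x) = (\<lambda>v. v $ 1)"
      by (rule frechet_derivative_eqI[OF has_derivative_nth D x]) (simp add: quadric_chart_nth[OF comp])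
    then have v1: "v $ 1 = 0" using c[of n] c0 by simp
    have "((\<lambda>u. c0 + u $ 3) has_derivative (\<lambda>v. 0 + v $ 3)) (at x)"
      by (intro has_derivative_add has_derivative_const has_derivative_nth)
    then have "frechet_derivative (\<lambda>y. hom_coord y $ n') (at x) = (\<lambda>v. 0 + v $ 3)"
      by (rule frechet_derivative_eqI[OF _ D x]) (simp add: quadric_chart_nth[OF comp])
    then have v3: "v $ 3 = 0" using c[of n'] c0 by simp
    have "frechet_derivative (\<lambda>y. (zw \<circ> fst \<circ> chart) y $ m') (at x) = (\<lambda>v. v $ 2)"
      by (rule frechet_derivative_eqI[OF has_derivative_nth D x])
        (simp add: zw_chart quadric_chart_nth[OF comp])
    then have v2: "v $ 2 = 0" using conjunct1[OF v, THEN spec, of m'] by simp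
    show "v = 0" using v1 v2 v3 by (simp add: vec_eq_iff forall_3)
  qed (use x hom_coord_nonzero in \<open>auto simp: chart_def\<close>)
qed

lemma chart_components:
  assumes "u \<in> chart_domain"
  shows "chart u \<in> T i \<longleftrightarrow> u $ 1 = 0" "chart u \<in> T 5 \<longleftrightarrow> u $ 2 = 0"
proof -
  note Z = chart_in_Z[OF assms]
  then have Z': "(point_at (aff_coord u), proj_pt (hom_coord u)) \<in> Z" by (simp add: chart_def)
  show "chart u \<in> T i \<longleftrightarrow> u $ 1 = 0"
    using Z' by (auto simp: chart_def T_component_iff[OF comp hom_coord_nonzero] quadric_chart_nth[OF comp])
  have "chart u \<in> T 5 \<longleftrightarrow> zw (fst (chart u)) = 0"
    using Z zw_eq_0_iff[OF Z_in_U[OF Z]] by (simp add: T_5_iff)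
  also have "\<dots> \<longleftrightarrow> u $ 2 = 0" using hom_coord_nonzero by (simp add: zw_chart[OF assms])
  finally show "chart u \<in> T 5 \<longleftrightarrow> u $ 2 = 0" .
qed

lemma zero_in_chart_domain: "0 \<in> chart_domain"
  using r_pos by (simp add: chart_domain_def polydisk_def)

lemma chart_adapted: "adapted_chart i 5 (chart 0) chart_domain chart"
proof -
  have "open {t :: 'x blowup_pt. projector (snd t) m' m' \<noteq> 0}"
    by (intro open_Collect_neq continuous_on_projector_snd continuous_on_const)
  then have "openin (top_of_set Z) (chart ` chart_domain)"
    unfolding chart_image by (rule openin_open_Int)
  then show ?thesis
    unfolding adapted_chart_def
    using open_chart_domain zero_in_chart_domain chart_homeomorphism chart_immersion chart_components
    by blast
qed

text \<open>In this chart the entries are \<open>u\<^sub>2u\<^sub>1(c0 + u\<^sub>3)\<close> and \<open>u\<^sub>2\<close>, and the coefficient is constant.\<close>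

lemma chart_log_equation:
  assumes u: "u \<in> chart_domain"
  shows "1 * (zw (fst (chart u)) $ m * zw (fst (chart u)) $ m') =
     u $ 1 * u $ 2 * (partial 1 ((\<lambda>t. zw (fst t) $ m) \<circ> chart) u * partial 2 ((\<lambda>t. zw (fst t) $ m') \<circ> chart) u
                    - partial 2 ((\<lambda>t. zw (fst t) $ m) \<circ> chart) u * partial 1 ((\<lambda>t. zw (fst t) $ m') \<circ> chart) u)"
proof -
  have "((\<lambda>u. u $ 2 * (u $ 1 * (c0 + u $ 3))) has_derivative
      (\<lambda>v. u $ 2 * (u $ 1 * (0 + v $ 3) + v $ 1 * (c0 + u $ 3)) + v $ 2 * (u $ 1 * (c0 + u $ 3)))) (at u)"
    by (intro has_derivative_mult has_derivative_add has_derivative_const has_derivative_nth)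
  then have dm: "frechet_derivative ((\<lambda>t. zw (fst t) $ m) \<circ> chart) (at u) =
      (\<lambda>v. u $ 2 * (u $ 1 * (0 + v $ 3) + v $ 1 * (c0 + u $ 3)) + v $ 2 * (u $ 1 * (c0 + u $ 3)))"
    by (rule frechet_derivative_eqI[OF _ open_chart_domain u]) (simp add: zw_chart quadric_chart_nth[OF comp])
  have dm': "frechet_derivative ((\<lambda>t. zw (fst t) $ m') \<circ> chart) (at u) = (\<lambda>v. v $ 2)"
    by (rule frechet_derivative_eqI[OF has_derivative_nth open_chart_domain u])
      (simp add: zw_chart quadric_chart_nth[OF comp])
  show ?thesis
    unfolding partial_def dm dm' zw_chart[OF u]
    by (simp add: axis_nth quadric_chart_nth[OF comp])
qed

end

lemma log_coefficient_exists:
  assumes c: "component i m m' n n'"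
  shows "log_coefficient (\<lambda>t. zw (fst t) $ m) (\<lambda>t. zw (fst t) $ m') i 5 1"
  unfolding log_coefficient_def
proof
  fix t assume t: "t \<in> T_cap {i, 5} - (\<Union>l\<in>{1..5} - {i, 5}. T l)"
  obtain v where v: "v \<noteq> 0" "snd t = proj_pt v" by (rule proj_obtain)
  have t_eq: "t = (fst t, proj_pt v)" using v(2) by (simp add: prod_eq_iff)
  have vq: "fst t = (P, P)" "v $ m = 0" "v $ n = 0" "v $ m' \<noteq> 0" "v $ n' \<noteq> 0"
    using t generic_point_iff[OF c v(1), of "fst t"] t_eq by auto
  define c0 where "c0 = v $ n' / v $ m'"
  have "v = v $ m' *s quadric_chart m m' n c0 0"
    unfolding vec_eq_component_iff[OF c]
    using vq by (simp add: quadric_chart_nth[OF c] c0_def)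
  then have "proj_pt v = proj_pt (quadric_chart m m' n c0 0)"
    using proj_pt_smult[OF quadric_chart_nonzero[OF c] vq(4)] by metis
  moreover have "point_at 0 = (P, P)" using point_at_zw[of "(P, P)"] P_in_U by (simp add: zw_PP)
  ultimately have "chart m m' n c0 0 = t"
    using t_eq vq(1) by (simp add: chart_def[OF c])
  then have "adapted_chart i 5 t (chart_domain m m' n c0) (chart m m' n c0)"
    using chart_adapted[OF c, of c0] by simp
  then show "\<exists>D \<psi> C. adapted_chart i 5 t D \<psi> \<and> continuous_on D C \<and> C 0 = of_rat 1 \<and>
          (\<forall>u\<in>D. C u * (zw (fst (\<psi> u)) $ m * zw (fst (\<psi> u)) $ m') =
             u $ 1 * u $ 2 * (partial 1 ((\<lambda>t. zw (fst t) $ m) \<circ> \<psi>) u * partial 2 ((\<lambda>t. zw (fst t) $ m') \<circ> \<psi>) u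
                            - partial 2 ((\<lambda>t. zw (fst t) $ m) \<circ> \<psi>) u * partial 1 ((\<lambda>t. zw (fst t) $ m') \<circ> \<psi>) u))"
    using chart_log_equation[OF c, of _ c0]
    by (intro exI[of _ "chart_domain m m' n c0"] exI[of _ "chart m m' n c0"] exI[of _ "\<lambda>u. 1"] conjI ballI)
      auto
qed

lemma log_coefficient_iff:
  assumes "component i m m' n n'"
  shows "log_coefficient (\<lambda>t. zw (fst t) $ m) (\<lambda>t. zw (fst t) $ m') i 5 a \<longleftrightarrow> a = 1"
  using log_coefficient_exists[OF assms] log_coefficient_unique[OF assms] by blast

text \<open>The wedge product is alternating.\<close>

lemma log_coefficient_swap:
  assumes "log_coefficient g h j k a"
  shows "log_coefficient h g j k (- a)"
  unfolding log_coefficient_def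
proof
  fix q assume "q \<in> T_cap {j, k} - (\<Union>l\<in>{1..5} - {j, k}. T l)"
  then obtain D \<psi> C where *: "adapted_chart j k q D \<psi>" "continuous_on D C" "C 0 = of_rat a"
    "\<And>u. u \<in> D \<Longrightarrow> C u * (g (\<psi> u) * h (\<psi> u)) =
             u $ 1 * u $ 2 * (partial 1 (g \<circ> \<psi>) u * partial 2 (h \<circ> \<psi>) u
                            - partial 2 (g \<circ> \<psi>) u * partial 1 (h \<circ> \<psi>) u)"
    using assms unfolding log_coefficient_def by meson
  have "- C u * (h (\<psi> u) * g (\<psi> u)) =
      u $ 1 * u $ 2 * (partial 1 (h \<circ> \<psi>) u * partial 2 (g \<circ> \<psi>) u
                            - partial 2 (h \<circ> \<psi>) u * partial 1 (g \<circ> \<psi>) u)" if "u \<in> D" for u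
  proof -
    have "- C u * (h (\<psi> u) * g (\<psi> u)) = - (C u * (g (\<psi> u) * h (\<psi> u)))" by simp
    also have "\<dots> = - (u $ 1 * u $ 2 * (partial 1 (g \<circ> \<psi>) u * partial 2 (h \<circ> \<psi>) u
                            - partial 2 (g \<circ> \<psi>) u * partial 1 (h \<circ> \<psi>) u))"
      by (simp only: *(4)[OF that])
    finally show ?thesis by (simp add: algebra_simps)
  qed
  then show "\<exists>D \<psi> C. adapted_chart j k q D \<psi> \<and> continuous_on D C \<and> C 0 = of_rat (- a) \<and>
          (\<forall>u\<in>D. C u * (h (\<psi> u) * g (\<psi> u)) =
             u $ 1 * u $ 2 * (partial 1 (h \<circ> \<psi>) u * partial 2 (g \<circ> \<psi>) u
                            - partial 2 (h \<circ> \<psi>) u * partial 1 (g \<circ> \<psi>) u))"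
    using * by (intro exI[of _ D] exI[of _ \<psi>] exI[of _ "\<lambda>u. - C u"] conjI ballI)
      (auto simp: of_rat_minus intro: continuous_on_minus)
qed

lemma log_coefficient_swap_iff:
  assumes "component i m m' n n'"
  shows "log_coefficient (\<lambda>t. zw (fst t) $ m') (\<lambda>t. zw (fst t) $ m) i 5 a \<longleftrightarrow> a = - 1"
proof
  assume "log_coefficient (\<lambda>t. zw (fst t) $ m') (\<lambda>t. zw (fst t) $ m) i 5 a"
  then have "- a = 1" using log_coefficient_swap log_coefficient_iff[OF assms] by blast
  then show "a = - 1" by simp
qed (use log_coefficient_swap[OF log_coefficient_exists[OF assms]] in simp)

lemma pull_coeff_component:
  "component i 1 2 n n' \<Longrightarrow> pull_coeff1 {i, 5} = 1"
  "component i 2 1 n n' \<Longrightarrow> pull_coeff1 {i, 5} = - 1"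
  "component i 3 4 n n' \<Longrightarrow> pull_coeff2 {i, 5} = 1"
  "component i 4 3 n n' \<Longrightarrow> pull_coeff2 {i, 5} = - 1"
proof -
  have mm: "Min {i, 5} = i \<and> Max {i, 5} = 5" if "component i m m' n n'" for m m' n n'
    using component_coordinates(1)[OF that] by auto
  show "component i 1 2 n n' \<Longrightarrow> pull_coeff1 {i, 5} = 1"
    using log_coefficient_iff[of i 1 2 n n', unfolded zw_nth] mm by (simp add: pull_coeff1_def)
  show "component i 2 1 n n' \<Longrightarrow> pull_coeff1 {i, 5} = - 1"
    using log_coefficient_swap_iff[of i 2 1 n n', unfolded zw_nth] mm by (simp add: pull_coeff1_def)
  show "component i 3 4 n n' \<Longrightarrow> pull_coeff2 {i, 5} = 1"
    using log_coefficient_iff[of i 3 4 n n', unfolded zw_nth] mm by (simp add: pull_coeff2_def)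
  show "component i 4 3 n n' \<Longrightarrow> pull_coeff2 {i, 5} = - 1"
    using log_coefficient_swap_iff[of i 4 3 n n', unfolded zw_nth] mm by (simp add: pull_coeff2_def)
qed

lemma pull_coeff_values:
  "pull_coeff1 {1, 5} = 1" "pull_coeff1 {2, 5} = 1" "pull_coeff1 {3, 5} = - 1" "pull_coeff1 {4, 5} = - 1"
  "pull_coeff2 {1, 5} = 1" "pull_coeff2 {2, 5} = - 1" "pull_coeff2 {3, 5} = 1" "pull_coeff2 {4, 5} = - 1"
  by (rule pull_coeff_component[of _ 3 4] pull_coeff_component[of _ 4 3] pull_coeff_component[of _ 1 2]
      pull_coeff_component[of _ 2 1], simp add: component_def)+

end

section \<open>Gysin maps of points\<close>

lemma rat_group_simps [simp]:
  "carrier rat_group = UNIV" "x \<otimes>\<^bsub>rat_group\<^esub> y = x + y" "\<one>\<^bsub>rat_group\<^esub> = 0"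
  by (simp_all add: rat_group_def)

lemma group_rat_group: "group rat_group"
  by (rule groupI) (auto simp: intro: exI[of _ "- _"])

lemma group_H_2: "group (H_2 V)"
  by (simp add: H_2_def)

lemma H2_hom: "\<eta> \<in> H2 V \<Longrightarrow> group_hom (H_2 V) rat_group \<eta>"
  by (auto simp: H2_def group_hom_def group_hom_axioms_def group_H_2 group_rat_group)

lemma fundamental_class_generates:
  assumes "fundamental_class V m"
  shows "m \<in> carrier (H_2 V)" "carrier (H_2 V) = generate (H_2 V) {m}"
proof -
  show m: "m \<in> carrier (H_2 V)" using assms by (simp add: fundamental_class_def)
  have "subgroup_generated (H_2 V) {m} = H_2 V" using assms by (simp add: fundamental_class_def)
  from arg_cong[OF this, of carrier] m show "carrier (H_2 V) = generate (H_2 V) {m}"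
    by (simp add: carrier_subgroup_generated)
qed

text \<open>A class in \<open>H\<^sup>2\<close> of a curve is determined by its degree, because the fundamental class generates \<open>H\<^sub>2\<close>.\<close>

lemma H2_eqI:
  assumes m: "fundamental_class V m" and \<eta>: "\<eta> \<in> H2 V" "\<theta> \<in> H2 V" and eq: "\<eta> m = \<theta> m"
  shows "\<eta> = \<theta>"
proof
  fix c
  interpret h: group_hom "H_2 V" rat_group \<eta> by (rule H2_hom[OF \<eta>(1)])
  interpret k: group_hom "H_2 V" rat_group \<theta> by (rule H2_hom[OF \<eta>(2)])
  show "\<eta> c = \<theta> c"
  proof (cases "c \<in> carrier (H_2 V)")
    case True
    note mc = fundamental_class_generates(1)[OF m]
    have "c \<in> generate (H_2 V) {m}" using True fundamental_class_generates(2)[OF m] by simp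
    then obtain k :: int where "c = m [^]\<^bsub>H_2 V\<^esub> k"
      using group.generate_pow[OF group_H_2 mc] by blast
    then show ?thesis
      using h.hom_int_pow[OF mc, of k] k.hom_int_pow[OF mc, of k] eq by simp
  next
    case False
    then show ?thesis using \<eta> by (simp add: H2_def)
  qed
qed

lemma zero_in_H2: "(\<lambda>c. 0) \<in> H2 V"
  by (simp add: H2_def hom_def)

text \<open>The zero class has degree zero on every \<open>V\<close>, compact or not. This disposes of all empty triple strata.\<close>

lemma gysin_point_zero:
  assumes m: "fundamental_class V m" and "(\<Sum>q\<in>E. x q) = 0"
  shows "gysin_point m V E x = (\<lambda>c. 0)"
  unfolding gysin_point_def assms(2)
proof (rule the_equality)
  show "(\<lambda>c. 0) \<in> H2 V \<and> (\<not> trivial_group (H_2 V) \<longrightarrow> (0::rat) = 0)" by (simp add: zero_in_H2)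
next
  fix \<eta> assume \<eta>: "\<eta> \<in> H2 V \<and> (\<not> trivial_group (H_2 V) \<longrightarrow> \<eta> m = 0)"
  have "\<eta> m = 0"
  proof (cases "trivial_group (H_2 V)")
    case True
    interpret h: group_hom "H_2 V" rat_group \<eta> using H2_hom \<eta> by blast
    have "m = \<one>\<^bsub>H_2 V\<^esub>"
      using True m by (auto simp: fundamental_class_def trivial_group_def)
    then show ?thesis using h.hom_one by simp
  qed (use \<eta> in blast)
  then show "\<eta> = (\<lambda>c. 0)" using H2_eqI[OF m _ zero_in_H2] \<eta> by blast
qed

text \<open>A class of prescribed degree exists because the generator \<open>m\<close> of an infinite cyclic group has infinite
order.\<close>

lemma gysin_point_degree:
  assumes m: "fundamental_class V m" and iso: "H_2 V \<cong> integer_group"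
  shows "gysin_point m V E x m = (\<Sum>q\<in>E. x q)"
proof -
  let ?s = "\<Sum>q\<in>E. x q"
  obtain \<phi> where \<phi>: "\<phi> \<in> iso (H_2 V) integer_group" using iso by (auto simp: is_iso_def)
  interpret p: group_hom "H_2 V" integer_group \<phi>
    using \<phi> by (auto simp: iso_def group_hom_def group_hom_axioms_def group_H_2)
  have mc: "m \<in> carrier (H_2 V)" using m by (simp add: fundamental_class_def)
  have bij: "bij_betw \<phi> (carrier (H_2 V)) UNIV" using \<phi> by (simp add: iso_def)
  have nontriv: "\<not> trivial_group (H_2 V)"
  proof
    assume "trivial_group (H_2 V)"
    then have "carrier (H_2 V) = {\<one>\<^bsub>H_2 V\<^esub>}" by (simp add: trivial_group_def)
    then have "finite (carrier (H_2 V))" by simp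
    then show False using bij_betw_finite[OF bij] by simp
  qed
  have "\<phi> m \<noteq> 0"
  proof
    assume 0: "\<phi> m = 0"
    have "\<phi> \<one>\<^bsub>H_2 V\<^esub> = 0" using p.hom_one by simp
    with 0 have "\<phi> m = \<phi> \<one>\<^bsub>H_2 V\<^esub>" by simp
    then have one: "m = \<one>\<^bsub>H_2 V\<^esub>"
      by (rule inj_onD[OF bij_betw_imp_inj_on[OF bij] _ mc p.G.one_closed])
    have "carrier (H_2 V) = generate (H_2 V) {m}"
      by (rule fundamental_class_generates(2)[OF m])
    also have "\<dots> = {\<one>\<^bsub>H_2 V\<^esub>}" unfolding one by (rule p.G.generate_one)
    finally show False using nontriv by (simp add: trivial_group_def group_H_2)
  qed
  define \<eta> where "\<eta> c = (if c \<in> carrier (H_2 V) then of_int (\<phi> c) / of_int (\<phi> m) * ?s else 0)" for c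
  have \<eta>: "\<eta> \<in> H2 V"
    unfolding H2_def
  proof (intro CollectI conjI homI allI impI)
    fix a b assume ab: "a \<in> carrier (H_2 V)" "b \<in> carrier (H_2 V)"
    then have "\<phi> (a \<otimes>\<^bsub>H_2 V\<^esub> b) = \<phi> a + \<phi> b" using p.hom_mult by simp
    then show "\<eta> (a \<otimes>\<^bsub>H_2 V\<^esub> b) = \<eta> a \<otimes>\<^bsub>rat_group\<^esub> \<eta> b"
      using ab p.G.m_closed[OF ab] by (simp add: \<eta>_def add_divide_distrib distrib_right)
  qed (simp_all add: \<eta>_def)
  have \<eta>m: "\<eta> m = ?s" using mc \<open>\<phi> m \<noteq> 0\<close> by (simp add: \<eta>_def)
  have "gysin_point m V E x = \<eta>"
    unfolding gysin_point_def
  proof (rule the_equality)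
    show "\<theta> = \<eta>" if "\<theta> \<in> H2 V \<and> (\<not> trivial_group (H_2 V) \<longrightarrow> \<theta> m = ?s)" for \<theta>
      using H2_eqI[OF m, of \<theta> \<eta>] that \<eta> \<eta>m nontriv by simp
  qed (use \<eta> \<eta>m in simp)
  then show ?thesis by (simp add: \<eta>m)
qed

section \<open>The projective line is a sphere\<close>

text \<open>A projective line inside projective space, paired with the fixed point \<open>a\<close>, since the strata lie in a
product.\<close>

definition coordinate_line :: "'a \<Rightarrow> 'n::finite \<Rightarrow> 'n \<Rightarrow> ('a \<times> 'n proj) set" where
  "coordinate_line a m n = {(b, proj_pt v) |b v. b = a \<and> v \<noteq> 0 \<and> (\<forall>j. j \<noteq> m \<longrightarrow> j \<noteq> n \<longrightarrow> v $ j = 0)}"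

text \<open>The Hopf map to the unit sphere: the Pauli coordinates of the projector onto a line in \<open>\<complex>\<^sup>2\<close>. The values
at indices above \<open>2\<close> are those required by \<open>nsphere\<close>.\<close>

definition hopf :: "'n::finite \<Rightarrow> 'n \<Rightarrow> 'a \<times> 'n proj \<Rightarrow> nat \<Rightarrow> real" where
  "hopf m n t k = (if k = 0 then 2 * Re (projector (snd t) m n)
     else if k = 1 then 2 * Im (projector (snd t) m n)
     else if k = 2 then Re (projector (snd t) m m) - Re (projector (snd t) n n) else 0)"

lemma norm_on_line:
  fixes v :: "complex^'n"
  assumes "m \<noteq> n" "\<forall>j. j \<noteq> m \<longrightarrow> j \<noteq> n \<longrightarrow> v $ j = 0"
  shows "(norm v)\<^sup>2 = (cmod (v $ m))\<^sup>2 + (cmod (v $ n))\<^sup>2"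
proof -
  have "(norm v)\<^sup>2 = (\<Sum>j\<in>UNIV. (cmod (v $ j))\<^sup>2)"
    by (simp add: norm_vec_def L2_set_def sum_nonneg)
  also have "\<dots> = (\<Sum>j\<in>{m, n}. (cmod (v $ j))\<^sup>2)"
    by (rule sum.mono_neutral_right) (use assms(2) in auto)
  finally show ?thesis using assms(1) by simp
qed

lemma hopf_values:
  fixes v :: "complex^'n"
  assumes "m \<noteq> n" "v \<noteq> 0" "\<forall>j. j \<noteq> m \<longrightarrow> j \<noteq> n \<longrightarrow> v $ j = 0"
  defines "\<nu> \<equiv> (cmod (v $ m))\<^sup>2 + (cmod (v $ n))\<^sup>2"
  shows "\<nu> > 0"
    "hopf m n (a, proj_pt v) 0 = 2 * Re (v $ m * cnj (v $ n)) / \<nu>"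
    "hopf m n (a, proj_pt v) 1 = 2 * Im (v $ m * cnj (v $ n)) / \<nu>"
    "hopf m n (a, proj_pt v) 2 = ((cmod (v $ m))\<^sup>2 - (cmod (v $ n))\<^sup>2) / \<nu>"
    "k > 2 \<Longrightarrow> hopf m n (a, proj_pt v) k = 0"
proof -
  have \<nu>: "(norm v)\<^sup>2 = \<nu>" unfolding \<nu>_def using norm_on_line assms(1,3) by blast
  show "\<nu> > 0" unfolding \<nu>[symmetric] using assms(2) by simp
  have "v $ j * cnj (v $ j) = of_real ((cmod (v $ j))\<^sup>2)" for j by (rule complex_norm_square[symmetric])
  then have diag: "Re (projector (proj_pt v) j j) = (cmod (v $ j))\<^sup>2 / \<nu>" for j
    by (simp only: projector_proj_pt[OF assms(2)] \<nu> Re_divide_of_real Re_complex_of_real)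
  have off: "projector (proj_pt v) m n = (v $ m * cnj (v $ n)) / of_real \<nu>"
    by (simp only: projector_proj_pt[OF assms(2)] \<nu>)
  show "hopf m n (a, proj_pt v) 0 = 2 * Re (v $ m * cnj (v $ n)) / \<nu>"
    "hopf m n (a, proj_pt v) 1 = 2 * Im (v $ m * cnj (v $ n)) / \<nu>"
    unfolding hopf_def snd_conv off by (simp_all only: Re_divide_of_real Im_divide_of_real) simp_all
  show "hopf m n (a, proj_pt v) 2 = ((cmod (v $ m))\<^sup>2 - (cmod (v $ n))\<^sup>2) / \<nu>"
    unfolding hopf_def snd_conv diag by (simp add: diff_divide_distrib)
  show "hopf m n (a, proj_pt v) k = 0" if "k > 2" using that by (simp add: hopf_def)
qed

lemma topspace_nsphere_2:
  "x \<in> topspace (nsphere 2) \<longleftrightarrow> (x 0)\<^sup>2 + (x 1)\<^sup>2 + (x 2)\<^sup>2 = 1 \<and> (\<forall>k>2. x k = 0)"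
  by (simp add: nsphere numeral_2_eq_2)

lemma hopf_in_sphere:
  assumes "m \<noteq> n" "t \<in> coordinate_line a m n"
  shows "hopf m n t \<in> topspace (nsphere 2)"
proof -
  obtain v where v: "t = (a, proj_pt v)" "v \<noteq> 0" "\<forall>j. j \<noteq> m \<longrightarrow> j \<noteq> n \<longrightarrow> v $ j = 0"
    using assms(2) by (auto simp: coordinate_line_def)
  define w A B \<nu> where "w = v $ m * cnj (v $ n)" and "A = (cmod (v $ m))\<^sup>2" and "B = (cmod (v $ n))\<^sup>2"
    and "\<nu> = A + B"
  note h = hopf_values[OF assms(1) v(2,3), folded w_def A_def B_def, folded \<nu>_def]
  have w: "(Re w)\<^sup>2 + (Im w)\<^sup>2 = A * B"
    unfolding cmod_power2[symmetric] by (simp add: w_def A_def B_def norm_mult power_mult_distrib)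
  have "(2 * Re w / \<nu>)\<^sup>2 + (2 * Im w / \<nu>)\<^sup>2 + ((A - B) / \<nu>)\<^sup>2
      = (4 * ((Re w)\<^sup>2 + (Im w)\<^sup>2) + (A - B)\<^sup>2) / \<nu>\<^sup>2"
    by (simp add: power_divide power_mult_distrib add_divide_distrib)
  also have "4 * ((Re w)\<^sup>2 + (Im w)\<^sup>2) + (A - B)\<^sup>2 = \<nu>\<^sup>2"
    unfolding w \<nu>_def by (simp add: power2_eq_square algebra_simps)
  also have "\<nu>\<^sup>2 / \<nu>\<^sup>2 = 1" using h(1) by simp
  finally show ?thesis
    unfolding topspace_nsphere_2 v(1) h(2-4) by (simp add: h(5))
qed

text \<open>Since the trace of the projector is \<open>1\<close>, the sphere coordinates determine all its entries, and any
nonzero column of the projector spans the line.\<close>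

lemma hopf_inj:
  fixes a :: 'a and m n :: "'n::finite"
  assumes mn: "m \<noteq> n"
  shows "inj_on (hopf m n) (coordinate_line a m n)"
proof (rule inj_onI)
  fix s t :: "'a \<times> 'n proj"
  assume s: "s \<in> coordinate_line a m n" and t: "t \<in> coordinate_line a m n" and eq: "hopf m n s = hopf m n t"
  obtain v where v: "s = (a, proj_pt v)" "v \<noteq> 0" "\<forall>j. j \<noteq> m \<longrightarrow> j \<noteq> n \<longrightarrow> v $ j = 0"
    using s by (auto simp: coordinate_line_def)
  obtain w where w: "t = (a, proj_pt w)" "w \<noteq> 0" "\<forall>j. j \<noteq> m \<longrightarrow> j \<noteq> n \<longrightarrow> w $ j = 0"
    using t by (auto simp: coordinate_line_def)
  define A B \<nu> where "A = (cmod (v $ m))\<^sup>2" "B = (cmod (v $ n))\<^sup>2" "\<nu> = A + B"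
  define A' B' \<nu>' where "A' = (cmod (w $ m))\<^sup>2" "B' = (cmod (w $ n))\<^sup>2" "\<nu>' = A' + B'"
  note hv = hopf_values[OF mn v(2,3), folded A_B_\<nu>_def(1,2), folded A_B_\<nu>_def(3)]
  note hw = hopf_values[OF mn w(2,3), folded A'_B'_\<nu>'_def(1,2), folded A'_B'_\<nu>'_def(3)]
  have eqk: "hopf m n (a, proj_pt v) k = hopf m n (a, proj_pt w) k" for k
    using eq v(1) w(1) by simp
  have "(A - B) / \<nu> = (A' - B') / \<nu>'" using eqk[of 2] unfolding hv(4) hw(4) .
  moreover have "(A + B) / \<nu> = 1" "(A' + B') / \<nu>' = 1"
    using hv(1) hw(1) by (simp_all add: A_B_\<nu>_def(3) A'_B'_\<nu>'_def(3))
  ultimately have AB: "A / \<nu> = A' / \<nu>'" "B / \<nu> = B' / \<nu>'"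
    by (simp_all add: add_divide_distrib diff_divide_distrib)
  have half: "b / c = d / e" if "2 * b / c = 2 * d / e" for b c d e :: real
  proof -
    have "b / c = (2 * b / c) / 2" by simp
    also have "\<dots> = d / e" unfolding that by simp
    finally show ?thesis .
  qed
  have w0: "v $ m * cnj (v $ n) / of_real \<nu> = w $ m * cnj (w $ n) / of_real \<nu>'"
  proof (rule complex_eqI)
    show "Re (v $ m * cnj (v $ n) / of_real \<nu>) = Re (w $ m * cnj (w $ n) / of_real \<nu>')"
      using eqk[of 0] unfolding hv(2) hw(2) Re_divide_of_real by (rule half)
    show "Im (v $ m * cnj (v $ n) / of_real \<nu>) = Im (w $ m * cnj (w $ n) / of_real \<nu>')"
      using eqk[of 1] unfolding hv(3) hw(3) Im_divide_of_real by (rule half)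
  qed
  have sq: "x * cnj x = of_real ((cmod x)\<^sup>2)" for x by (rule complex_norm_square[symmetric])
  have AB': "v $ m * cnj (v $ m) / of_real \<nu> = w $ m * cnj (w $ m) / of_real \<nu>'"
    "v $ n * cnj (v $ n) / of_real \<nu> = w $ n * cnj (w $ n) / of_real \<nu>'"
    unfolding sq using AB by (simp_all only: A_B_\<nu>_def(1,2) A'_B'_\<nu>'_def(1,2) flip: of_real_divide)
  have cnj_eq: "cnj (v $ m * cnj (v $ n) / of_real \<nu>) = cnj (w $ m * cnj (w $ n) / of_real \<nu>')"
    unfolding w0 ..
  have w1: "v $ n * cnj (v $ m) / of_real \<nu> = w $ n * cnj (w $ m) / of_real \<nu>'"
    using cnj_eq by (simp only: complex_cnj_divide complex_cnj_mult complex_cnj_cnj complex_cnj_complex_of_real mult.commute)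
  have all: "v $ i * cnj (v $ j) / of_real \<nu> = w $ i * cnj (w $ j) / of_real \<nu>'"
    if "j = m \<or> j = n" for i j
    using that w0 w1 AB' v(3)[rule_format, of i] w(3)[rule_format, of i]
    by (cases "i = m"; cases "i = n") auto
  obtain j where j: "v $ j \<noteq> 0" "j = m \<or> j = n" using v(2,3) by (auto simp: vec_eq_iff)
  define c where "c = (cnj (v $ j) / of_real \<nu>)"
  define d where "d = (cnj (w $ j) / of_real \<nu>')"
  have "c \<noteq> 0" using j(1) hv(1) by (simp add: c_def)
  have cd: "v $ i * c = w $ i * d" for i using all[OF j(2), of i] by (simp add: c_def d_def)
  have "d \<noteq> 0" using cd[of j] j(1) \<open>c \<noteq> 0\<close> by auto
  have "w = (c / d) *s v"
    using cd \<open>d \<noteq> 0\<close> by (simp add: vec_eq_iff field_simps)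
  then have "proj_pt v = proj_pt w"
    using proj_pt_eq_iff[OF v(2) w(2)] \<open>c \<noteq> 0\<close> \<open>d \<noteq> 0\<close> by (metis divide_eq_0_iff)
  then show "s = t" using v w by simp
qed

lemma hopf_surj:
  fixes a :: 'a and m n :: "'n::finite"
  assumes mn: "m \<noteq> n" and x: "x \<in> topspace (nsphere 2)"
  shows "x \<in> hopf m n ` coordinate_line a m n"
proof -
  have sphere: "(x 0)\<^sup>2 + (x 1)\<^sup>2 + (x 2)\<^sup>2 = 1" and tail: "\<And>k. k > 2 \<Longrightarrow> x k = 0"
    using x by (auto simp: topspace_nsphere_2)
  (* inverse stereographic projection; the pole x 2 = -1 is the line spanned by the n-th axis *)
  define \<alpha> \<beta> where "\<alpha> = (if x 2 = -1 then 0 else complex_of_real (1 + x 2))"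
    and "\<beta> = (if x 2 = -1 then 1 else Complex (x 0) (- x 1))"
  define v :: "complex^'n" where "v = (\<chi> j. if j = m then \<alpha> else if j = n then \<beta> else 0)"
  have v: "v $ m = \<alpha>" "v $ n = \<beta>" "\<forall>j. j \<noteq> m \<longrightarrow> j \<noteq> n \<longrightarrow> v $ j = 0"
    using mn by (simp_all add: v_def)
  have "\<alpha> \<noteq> 0 \<or> \<beta> \<noteq> 0"
    by (simp add: \<alpha>_def \<beta>_def) (metis add.commute add_eq_0_iff of_real_1 of_real_add of_real_eq_0_iff)
  then have v0: "v \<noteq> 0" using v(1,2) by auto
  note h = hopf_values[OF mn v0 v(3), unfolded v(1,2)]
  have "hopf m n (a, proj_pt v) k = x k" for k
  proof (cases "x 2 = -1")
    case True
    then have "(x 0)\<^sup>2 + (x 1)\<^sup>2 = 0" using sphere by simp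
    then have "x 0 = 0" "x 1 = 0" by (simp_all add: sum_power2_eq_zero_iff)
    moreover have "k = 0 \<or> k = 1 \<or> k = 2 \<or> k > 2" by linarith
    ultimately show ?thesis using True tail[of k] by (auto simp: h(2-5) h(3)[unfolded One_nat_def] \<alpha>_def \<beta>_def)
  next
    case False
    define y where "y = 1 + x 2"
    have y: "y \<noteq> 0" using False by (simp add: y_def)
    have \<alpha>\<beta>: "\<alpha> = of_real y" "\<beta> = Complex (x 0) (- x 1)" using False by (simp_all add: \<alpha>_def \<beta>_def y_def)
    have A: "(cmod \<alpha>)\<^sup>2 = y\<^sup>2" "(cmod \<beta>)\<^sup>2 = (x 0)\<^sup>2 + (x 1)\<^sup>2"
      by (simp_all add: \<alpha>\<beta> cmod_power2)
    have \<nu>: "y\<^sup>2 + ((x 0)\<^sup>2 + (x 1)\<^sup>2) = 2 * y"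
      using sphere by (simp add: y_def power2_eq_square algebra_simps)
    have \<delta>: "y\<^sup>2 - ((x 0)\<^sup>2 + (x 1)\<^sup>2) = 2 * y * x 2"
      using sphere by (simp add: y_def power2_eq_square algebra_simps)
    have prod: "Re (\<alpha> * cnj \<beta>) = y * x 0" "Im (\<alpha> * cnj \<beta>) = y * x 1"
      by (simp_all add: \<alpha>\<beta>)
    have "k = 0 \<or> k = 1 \<or> k = 2 \<or> k > 2" by linarith
    then show ?thesis
      using y tail[of k]
      by (auto simp: h(2-5)[unfolded A \<nu> \<delta> prod] h(3)[unfolded A \<nu> \<delta> prod, unfolded One_nat_def])
  qed
  then have "hopf m n (a, proj_pt v) = x" by blast
  moreover have "(a, proj_pt v) \<in> coordinate_line a m n" using v0 v(3) by (auto simp: coordinate_line_def)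
  ultimately show ?thesis by blast
qed

lemma compact_coordinate_line:
  fixes a :: "'a::topological_space" and m n :: "'n::finite"
  shows "compact (coordinate_line a m n)"
proof -
  let ?S = "sphere 0 1 \<inter> {v :: complex^'n. \<forall>j. j \<noteq> m \<longrightarrow> j \<noteq> n \<longrightarrow> v $ j = 0}"
  have "closed {v :: complex^'n. \<forall>j. j \<noteq> m \<longrightarrow> j \<noteq> n \<longrightarrow> v $ j = 0}"
    by (intro closed_Collect_all closed_Collect_imp closed_Collect_eq continuous_intros) auto
  then have "compact ?S" by (intro compact_Int_closed compact_sphere)
  moreover have "continuous_on ?S (\<lambda>v. (a, proj_pt v))"
    by (intro continuous_on_Pair continuous_on_const continuous_on_proj_pt_comp continuous_on_id) auto
  ultimately have "compact ((\<lambda>v. (a, proj_pt v)) ` ?S)" by (rule compact_continuous_image[rotated])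
  also have "(\<lambda>v. (a, proj_pt v)) ` ?S = coordinate_line a m n"
  proof (rule subset_antisym; rule subsetI)
    fix t assume "t \<in> coordinate_line a m n"
    then obtain v where v: "t = (a, proj_pt v)" "v \<noteq> 0" "\<forall>j. j \<noteq> m \<longrightarrow> j \<noteq> n \<longrightarrow> v $ j = 0"
      by (auto simp: coordinate_line_def)
    let ?w = "of_real (1 / norm v) *s v"
    have "norm ?w = 1" using v(2) unfolding norm_vector_scalar by (simp add: norm_divide)
    then have "?w \<in> ?S" using v(3) by simp
    moreover have "t = (a, proj_pt ?w)" using v(1,2) by (simp add: proj_pt_smult)
    ultimately show "t \<in> (\<lambda>v. (a, proj_pt v)) ` ?S" by blast
  next
    fix t assume "t \<in> (\<lambda>v. (a, proj_pt v)) ` ?S"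
    then obtain v where "t = (a, proj_pt v)" "v \<in> ?S" by blast
    moreover then have "v \<noteq> 0" by auto
    ultimately show "t \<in> coordinate_line a m n" by (auto simp: coordinate_line_def)
  qed
  finally show ?thesis .
qed

text \<open>A continuous bijection from a compact space to a Hausdorff space is a homeomorphism.\<close>

lemma coordinate_line_sphere:
  fixes a :: "'a::topological_space" and m n :: "'n::finite"
  assumes mn: "m \<noteq> n"
  shows "top_of_set (coordinate_line a m n) homeomorphic_space nsphere 2"
proof -
  let ?L = "coordinate_line a m n"
  have proj: "continuous_on ?L (\<lambda>t. projector (snd t) i j)" for i j
    by (rule continuous_on_compose2[OF continuous_on_projector]) (auto intro!: continuous_intros)
  have "continuous_on ?L (\<lambda>t. hopf m n t k)" for k
    unfolding hopf_def
    by (cases "k = 0"; cases "k = 1"; cases "k = 2") (auto intro!: continuous_intros proj)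
  then have "continuous_map (top_of_set ?L) (powertop_real UNIV) (hopf m n)"
    by (simp add: continuous_map_componentwise_UNIV)
  then have cont: "continuous_map (top_of_set ?L) (nsphere 2) (hopf m n)"
    using hopf_in_sphere[OF mn, of _ a] unfolding nsphere
    by (auto simp: continuous_map_in_subtopology)
  have "compact_space (top_of_set ?L)"
    by (intro compact_space_subtopology) (simp add: compact_coordinate_line)
  moreover have "Hausdorff_space (nsphere 2)"
    unfolding nsphere_def by (intro Hausdorff_space_subtopology Hausdorff_Euclidean_space)
  moreover have "hopf m n ` topspace (top_of_set ?L) = topspace (nsphere 2)"
    using hopf_in_sphere[OF mn, of _ a] hopf_surj[OF mn, of _ a] by auto
  moreover have "inj_on (hopf m n) (topspace (top_of_set ?L))" using hopf_inj[OF mn] by simp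
  ultimately have "homeomorphic_map (top_of_set ?L) (nsphere 2) (hopf m n)"
    using cont by (intro continuous_imp_homeomorphic_map)
  then show ?thesis by (rule homeomorphic_map_imp_homeomorphic_space)
qed

lemma H_2_coordinate_line:
  fixes a :: "'a::topological_space" and m n :: "'n::finite"
  assumes mn: "m \<noteq> n"
  shows "H_2 (coordinate_line a m n) \<cong> integer_group"
proof -
  have "H_2 (coordinate_line a m n) \<cong> homology_group 2 (nsphere 2)"
    unfolding H_2_def
    by (rule homeomorphic_space_imp_isomorphic_homology_groups[OF coordinate_line_sphere[OF mn]])
  moreover have "homology_group 2 (nsphere 2) \<cong> integer_group"
    using reduced_homology_group_nsphere(1)[of 2] by (simp add: un_reduced_homology_group)
  ultimately show ?thesis by (rule iso_trans)
qed

section \<open>Index sets and signs\<close>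

lemma subset_12345: "I \<subseteq> {1..5} \<Longrightarrow> I \<in> Pow {1, 2, 3, 4, 5 :: nat}"
  by auto

lemma strata_2: "strata 2 =
    {{1, 2}, {1, 3}, {1, 4}, {1, 5}, {2, 3}, {2, 4}, {2, 5}, {3, 4}, {3, 5}, {4, 5}}" (is "_ = ?S")
proof (rule subset_antisym; rule subsetI)
  fix I assume "I \<in> strata 2"
  then have "card I = 2" "I \<in> Pow {1, 2, 3, 4, 5}" using subset_12345 by (auto simp: strata_def)
  then show "I \<in> ?S"
    by (simp only: Pow_insert Pow_empty image_insert image_empty Un_insert_left Un_empty_left insert_iff empty_iff)
      (elim disjE; simp del: One_nat_def)
qed (auto simp: strata_def simp del: One_nat_def)

lemma strata_3: "strata 3 =
    {{1, 2, 3}, {1, 2, 4}, {1, 2, 5}, {1, 3, 4}, {1, 3, 5}, {1, 4, 5}, {2, 3, 4}, {2, 3, 5}, {2, 4, 5}, {3, 4, 5}}"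
    (is "_ = ?S")
proof (rule subset_antisym; rule subsetI)
  fix I assume "I \<in> strata 3"
  then have "card I = 3" "I \<in> Pow {1, 2, 3, 4, 5}" using subset_12345 by (auto simp: strata_def)
  then show "I \<in> ?S"
    by (simp only: Pow_insert Pow_empty image_insert image_empty Un_insert_left Un_empty_left insert_iff empty_iff)
      (elim disjE; simp del: One_nat_def)
qed (auto simp: strata_def simp del: One_nat_def)

lemma strata_4: "strata 4 =
    {{1, 2, 3, 4}, {1, 2, 3, 5}, {1, 2, 4, 5}, {1, 3, 4, 5}, {2, 3, 4, 5}}"
    (is "_ = ?S")
proof (rule subset_antisym; rule subsetI)
  fix I assume "I \<in> strata 4"
  then have "card I = 4" "I \<in> Pow {1, 2, 3, 4, 5}" using subset_12345 by (auto simp: strata_def)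
  then show "I \<in> ?S"
    by (simp only: Pow_insert Pow_empty image_insert image_empty Un_insert_left Un_empty_left insert_iff empty_iff)
      (elim disjE; simp del: One_nat_def)
qed (auto simp: strata_def simp del: One_nat_def)

definition nonempty_triples :: "nat set set" where
  "nonempty_triples = {{1, 2, 5}, {1, 3, 5}, {2, 4, 5}, {3, 4, 5}}"

text \<open>Literal finite sets are told apart by their sorted lists.\<close>

lemma triples_distinct:
  "{1, 2, 5} \<noteq> {1, 3, 5 :: nat}" "{1, 2, 5} \<noteq> {2, 4, 5 :: nat}" "{1, 2, 5} \<noteq> {3, 4, 5 :: nat}"
  "{1, 3, 5} \<noteq> {2, 4, 5 :: nat}" "{1, 3, 5} \<noteq> {3, 4, 5 :: nat}" "{2, 4, 5} \<noteq> {3, 4, 5 :: nat}"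
  by (rule notI, drule arg_cong[of _ _ srt], simp)+

lemma sum_of_indicators:
  fixes a :: "'i \<Rightarrow> rat"
  assumes "A \<noteq> B" "A \<noteq> C" "A \<noteq> D" "B \<noteq> C" "B \<noteq> D" "C \<noteq> D"
  shows "(if I \<in> {A, B, C, D} \<and> t \<in> S I then a I else 0) =
    a A * (if I = A \<and> t \<in> S A then 1 else 0) + a B * (if I = B \<and> t \<in> S B then 1 else 0)
    + a C * (if I = C \<and> t \<in> S C then 1 else 0) + a D * (if I = D \<and> t \<in> S D then 1 else 0)"
  using assms by auto

lemma position_eq:
  assumes "b < card I" "srt I ! b = j"
  shows "position I j = b"
proof -
  have "distinct (srt I)" "length (srt I) = card I" by simp_all
  then show ?thesis
    unfolding position_def using assms
    by (intro the_equality) (auto simp: nth_eq_iff_index_eq)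
qed

text \<open>Since \<open>5\<close> is the last index of \<open>I\<close>, admissibility with \<open>p = 1\<close> forces \<open>J = {j, 5}\<close> with \<open>j\<close> one of the
other two indices.\<close>

lemma admissible_triples:
  "{(I, J). I \<in> nonempty_triples \<and> J \<in> strata 2 \<and> admissible I J 1} =
    {({1, 2, 5}, {1, 5}), ({1, 2, 5}, {2, 5}), ({1, 3, 5}, {1, 5}), ({1, 3, 5}, {3, 5}),
     ({2, 4, 5}, {2, 5}), ({2, 4, 5}, {4, 5}), ({3, 4, 5}, {3, 5}), ({3, 4, 5}, {4, 5})}" (is "?L = ?R")
proof (rule subset_antisym; rule subsetI)
  fix p assume "p \<in> ?L"
  then obtain I J where p: "p = (I, J)" "I \<in> nonempty_triples" "J \<in> strata 2" "admissible I J 1" by blast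
  then show "p \<in> ?R"
    unfolding nonempty_triples_def strata_2 insert_iff empty_iff
    by (elim disjE FalseE; simp add: admissible_def)
next
  fix p assume "p \<in> ?R"
  then show "p \<in> ?L"
    unfolding nonempty_triples_def strata_2 insert_iff empty_iff
    by (elim disjE FalseE; simp add: admissible_def)
qed

lemma sign_and_target:
  assumes "i < k" "k < 5"
  shows "(-1 :: rat) ^ sign_exponent {i, k, 5} {i, 5} 1 = 1"
    "(-1 :: rat) ^ sign_exponent {i, k, 5} {k, 5} 1 = -1"
    "target_index {i, k, 5} {i, 5} 1 = {k, 5}"
    "target_index {i, k, 5} {k, 5} 1 = {i, 5}"
proof -
  have srt: "srt {i, k, 5} = [i, k, 5]" "srt {i, 5} = [i, 5]" "srt {k, 5} = [k, 5]"
    using assms by simp_all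
  have card: "card {i, k, 5} = 3" using assms by simp
  have pos: "position {i, k, 5} i = 0" "position {i, k, 5} k = 1"
    by (rule position_eq; simp add: srt card)+
  show "(-1 :: rat) ^ sign_exponent {i, k, 5} {i, 5} 1 = 1"
    "(-1 :: rat) ^ sign_exponent {i, k, 5} {k, 5} 1 = -1"
    by (simp_all add: sign_exponent_def srt card pos)
  show "target_index {i, k, 5} {i, 5} 1 = {k, 5}" "target_index {i, k, 5} {k, 5} 1 = {i, 5}"
    using assms by (auto simp: target_index_def srt)
qed

context node_chart
begin

lemma point_over_PP_in_Z: "v \<noteq> 0 \<Longrightarrow> ((P, P), proj_pt v) \<in> Z \<longleftrightarrow> v $ 1 * v $ 2 = v $ 3 * v $ 4"
  using P_in_U by (auto simp: Z_iff zw_PP intro!: exI[of _ 0])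

text \<open>These intersections are the four lines of the cycle on the quadric surface over \<open>(P, P)\<close>.\<close>

lemma T_cap_exceptional:
  assumes c: "component i m m' n n'"
  shows "T_cap {i, 5} = coordinate_line (P, P) m' n'"
proof (rule Set.set_eqI)
  fix t :: "'x blowup_pt"
  obtain v where v: "v \<noteq> 0" "snd t = proj_pt v" by (rule proj_obtain)
  have t: "t = (fst t, proj_pt v)" using v(2) by (simp add: prod_eq_iff)
  note mn = component_coordinates[OF c]
  have "t \<in> T_cap {i, 5} \<longleftrightarrow> fst t = (P, P) \<and> v $ m = 0 \<and> v $ n = 0"
  proof (cases "fst t = (P, P)")
    case True
    have "t \<in> T_cap {i, 5} \<longleftrightarrow> ((P, P), proj_pt v) \<in> Z \<and> v $ m = 0 \<and> v $ n = 0"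
      using t True T_component_iff[OF c v(1), of "(P, P)"] by (auto simp: T_cap_def T_5_iff)
    then show ?thesis using True by (auto simp: point_over_PP_in_Z[OF v(1)] mn(9))
  qed (auto simp: T_cap_def T_5_iff)
  also have "v $ m = 0 \<and> v $ n = 0 \<longleftrightarrow> (\<forall>j. j \<noteq> m' \<longrightarrow> j \<noteq> n' \<longrightarrow> v $ j = 0)"
  proof
    assume "v $ m = 0 \<and> v $ n = 0"
    then have "v $ j = 0" if "j \<noteq> m'" "j \<noteq> n'" for j using mn(2)[of j] that by auto
    then show "\<forall>j. j \<noteq> m' \<longrightarrow> j \<noteq> n' \<longrightarrow> v $ j = 0" by blast
  qed (use mn(3,5,6,8) in simp)
  also have "fst t = (P, P) \<and> (\<forall>j. j \<noteq> m' \<longrightarrow> j \<noteq> n' \<longrightarrow> v $ j = 0) \<longleftrightarrow> t \<in> coordinate_line (P, P) m' n'"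
  proof
    assume "fst t = (P, P) \<and> (\<forall>j. j \<noteq> m' \<longrightarrow> j \<noteq> n' \<longrightarrow> v $ j = 0)"
    then show "t \<in> coordinate_line (P, P) m' n'"
      unfolding coordinate_line_def using t v(1) by (intro CollectI exI[of _ "fst t"] exI[of _ v]) simp
  next
    assume "t \<in> coordinate_line (P, P) m' n'"
    then obtain w where w: "t = ((P, P), proj_pt w)" "w \<noteq> 0" "\<forall>j. j \<noteq> m' \<longrightarrow> j \<noteq> n' \<longrightarrow> w $ j = 0"
      by (auto simp: coordinate_line_def)
    then have "proj_pt w = proj_pt v" using v(2) by simp
    then obtain c where "v = c *s w" using proj_pt_eq_iff[OF w(2) v(1)] by blast
    then show "fst t = (P, P) \<and> (\<forall>j. j \<noteq> m' \<longrightarrow> j \<noteq> n' \<longrightarrow> v $ j = 0)" using w by simp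
  qed
  finally show "t \<in> T_cap {i, 5} \<longleftrightarrow> t \<in> coordinate_line (P, P) m' n'" .
qed

text \<open>Opposite components together would make all four homogeneous coordinates vanish.\<close>

lemma T_disjoint:
  "t \<in> T 1 \<Longrightarrow> t \<in> T 4 \<Longrightarrow> False" "t \<in> T 2 \<Longrightarrow> t \<in> T 3 \<Longrightarrow> False"
proof -
  obtain v where v: "v \<noteq> 0" "snd t = proj_pt v" by (rule proj_obtain)
  have t: "t = (fst t, proj_pt v)" using v(2) by (simp add: prod_eq_iff)
  have nz: "\<not> (v $ 1 = 0 \<and> v $ 2 = 0 \<and> v $ 3 = 0 \<and> v $ 4 = 0)"
    using v(1) by (simp add: vec_eq_iff forall_4)
  show "t \<in> T 1 \<Longrightarrow> t \<in> T 4 \<Longrightarrow> False" "t \<in> T 2 \<Longrightarrow> t \<in> T 3 \<Longrightarrow> False"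
    using T_iff[OF v(1), of "fst t"] nz unfolding t[symmetric] by blast+
qed

lemma T_cap_empty: "{1, 4} \<subseteq> I \<or> {2, 3} \<subseteq> I \<Longrightarrow> T_cap I = {}"
  using T_disjoint by (fastforce simp: T_cap_def simp del: One_nat_def)

definition axis_point :: "4 \<Rightarrow> 'x blowup_pt" where
  "axis_point j = ((P, P), proj_pt (axis j 1))"

lemma single_point_on_axis:
  assumes "\<And>q v. v \<noteq> 0 \<Longrightarrow> (q, proj_pt v) \<in> S \<longleftrightarrow> q = (P, P) \<and> (\<forall>l. l \<noteq> j \<longrightarrow> v $ l = 0)"
  shows "S = {axis_point j}"
proof (rule subset_antisym; rule subsetI)
  fix t assume t: "t \<in> S"
  obtain v where v: "v \<noteq> 0" "snd t = proj_pt v" by (rule proj_obtain)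
  have t_eq: "t = (fst t, proj_pt v)" using v(2) by (simp add: prod_eq_iff)
  then have *: "fst t = (P, P)" "\<And>l. l \<noteq> j \<Longrightarrow> v $ l = 0" using t assms[OF v(1), of "fst t"] by auto
  then have "v = v $ j *s axis j 1" by (auto simp: vec_eq_iff axis_nth)
  moreover have "v $ j \<noteq> 0" using * v(1) by (auto simp: vec_eq_iff) metis
  ultimately have "proj_pt v = proj_pt (axis j 1)"
    using proj_pt_smult[of "axis j 1" "v $ j"] by (simp add: axis_eq_0_iff)
  then show "t \<in> {axis_point j}" using t_eq * by (simp add: axis_point_def)
next
  fix t assume "t \<in> {axis_point j}"
  then show "t \<in> S" using assms[of "axis j 1" "(P, P)"] by (simp add: axis_point_def axis_nth axis_eq_0_iff)
qed

lemma triple_points: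
  "T_cap {1, 2, 5} = {axis_point 2}" "T_cap {1, 3, 5} = {axis_point 4}"
  "T_cap {2, 4, 5} = {axis_point 3}" "T_cap {3, 4, 5} = {axis_point 1}"
  by (rule single_point_on_axis;
      auto simp: T_cap_def T_iff T_5_iff point_over_PP_in_Z forall_4 simp del: One_nat_def)+

lemma T_cap_triple_empty: "I \<in> strata 3 \<Longrightarrow> I \<notin> nonempty_triples \<Longrightarrow> T_cap I = {}"
  unfolding nonempty_triples_def strata_3 insert_iff empty_iff by (elim disjE FalseE; simp add: T_cap_empty)

lemma T_cap_quadruple_empty: "I \<in> strata 4 \<Longrightarrow> T_cap I = {}"
  unfolding strata_4 insert_iff empty_iff by (elim disjE FalseE; simp add: T_cap_empty)

definition point_of :: "nat set \<Rightarrow> 'x blowup_pt" where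
  "point_of I = (THE t. T_cap I = {t})"

lemma T_cap_triple:
  assumes "I \<in> nonempty_triples"
  shows "T_cap I = {point_of I}"
proof -
  have "\<exists>t. T_cap I = {t}"
    using assms unfolding nonempty_triples_def insert_iff empty_iff
    by (elim disjE FalseE) (simp_all only: triple_points singleton_inject, blast+)
  then obtain t where t: "T_cap I = {t}" by blast
  then have "point_of I = t" unfolding point_of_def by (intro the_equality) auto
  then show ?thesis using t by simp
qed

definition unit_combination :: "(nat set \<Rightarrow> rat) \<Rightarrow> 'x H0_family" where
  "unit_combination a = (\<lambda>I t. if I \<in> nonempty_triples \<and> t \<in> T_cap I then a I else 0)"

lemma unit_combination_eq:
  "unit_combination a = (\<lambda>I t. a {1, 2, 5} * unit_class {1, 2, 5} I t + a {1, 3, 5} * unit_class {1, 3, 5} I t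
      + a {2, 4, 5} * unit_class {2, 4, 5} I t + a {3, 4, 5} * unit_class {3, 4, 5} I t)"
  unfolding unit_combination_def unit_class_def nonempty_triples_def by (intro ext sum_of_indicators triples_distinct)

lemma const_in_H0: "(\<lambda>t. if t \<in> V then a else 0) \<in> H0 V"
  unfolding H0_def
proof (intro CollectI conjI allI impI)
  have "continuous_map (top_of_set V) (discrete_topology UNIV) (\<lambda>t. a)"
    by (simp only: continuous_map_const topspace_discrete_topology UNIV_I simp_thms)
  then show "continuous_map (top_of_set V) (discrete_topology UNIV) (\<lambda>t. if t \<in> V then a else 0)"
    by (rule continuous_map_eq) (simp only: topspace_euclidean_subtopology if_True)
qed (simp only: if_False)

lemma triples_subset_strata: "I \<in> nonempty_triples \<Longrightarrow> I \<in> strata 3"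
  unfolding nonempty_triples_def strata_3 insert_iff empty_iff by (elim disjE FalseE; hypsubst; simp only: simp_thms)

lemma H0_outside: "c \<in> H0 V \<Longrightarrow> t \<notin> V \<Longrightarrow> c t = 0"
  unfolding H0_def by blast

lemma unit_combination_in_H0: "unit_combination a \<in> H0_strata 3"
  unfolding H0_strata_def
proof (intro CollectI conjI ballI allI impI)
  fix I
  have "unit_combination a I = (\<lambda>t. if t \<in> T_cap I then if I \<in> nonempty_triples then a I else 0 else 0)"
    unfolding unit_combination_def by (rule ext) presburger
  then show "unit_combination a I \<in> H0 (T_cap I)" by (simp only: const_in_H0)
next
  fix I assume "I \<notin> strata 3"
  then have "I \<notin> nonempty_triples" using triples_subset_strata by blast
  then show "unit_combination a I = (\<lambda>t. 0)" unfolding unit_combination_def by (simp only: simp_thms if_False)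
qed

lemma unit_combination_point: "I \<in> nonempty_triples \<Longrightarrow> unit_combination a I (point_of I) = a I"
  using T_cap_triple[of I] unfolding unit_combination_def by (simp only: simp_thms singletonI if_True)

lemma H0_strata_3_eq:
  assumes N: "N \<in> H0_strata 3"
  shows "N = unit_combination (\<lambda>I. N I (point_of I))"
proof (rule ext, rule ext)
  fix I t
  show "N I t = unit_combination (\<lambda>I. N I (point_of I)) I t"
  proof (cases "I \<in> nonempty_triples \<and> t \<in> T_cap I")
    case True
    then have "t = point_of I" using T_cap_triple[of I] by blast
    then show ?thesis using True unfolding unit_combination_def by (simp only: simp_thms if_True)
  next
    case False
    have "N I t = 0"
    proof (cases "I \<in> strata 3")
      case True
      then have "N I \<in> H0 (T_cap I)" using N unfolding H0_strata_def by blast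
      moreover have "t \<notin> T_cap I" using False T_cap_triple_empty[OF True] by blast
      ultimately show ?thesis by (rule H0_outside)
    next
      case False
      then have "N I = (\<lambda>t. 0)" using N unfolding H0_strata_def by blast
      then show ?thesis by (simp only:)
    qed
    then show ?thesis using False unfolding unit_combination_def by (simp only: if_False)
  qed
qed

lemma restriction_4: "restriction 4 N = (\<lambda>I t. 0)"
proof (rule ext, rule ext)
  fix I t
  have "\<not> (I \<in> strata 4 \<and> t \<in> T_cap I)" using T_cap_quadruple_empty[of I] by blast
  then show "restriction 4 N I t = 0" unfolding restriction_def by (simp only: if_False)
qed

lemma node_components: "Y 1 \<inter> Y 2 = {P}"
proof (rule subset_antisym; rule subsetI)
  fix x assume "x \<in> Y 1 \<inter> Y 2"
  then have x: "x \<in> U" "z x $ 1 = 0" "z x $ 2 = 0" unfolding Y_def by simp_all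
  have zx: "z x = 0" unfolding vec_eq_iff forall_2 using x(2,3) by simp
  have "x = the_inv_into U z (z x)" by (rule inv_z[OF x(1), symmetric])
  also have "\<dots> = the_inv_into U z (z P)" unfolding zx z_P ..
  also have "\<dots> = P" by (rule inv_z[OF P_in_U])
  finally have "x = P" .
  then show "x \<in> {P}" by (simp only: singletonI)
next
  fix x assume "x \<in> {P}"
  then have "x = P" by (simp only: singleton_iff)
  then show "x \<in> Y 1 \<inter> Y 2" unfolding Y_def using P_in_U z_P by simp
qed

end

section \<open>The product with a class on the triple strata\<close>

lemma sum_over_pairs:
  assumes "A \<noteq> B" "A \<noteq> C" "A \<noteq> D" "B \<noteq> C" "B \<noteq> D" "C \<noteq> D" "a1 \<noteq> a2" "b1 \<noteq> b2" "c1 \<noteq> c2" "d1 \<noteq> d2"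
  shows "sum h {(A, a1), (A, a2), (B, b1), (B, b2), (C, c1), (C, c2), (D, d1), (D, d2)} =
    (h (A, a1) + h (A, a2)) + (h (B, b1) + h (B, b2)) + (h (C, c1) + h (C, c2)) + (h (D, d1) + (h (D, d2) :: rat))"
  using assms by (simp add: add.assoc)

lemma pairs_distinct: "i < k \<Longrightarrow> k < 5 \<Longrightarrow> {i, 5} \<noteq> {k, 5 :: nat}"
  by (rule notI, drule arg_cong[of _ _ srt], simp)

lemma pair_in_strata_2: "1 \<le> i \<Longrightarrow> i < k \<Longrightarrow> k \<le> 5 \<Longrightarrow> {i, k} \<in> strata 2"
  by (simp add: strata_def)

text \<open>Only the strata \<open>i5\<close> receive a contribution; the double strata that leave the exceptional divisor play
the role of target only for empty triple strata.\<close>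

lemma admissible_triple_target:
  assumes "I \<in> nonempty_triples" "J \<in> strata 2" "admissible I J 1"
  shows "J \<subseteq> I" "\<exists>i. 1 \<le> i \<and> i < 5 \<and> target_index I J 1 = {i, 5}"
proof -
  have IJ: "(I, J) \<in> {(I, J). I \<in> nonempty_triples \<and> J \<in> strata 2 \<and> admissible I J 1}"
    by (simp only: mem_Collect_eq prod.case assms simp_thms)
  have E: "\<exists>i k. I = {i, k, 5} \<and> 1 \<le> i \<and> i < k \<and> k < 5 \<and> (J = {i, 5} \<or> J = {k, 5})" (is ?E)
    if "I = {i, k, 5}" "J = {i, 5} \<or> J = {k, 5}" "1 \<le> i" "i < k" "k < 5" for i k
    by (intro exI[of _ i] exI[of _ k] conjI that)
  from IJ have ?E
    unfolding admissible_triples insert_iff empty_iff prod.inject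
    by (elim disjE FalseE conjE)
      ((rule E[OF _ disjI1], assumption, assumption, simp, simp, simp)
        | (rule E[OF _ disjI2], assumption, assumption, simp, simp, simp))+
  then obtain i k where ik: "I = {i, k, 5}" "1 \<le> i" "i < k" "k < 5" "J = {i, 5} \<or> J = {k, 5}"
    by (elim exE conjE)
  show "J \<subseteq> I" using ik(5) unfolding ik(1) by (elim disjE; simp)
  show "\<exists>i. 1 \<le> i \<and> i < 5 \<and> target_index I J 1 = {i, 5}"
    using ik(5)
  proof
    assume "J = {i, 5}"
    then have "target_index I J 1 = {k, 5}" using sign_and_target(3)[OF ik(3,4)] ik(1) by (simp only:)
    then show ?thesis using ik(2-4) by (intro exI[of _ k] conjI) simp_all
  next
    assume "J = {k, 5}"
    then have "target_index I J 1 = {i, 5}" using sign_and_target(4)[OF ik(3,4)] ik(1) by (simp only:)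
    then show ?thesis using ik(2-4) by (intro exI[of _ i] conjI) simp_all
  qed
qed

lemma finite_strata: "finite (strata j)"
proof -
  have "strata j \<subseteq> Pow {1..5}" by (auto simp: strata_def)
  then show ?thesis by (rule finite_subset) simp
qed

context node_chart
begin

lemma H_2_exceptional:
  assumes "1 \<le> i" "i < 5"
  shows "H_2 (T_cap {i, 5}) \<cong> integer_group"
proof -
  have "i = 1 \<or> i = 2 \<or> i = 3 \<or> i = 4" using assms by linarith
  then have "component i 1 2 3 4 \<or> component i 1 2 4 3 \<or> component i 2 1 3 4 \<or> component i 2 1 4 3"
    by (elim disjE) (simp_all add: component_def)
  then obtain m m' n n' where c: "component i m m' n n'" by blast
  show ?thesis
    unfolding T_cap_exceptional[OF c] by (rule H_2_coordinate_line[OF component_coordinates(7)[OF c]])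
qed

context
  fixes \<mu> :: "nat set \<Rightarrow> ('x blowup_pt chain) set" and N :: "'x H0_family"
  assumes fund: "fundamental_classes \<mu>"
begin

text \<open>The degree of the contribution of the pair \<open>p\<close> to \<open>N \<cdot> y\<close>.\<close>

definition intersection :: "'x H0_family \<Rightarrow> nat set \<times> nat set \<Rightarrow> rat" where
  "intersection y p = (case p of (I, J) \<Rightarrow>
     (-1) ^ sign_exponent I J 1 * (\<Sum>q\<in>T_cap (I \<union> J). N I q * y J q))"

text \<open>Evaluated on the fundamental class used to define the Gysin map, the choice of that class cancels. Pairs
whose first member is an empty triple stratum drop out.\<close>

lemma mult_degree:
  assumes K: "K \<in> strata 2"
  shows "mult \<mu> N y K (\<mu> K) = (\<Sum>p \<in> {p \<in> {(I, J). I \<in> nonempty_triples \<and> J \<in> strata 2 \<and> admissible I J 1}.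
      (case p of (I, J) \<Rightarrow> target_index I J 1) = K}. intersection y p)"
  unfolding mult_def
proof (rule sum.mono_neutral_cong_right)
  have m: "fundamental_class (T_cap K) (\<mu> K)" using fund K unfolding fundamental_classes_def by blast
  let ?A = "{(I, J). I \<in> strata 3 \<and> J \<in> strata 2 \<and> admissible I J 1 \<and> target_index I J 1 = K}"
  let ?S = "{p \<in> {(I, J). I \<in> nonempty_triples \<and> J \<in> strata 2 \<and> admissible I J 1}.
      (case p of (I, J) \<Rightarrow> target_index I J 1) = K}"
  have "?A \<subseteq> strata 3 \<times> strata 2" by blast
  then show "finite ?A" by (rule finite_subset) (intro finite_cartesian_product finite_strata)
  show "?S \<subseteq> ?A" using triples_subset_strata by auto
  show "\<forall>p \<in> ?A - ?S. (case p of (I, J) \<Rightarrow> (-1) ^ sign_exponent I J 1 *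
       gysin_point (\<mu> K) (T_cap K) (T_cap (I \<union> J)) (\<lambda>t. N I t * y J t) (\<mu> K)) = 0"
  proof
    fix p assume p: "p \<in> ?A - ?S"
    obtain I J where IJ: "p = (I, J)" by (rule prod.exhaust)
    have "I \<in> strata 3" "I \<notin> nonempty_triples" using p unfolding IJ by auto
    then have "T_cap I = {}" by (rule T_cap_triple_empty)
    then have "T_cap (I \<union> J) = {}" unfolding T_cap_def by blast
    then have "gysin_point (\<mu> K) (T_cap K) (T_cap (I \<union> J)) (\<lambda>t. N I t * y J t) = (\<lambda>c. 0)"
      by (intro gysin_point_zero[OF m]) simp
    then show "(case p of (I, J) \<Rightarrow> (-1) ^ sign_exponent I J 1 *
       gysin_point (\<mu> K) (T_cap K) (T_cap (I \<union> J)) (\<lambda>t. N I t * y J t) (\<mu> K)) = 0"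
      unfolding IJ by simp
  qed
  fix p assume p: "p \<in> ?S"
  obtain I J where IJ: "p = (I, J)" by (rule prod.exhaust)
  have S: "I \<in> nonempty_triples" "J \<in> strata 2" "admissible I J 1" and tgt: "target_index I J 1 = K"
    using p unfolding IJ by auto
  obtain i where i: "1 \<le> i" "i < 5" "target_index I J 1 = {i, 5}"
    using admissible_triple_target(2)[OF S] by blast
  have "H_2 (T_cap K) \<cong> integer_group" using H_2_exceptional[OF i(1,2)] i(3) tgt by (simp only:)
  then have "gysin_point (\<mu> K) (T_cap K) (T_cap (I \<union> J)) (\<lambda>t. N I t * y J t) (\<mu> K)
      = (\<Sum>q\<in>T_cap (I \<union> J). N I q * y J q)"
    by (rule gysin_point_degree[OF m])
  then show "(case p of (I, J) \<Rightarrow> (-1) ^ sign_exponent I J 1 *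
       gysin_point (\<mu> K) (T_cap K) (T_cap (I \<union> J)) (\<lambda>t. N I t * y J t) (\<mu> K)) = intersection y p"
    unfolding IJ intersection_def by simp
qed

lemma push_mult_sum:
  "p2_push \<mu> (mult \<mu> N y) P = (\<Sum>p \<in> {(I, J). I \<in> nonempty_triples \<and> J \<in> strata 2 \<and> admissible I J 1}.
     pull_coeff2 (case p of (I, J) \<Rightarrow> target_index I J 1) * intersection y p)"
proof -
  let ?S = "{(I, J). I \<in> nonempty_triples \<and> J \<in> strata 2 \<and> admissible I J 1}"
  let ?t = "\<lambda>p. case p of (I, J) \<Rightarrow> target_index I J 1"
  have "finite ?S" unfolding admissible_triples by simp
  moreover have "?t ` ?S \<subseteq> strata 2"
  proof (rule image_subsetI)
    fix p assume p: "p \<in> ?S"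
    obtain I J where IJ: "p = (I, J)" by (rule prod.exhaust)
    then have S: "I \<in> nonempty_triples" "J \<in> strata 2" "admissible I J 1" using p by auto
    obtain i where "1 \<le> i" "i < 5" "target_index I J 1 = {i, 5}"
      using admissible_triple_target(2)[OF S] by blast
    then show "?t p \<in> strata 2" using pair_in_strata_2[of i 5] by (simp add: IJ)
  qed
  ultimately have group: "(\<Sum>K\<in>strata 2. \<Sum>p\<in>{p \<in> ?S. ?t p = K}. pull_coeff2 (?t p) * intersection y p)
      = (\<Sum>p\<in>?S. pull_coeff2 (?t p) * intersection y p)"
    by (rule sum.group[OF _ finite_strata])
  have "p2_push \<mu> (mult \<mu> N y) P = (\<Sum>K\<in>strata 2. pull_coeff2 K * mult \<mu> N y K (\<mu> K))"
    unfolding p2_push_def node_components by simp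
  also have "\<dots> = (\<Sum>K\<in>strata 2. \<Sum>p\<in>{p \<in> ?S. ?t p = K}. pull_coeff2 (?t p) * intersection y p)"
  proof (rule sum.cong[OF refl])
    fix K assume K: "K \<in> strata 2"
    show "pull_coeff2 K * mult \<mu> N y K (\<mu> K) = (\<Sum>p\<in>{p \<in> ?S. ?t p = K}. pull_coeff2 (?t p) * intersection y p)"
      unfolding mult_degree[OF K] sum_distrib_left by (rule sum.cong[OF refl]) simp
  qed
  finally show ?thesis unfolding group .
qed

text \<open>Both pairs meet in the same point. The sign is the parity of the position of the index that the Gysin map
drops.\<close>

lemma intersection_value:
  assumes "{i, k, 5} \<in> nonempty_triples" "1 \<le> i" "i < k" "k < 5"
  shows "intersection (p1_pull x) ({i, k, 5}, {i, 5}) =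
      N {i, k, 5} (point_of {i, k, 5}) * (pull_coeff1 {i, 5} * x P)"
    "intersection (p1_pull x) ({i, k, 5}, {k, 5}) =
      - (N {i, k, 5} (point_of {i, k, 5}) * (pull_coeff1 {k, 5} * x P))"
proof -
  let ?I = "{i, k, 5}"
  have un: "?I \<union> {i, 5} = ?I" "?I \<union> {k, 5} = ?I" by auto
  note pt = T_cap_triple[OF assms(1)]
  have "point_of ?I \<in> T_cap ?I" unfolding pt by (rule singletonI)
  then have mem: "point_of ?I \<in> T_cap {i, 5}" "point_of ?I \<in> T_cap {k, 5}" unfolding T_cap_def by auto
  have str: "{i, 5} \<in> strata 2" "{k, 5} \<in> strata 2" using assms(2-4) by (auto intro: pair_in_strata_2)
  have pull: "p1_pull x {i, 5} (point_of ?I) = pull_coeff1 {i, 5} * x P"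
    "p1_pull x {k, 5} (point_of ?I) = pull_coeff1 {k, 5} * x P"
    unfolding p1_pull_def using mem str by (simp_all only: simp_thms if_True)
  show "intersection (p1_pull x) (?I, {i, 5}) = N ?I (point_of ?I) * (pull_coeff1 {i, 5} * x P)"
    unfolding intersection_def prod.case un pt sign_and_target(1)[OF assms(3,4)] by (simp add: pull)
  show "intersection (p1_pull x) (?I, {k, 5}) = - (N ?I (point_of ?I) * (pull_coeff1 {k, 5} * x P))"
    unfolding intersection_def prod.case un pt sign_and_target(2)[OF assms(3,4)] by (simp add: pull)
qed

definition triple_degree :: "rat" where
  "triple_degree = - 2 * N {1, 2, 5} (point_of {1, 2, 5}) + 2 * N {1, 3, 5} (point_of {1, 3, 5})
     - 2 * N {2, 4, 5} (point_of {2, 4, 5}) + 2 * N {3, 4, 5} (point_of {3, 4, 5})"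

text \<open>Each corner contributes a \<open>2 \<times> 2\<close> determinant of coefficients, here \<open>-2\<close>, \<open>2\<close>, \<open>-2\<close> and \<open>2\<close>.\<close>

lemma push_mult: "p2_push \<mu> (mult \<mu> N (p1_pull x)) P = triple_degree * x P"
proof -
  have summand: "pull_coeff2 (target_index {i, k, 5} {i, 5} 1) * intersection (p1_pull x) ({i, k, 5}, {i, 5})
      + pull_coeff2 (target_index {i, k, 5} {k, 5} 1) * intersection (p1_pull x) ({i, k, 5}, {k, 5})
      = (pull_coeff1 {i, 5} * pull_coeff2 {k, 5} - pull_coeff1 {k, 5} * pull_coeff2 {i, 5})
        * N {i, k, 5} (point_of {i, k, 5}) * x P"
    if "{i, k, 5} \<in> nonempty_triples" "1 \<le> i" "i < k" "k < 5" for i k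
    unfolding intersection_value[OF that] sign_and_target(3,4)[OF that(3,4)] by (simp add: algebra_simps)
  have tr: "{1, 2, 5} \<in> nonempty_triples" "{1, 3, 5} \<in> nonempty_triples" "{2, 4, 5} \<in> nonempty_triples" "{3, 4, 5} \<in> nonempty_triples"
    unfolding nonempty_triples_def by (simp_all only: insert_iff simp_thms)
  have ineq: "1 \<le> (1::nat)" "1 \<le> (2::nat)" "1 \<le> (3::nat)" "(1::nat) < 2" "(1::nat) < 3" "(2::nat) < 4" "(3::nat) < 4"
    "(2::nat) < 5" "(3::nat) < 5" "(4::nat) < 5" by simp_all
  have "p2_push \<mu> (mult \<mu> N (p1_pull x)) P =
     (pull_coeff1 {1, 5} * pull_coeff2 {2, 5} - pull_coeff1 {2, 5} * pull_coeff2 {1, 5})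
        * N {1, 2, 5} (point_of {1, 2, 5}) * x P
   + (pull_coeff1 {1, 5} * pull_coeff2 {3, 5} - pull_coeff1 {3, 5} * pull_coeff2 {1, 5})
        * N {1, 3, 5} (point_of {1, 3, 5}) * x P
   + (pull_coeff1 {2, 5} * pull_coeff2 {4, 5} - pull_coeff1 {4, 5} * pull_coeff2 {2, 5})
        * N {2, 4, 5} (point_of {2, 4, 5}) * x P
   + (pull_coeff1 {3, 5} * pull_coeff2 {4, 5} - pull_coeff1 {4, 5} * pull_coeff2 {3, 5})
        * N {3, 4, 5} (point_of {3, 4, 5}) * x P"
    unfolding push_mult_sum admissible_triples
    unfolding sum_over_pairs[OF triples_distinct pairs_distinct[OF ineq(4,8)] pairs_distinct[OF ineq(5,9)]
        pairs_distinct[OF ineq(6,10)] pairs_distinct[OF ineq(7,10)]] prod.case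
    unfolding summand[OF tr(1) ineq(1,4,8)] summand[OF tr(2) ineq(1,5,9)] summand[OF tr(3) ineq(2,6,10)]
      summand[OF tr(4) ineq(3,7,10)] ..
  then show ?thesis
    unfolding pull_coeff_values triple_degree_def by (simp only:) (simp add: algebra_simps)
qed

text \<open>As \<open>Y\<^sub>1 \<inter> Y\<^sub>2\<close> is the single point \<open>P\<close>, the requirement that the composite be the identity is one equation.\<close>

lemma monodromy_cocycle_iff:
  "monodromy_cocycle \<mu> N \<longleftrightarrow> N \<in> H0_strata 3 \<and> triple_degree = 1"
proof
  assume cocycle: "monodromy_cocycle \<mu> N"
  let ?x = "\<lambda>p. if p \<in> {P} then 1 else 0 :: rat"
  have "?x \<in> H0 (Y 1 \<inter> Y 2)" unfolding node_components by (rule const_in_H0)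
  then have "p2_push \<mu> (mult \<mu> N (p1_pull ?x)) = ?x"
    using cocycle unfolding monodromy_cocycle_def by blast
  then have "p2_push \<mu> (mult \<mu> N (p1_pull ?x)) P = ?x P" by (rule fun_cong)
  then have "triple_degree = 1" unfolding push_mult by simp
  then show "N \<in> H0_strata 3 \<and> triple_degree = 1"
    using cocycle unfolding monodromy_cocycle_def by blast
next
  assume N: "N \<in> H0_strata 3 \<and> triple_degree = 1"
  have "p2_push \<mu> (mult \<mu> N (p1_pull x)) = x" if x: "x \<in> H0 {P}" for x
  proof
    fix p
    show "p2_push \<mu> (mult \<mu> N (p1_pull x)) p = x p"
    proof (cases "p = P")
      case True
      then show ?thesis using push_mult N by simp
    next
      case False
      then have "p2_push \<mu> (mult \<mu> N (p1_pull x)) p = 0"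
        unfolding p2_push_def node_components by (simp only: singleton_iff if_False)
      moreover have "x p = 0" using H0_outside[OF x] False by simp
      ultimately show ?thesis by simp
    qed
  qed
  then show "monodromy_cocycle \<mu> N"
    unfolding monodromy_cocycle_def node_components using N restriction_4 by blast
qed

end

end

section \<open>Boundaries and the class of the monodromy\<close>

lemma triple_cases:
  assumes "I \<in> nonempty_triples"
  obtains i k where "I = {i, k, 5}" "1 \<le> i" "i < k" "k < 5"
  using assms unfolding nonempty_triples_def insert_iff empty_iff
  by (elim disjE FalseE) (rule that, assumption, simp, simp, simp)+

context node_chart
begin

lemma restriction_3_triple:
  assumes "{i, k, 5} \<in> strata 3" "t \<in> T_cap {i, k, 5}" "i < k" "k < 5"
  shows "restriction 3 x {i, k, 5} t = x {k, 5} t - x {i, 5} t + x {i, k} t"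
proof -
  have srt: "srt {i, k, 5} = [i, k, 5]" using assms(3,4) by simp
  have sets: "{i, k, 5} - {i} = {k, 5}" "{i, k, 5} - {k} = {i, 5}" "{i, k, 5} - {5} = {i, k}"
    using assms(3,4) by auto
  have three: "{1..3} = {1, 2, 3 :: nat}" by auto
  show ?thesis
    unfolding restriction_def three using assms(1,2) by (simp add: srt sets)
qed

lemma restriction_add:
  "restriction j (\<lambda>J t. x J t + y J t) = (\<lambda>I t. restriction j x I t + restriction j y I t)"
  unfolding restriction_def by (intro ext) (simp add: sum.distrib distrib_left)

text \<open>A potential on the four lines of the cycle, as a class on the double strata.\<close>

definition point_boundary :: "(nat \<Rightarrow> rat) \<Rightarrow> 'x H0_family" where
  "point_boundary c = (\<lambda>J t. if t \<in> T_cap J then if J \<in> strata 2 \<and> 5 \<in> J then c (Min J) else 0 else 0)"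

lemma point_boundary_supported: "point_boundary c \<in> supported_classes"
proof -
  have "fst t = (P, P)" if "point_boundary c J t \<noteq> 0" for J t
  proof -
    have "t \<in> T_cap J" "5 \<in> J" using that unfolding point_boundary_def by presburger+
    then have "t \<in> T 5" unfolding T_cap_def by blast
    then show ?thesis by (simp add: T_5_iff)
  qed
  moreover have "point_boundary c J \<in> H0 (T_cap J)" for J
    unfolding point_boundary_def by (rule const_in_H0)
  moreover have "point_boundary c J = (\<lambda>t. 0)" if "J \<notin> strata 2" for J
    using that unfolding point_boundary_def by (intro ext) presburger
  ultimately show ?thesis unfolding supported_classes_def H0_strata_def by blast
qed

text \<open>At the corner \<open>ik5\<close> with \<open>i < k\<close>, the restriction is the difference of the values on \<open>k5\<close> and \<open>i5\<close>, as the class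
vanishes on \<open>ik\<close>. Here \<open>i = Min I\<close> and \<open>k = Min (I - {i})\<close>.\<close>

lemma restriction_point_boundary:
  "restriction 3 (point_boundary c) = unit_combination (\<lambda>I. c (Min (I - {Min I})) - c (Min I))"
proof (rule ext, rule ext)
  fix I t
  show "restriction 3 (point_boundary c) I t = unit_combination (\<lambda>I. c (Min (I - {Min I})) - c (Min I)) I t"
  proof (cases "I \<in> strata 3 \<and> t \<in> T_cap I")
    case False
    then have "\<not> (I \<in> nonempty_triples \<and> t \<in> T_cap I)" using triples_subset_strata by blast
    then show ?thesis using False unfolding restriction_def unit_combination_def by (simp only: if_False)
  next
    case True
    then have tr: "I \<in> nonempty_triples" using T_cap_triple_empty by blast
    then obtain i k where I: "I = {i, k, 5}" and ik: "1 \<le> i" "i < k" "k < 5" by (rule triple_cases)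
    have mem: "t \<in> T_cap {i, k, 5}" "{i, k, 5} \<in> strata 3" using True unfolding I by blast+
    have sub: "t \<in> T_cap {k, 5}" "t \<in> T_cap {i, 5}" using mem(1) unfolding T_cap_def by auto
    have str: "{k, 5} \<in> strata 2" "{i, 5} \<in> strata 2" using ik by (auto intro: pair_in_strata_2)
    have Min: "Min {k, 5} = k" "Min {i, 5} = i" "Min {i, k, 5} = i" "{i, k, 5} - {i} = {k, 5}" "5 \<notin> {i, k}"
      using ik by auto
    have "point_boundary c {k, 5} t = c k" "point_boundary c {i, 5} t = c i" "point_boundary c {i, k} t = 0"
      unfolding point_boundary_def using sub str Min by simp_all
    then have "restriction 3 (point_boundary c) I t = c k - c i"
      unfolding I restriction_3_triple[OF mem(2,1) ik(2,3)] by simp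
    also have "\<dots> = unit_combination (\<lambda>I. c (Min (I - {Min I})) - c (Min I)) I t"
      unfolding unit_combination_def using tr True by (simp add: I Min)
    finally show ?thesis .
  qed
qed

text \<open>By hypothesis the oriented sum of \<open>a\<close> around the cycle of lines vanishes, hence \<open>a\<close> is the difference of
a potential on the four lines.\<close>

lemma unit_combination_is_boundary:
  assumes "- a {1, 2, 5} + a {1, 3, 5} - a {2, 4, 5} + a {3, 4, 5} = 0"
  shows "\<exists>x\<in>supported_classes. unit_combination a = restriction 3 x"
proof -
  (* The potential is 0 on line 15 and propagates to 25 and 35, and from 25 to 45;
     the hypothesis makes it consistent at the corner 345. *)
  define c :: "nat \<Rightarrow> rat" where "c i = (if i = 2 then a {1, 2, 5} else if i = 3 then a {1, 3, 5}
     else if i = 4 then a {1, 2, 5} + a {2, 4, 5} else 0)" for i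
  have "a I = c (Min (I - {Min I})) - c (Min I)" if "I \<in> nonempty_triples" for I
  proof -
    have "{1, 2, 5} - {1} = {2, 5 :: nat}" "{1, 3, 5} - {1} = {3, 5 :: nat}"
      "{2, 4, 5} - {2} = {4, 5 :: nat}" "{3, 4, 5} - {3} = {4, 5 :: nat}" by auto
    then show ?thesis
      using that assms unfolding nonempty_triples_def insert_iff empty_iff
      by (elim disjE FalseE) (simp_all only: Min_insert finite.intros insert_not_empty simp_thms Min_singleton, simp_all add: c_def)
  qed
  then have "unit_combination a = unit_combination (\<lambda>I. c (Min (I - {Min I})) - c (Min I))"
    unfolding unit_combination_def by (intro ext) presburger
  then show ?thesis
    using point_boundary_supported restriction_point_boundary by (intro bexI[of _ "point_boundary c"]) simp_all
qed

lemma cocycle_combination: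
  assumes "fundamental_classes \<mu>"
  shows "monodromy_cocycle \<mu> N \<longleftrightarrow> (\<exists>a. N = unit_combination a \<and>
    - 2 * a {1, 2, 5} + 2 * a {1, 3, 5} - 2 * a {2, 4, 5} + 2 * a {3, 4, 5} = 1)"
proof
  assume "monodromy_cocycle \<mu> N"
  then show "\<exists>a. N = unit_combination a \<and>
    - 2 * a {1, 2, 5} + 2 * a {1, 3, 5} - 2 * a {2, 4, 5} + 2 * a {3, 4, 5} = 1"
    unfolding monodromy_cocycle_iff[OF assms] triple_degree_def[OF assms]
    by (intro exI[of _ "\<lambda>I. N I (point_of I)"] conjI H0_strata_3_eq) blast+
next
  assume "\<exists>a. N = unit_combination a \<and>
    - 2 * a {1, 2, 5} + 2 * a {1, 3, 5} - 2 * a {2, 4, 5} + 2 * a {3, 4, 5} = 1"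
  then obtain a where a: "N = unit_combination a"
    "- 2 * a {1, 2, 5} + 2 * a {1, 3, 5} - 2 * a {2, 4, 5} + 2 * a {3, 4, 5} = 1" by blast
  have tr: "{1, 2, 5} \<in> nonempty_triples" "{1, 3, 5} \<in> nonempty_triples" "{2, 4, 5} \<in> nonempty_triples" "{3, 4, 5} \<in> nonempty_triples"
    unfolding nonempty_triples_def by (simp_all only: insert_iff simp_thms)
  show "monodromy_cocycle \<mu> N"
    unfolding monodromy_cocycle_iff[OF assms] triple_degree_def[OF assms] a(1) tr[THEN unit_combination_point]
    using a(2) unit_combination_in_H0 by blast
qed

text \<open>Every space of boundaries contains the classes supported over \<open>(P, P)\<close>, and these suffice.\<close>

lemma cohomologous_cocycles:
  assumes fund: "fundamental_classes \<mu>" and B: "boundary_source B"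
    and M: "monodromy_cocycle \<mu> M" and N: "monodromy_cocycle \<mu> N"
  shows "(M, N) \<in> cohomologous B"
proof -
  obtain a where a: "M = unit_combination a"
    "- 2 * a {1, 2, 5} + 2 * a {1, 3, 5} - 2 * a {2, 4, 5} + 2 * a {3, 4, 5} = 1"
    using M unfolding cocycle_combination[OF fund] by blast
  obtain b where b: "N = unit_combination b"
    "- 2 * b {1, 2, 5} + 2 * b {1, 3, 5} - 2 * b {2, 4, 5} + 2 * b {3, 4, 5} = 1"
    using N unfolding cocycle_combination[OF fund] by blast
  have "\<exists>x\<in>supported_classes. unit_combination (\<lambda>I. a I - b I) = restriction 3 x"
    by (rule unit_combination_is_boundary) (use a(2) b(2) in linarith)
  moreover have "(\<lambda>I t. M I t - N I t) = unit_combination (\<lambda>I. a I - b I)"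
    unfolding a(1) b(1) unit_combination_def by (intro ext) simp
  ultimately obtain x where "x \<in> supported_classes" "(\<lambda>I t. M I t - N I t) = restriction 3 x"
    by (elim bexE) simp
  moreover have "supported_classes \<subseteq> B" using B unfolding boundary_source_def by blast
  ultimately show ?thesis
    unfolding cohomologous_def using unit_combination_in_H0 a(1) b(1) by blast
qed

lemma cohomologous_trans:
  assumes B: "boundary_source B" and "(L, M) \<in> cohomologous B" "(M, N) \<in> cohomologous B"
  shows "(L, N) \<in> cohomologous B"
proof -
  obtain x y where x: "x \<in> B" "(\<lambda>I t. L I t - M I t) = restriction 3 x" and y: "y \<in> B" "(\<lambda>I t. M I t - N I t) = restriction 3 y"
    and H: "L \<in> H0_strata 3" "N \<in> H0_strata 3"
    using assms(2,3) unfolding cohomologous_def by blast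
  have "(\<lambda>J t. x J t + y J t) \<in> B" using B x(1) y(1) unfolding boundary_source_def by blast
  moreover have "(\<lambda>I t. L I t - N I t) = restriction 3 (\<lambda>J t. x J t + y J t)"
    unfolding restriction_add x(2)[symmetric] y(2)[symmetric] by simp
  ultimately show ?thesis using H unfolding cohomologous_def by blast
qed

lemma cohomologous_class:
  assumes "fundamental_classes \<mu>" "boundary_source B" "monodromy_cocycle \<mu> M" "monodromy_cocycle \<mu> N"
  shows "cohomologous B `` {M} = cohomologous B `` {N}"
  using cohomologous_cocycles[OF assms(1,2,3,4)] cohomologous_cocycles[OF assms(1,2,4,3)]
    cohomologous_trans[OF assms(2)] by blast

lemma monodromy_description:
  assumes fund: "fundamental_classes \<mu>"
  shows "monodromy_cocycle \<mu> N \<longleftrightarrow>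
      (\<exists>a125 a135 a245 a345 :: rat.
         N = (\<lambda>I t. a125 * unit_class {1, 2, 5} I t + a135 * unit_class {1, 3, 5} I t
                  + a245 * unit_class {2, 4, 5} I t + a345 * unit_class {3, 4, 5} I t) \<and>
         - 2 * a125 + 2 * a135 - 2 * a245 + 2 * a345 = 1)"
    (is "_ \<longleftrightarrow> ?R")
proof
  assume "monodromy_cocycle \<mu> N"
  then show ?R unfolding cocycle_combination[OF fund] unit_combination_eq by blast
next
  assume ?R
  then obtain a125 a135 a245 a345 where N: "N = (\<lambda>I t. a125 * unit_class {1, 2, 5} I t + a135 * unit_class {1, 3, 5} I t
                  + a245 * unit_class {2, 4, 5} I t + a345 * unit_class {3, 4, 5} I t)"
    and eq: "- 2 * a125 + 2 * a135 - 2 * a245 + 2 * a345 = 1" by (elim exE conjE)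
  define a where "a I = (if I = {1, 2, 5} then a125 else if I = {1, 3, 5} then a135
      else if I = {2, 4, 5} then a245 else a345)" for I :: "nat set"
  have a: "a {1, 2, 5} = a125" "a {1, 3, 5} = a135" "a {2, 4, 5} = a245" "a {3, 4, 5} = a345"
    unfolding a_def using triples_distinct triples_distinct[symmetric] by (simp_all only: simp_thms if_True if_False)
  show "monodromy_cocycle \<mu> N"
    unfolding cocycle_combination[OF fund] unit_combination_eq
    by (rule exI[of _ a]) (simp only: a N eq simp_thms)
qed

lemma unique_class:
  assumes fund: "fundamental_classes \<mu>" and B: "boundary_source B"
  shows "\<exists>!\<zeta>. \<zeta> \<in> {N. monodromy_cocycle \<mu> N} // cohomologous B"
proof -
  obtain M where M: "monodromy_cocycle \<mu> M"
  proof -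
    (* a solution supported at the corner 135 *)
    have "- 2 * 0 + 2 * (1 / 2) - 2 * 0 + 2 * 0 = (1 :: rat)" by simp
    then show ?thesis using that monodromy_description[OF fund] by blast
  qed
  show ?thesis
  proof (rule ex1I[of _ "cohomologous B `` {M}"])
    show "cohomologous B `` {M} \<in> {N. monodromy_cocycle \<mu> N} // cohomologous B"
      using M by (intro quotientI) simp
    fix \<zeta> assume "\<zeta> \<in> {N. monodromy_cocycle \<mu> N} // cohomologous B"
    then obtain N where N: "monodromy_cocycle \<mu> N" "\<zeta> = cohomologous B `` {N}"
      by (auto elim: quotientE)
    then show "\<zeta> = cohomologous B `` {M}" using cohomologous_class[OF fund B N(1) M] by simp
  qed
qed

end

lemma local_parameters_node_chart:
  assumes "local_parameters A f P U z"
  obtains r where "node_chart f P U z r"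
proof -
  obtain r where r: "0 < r" "z ` U = {v. \<forall>i. norm (v $ i) < r}"
    using assms unfolding local_parameters_def by blast
  have "node_chart f P U z r"
    using assms r unfolding local_parameters_def compatible_chart_def by unfold_locales auto
  then show ?thesis by (rule that)
qed

theorem theorem4p2:
  fixes A :: "('x::{t2_space,second_countable_topology}, 2) chart set"
    and f :: "'x \<Rightarrow> complex"
    and \<iota> :: "'x \<Rightarrow> 'm::finite proj"
    and P :: 'x and U :: "'x set" and z :: "'x \<Rightarrow> complex^2"
    and \<mu> :: "nat set \<Rightarrow> ('x blowup_pt chain) set"
  assumes "semistable_degeneration A f \<iota>"
    and "local_parameters A f P U z"
    and "node.fundamental_classes f P U z \<mu>"
  shows "(\<forall>N. node.monodromy_cocycle f P U z \<mu> N \<longleftrightarrow>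
           (\<exists>a125 a135 a245 a345 :: rat.
              N = (\<lambda>I t. a125 * node.unit_class f P U z {1, 2, 5} I t
                       + a135 * node.unit_class f P U z {1, 3, 5} I t
                       + a245 * node.unit_class f P U z {2, 4, 5} I t
                       + a345 * node.unit_class f P U z {3, 4, 5} I t) \<and>
              - 2 * a125 + 2 * a135 - 2 * a245 + 2 * a345 = 1)) \<and>
         (\<forall>B. node.boundary_source f P U z B \<longrightarrow>
           (\<exists>!\<zeta>. \<zeta> \<in> {N. node.monodromy_cocycle f P U z \<mu> N} // node.cohomologous f P U z B))"
proof -
  obtain r where "node_chart f P U z r"
    using local_parameters_node_chart[OF assms(2)] by blast
  then interpret node_chart f P U z r .
  show ?thesis
    using monodromy_description[OF assms(3)] unique_class[OF assms(3)] by blast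
qed

end
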